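(* For all integers $r,g \ge 2$ and every real $\beta \in \left(0,\frac{1}{8r}\right]$, there exists an integer $D_{\beta}\ge 0$ such that the following holds for all $D\ge D_{\beta}$. Let $G$ be an $r$-uniform $(1\pm D^{-\beta})D$-regular multi-hypergraph in which every pair of distinct vertices has codegree at most $\log^2 D$, and let $H$ be a $g$-bounded configuration hypergraph of $G$ of girth at least five with $\Delta_i(H) \le \frac{\beta}{4g^2} \cdot D^{i-1}\log D$ for all $2\le i\le g$. If the maximum codegree of $G$ with $H$ is at most $\log^{2(g-1)} D$, then there exists an $H$-avoiding matching of $G$ of size at least $\frac{|V(G)|}{r} \cdot \left(1-D^{-\frac{\beta}{16r}}\right)$.
   Context: A multi-hypergraph consists of a vertex set $V$ and a multiset $E$ of subsets of $V$ (edges). It is $r$-uniform if every edge has size exactly $r$ and $g$-bounded if every edge has size at most $g$. It is $(1\pm\gamma)D$-regular if every vertex has degree (number of edges containing it, counted with multiplicity) between $(1-\gamma)D$ and $(1+\gamma)D$. The codegree of two distinct vertices is the number of edges containing both. A configuration hypergraph $H$ for $G$ is a hypergraph with $V(H)=E(G)$ whose edges are matchings of $G$ of size at least two; a matching of $G$ is $H$-avoiding if it contains no edge of $H$ as a subset. For a hypergraph $H$, $d_{H,i}(v)$ is the number of edges of size $i$ containing $v$ and $\Delta_i(H)=\max_v d_{H,i}(v)$. An $i$-cycle ($i\ge 2$) in a hypergraph is an alternating sequence $e_1,v_1,\ldots,e_i,v_i$ of distinct edges and distinct vertices with $v_j\in e_j\cap e_{(j+1)\bmod i}$ for all $j\in[i]$;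 the girth is the minimum $i$ such that an $i$-cycle exists. For $v\in V(G)$ and $e\in E(G)$ with $v\notin e$, the codegree of $v$ and $e$ is the number of edges of $H$ that contain $e$ and also contain some edge of $G$ incident with $v$; the maximum codegree of $G$ with $H$ is the maximum of this over all such pairs. Logarithms are natural. *)

theory Defs
  imports Complex_Main "HOL-Library.Extended_Nat"
begin

text \<open>
  Parallel edges of a multi-hypergraph \<open>G\<close> are distinct vertices of its configuration hypergraphs,
  so the multiset of edges is represented by a set of edge names together with a map sending each
  name to its set of vertices. Cardinalities of sets of names thereby count with multiplicity.
\<close>

record ('v, 'e) multi_hypergraph =
  verts :: "'v set"
  edges :: "'e set"
  ends :: "'e \<Rightarrow> 'v set"

definition finite_multi_hypergraph :: "('v, 'e) multi_hypergraph \<Rightarrow> bool" where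
  "finite_multi_hypergraph G \<longleftrightarrow>
     finite (verts G) \<and> finite (edges G) \<and> (\<forall>e\<in>edges G. ends G e \<subseteq> verts G)"

definition uniform :: "nat \<Rightarrow> ('v, 'e) multi_hypergraph \<Rightarrow> bool" where
  "uniform r G \<longleftrightarrow> (\<forall>e\<in>edges G. card (ends G e) = r)"

definition vertex_degree :: "('v, 'e) multi_hypergraph \<Rightarrow> 'v \<Rightarrow> nat" where
  "vertex_degree G v = card {e \<in> edges G. v \<in> ends G e}"

definition approx_regular :: "real \<Rightarrow> real \<Rightarrow> ('v, 'e) multi_hypergraph \<Rightarrow> bool" where
  "approx_regular \<gamma> D G \<longleftrightarrow>
     (\<forall>v\<in>verts G. (1 - \<gamma>) * D \<le> real (vertex_degree G v) \<and> real (vertex_degree G v) \<le> (1 + \<gamma>) * D)"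

definition codegree :: "('v, 'e) multi_hypergraph \<Rightarrow> 'v \<Rightarrow> 'v \<Rightarrow> nat" where
  "codegree G u v = card {e \<in> edges G. u \<in> ends G e \<and> v \<in> ends G e}"

definition matching :: "('v, 'e) multi_hypergraph \<Rightarrow> 'e set \<Rightarrow> bool" where
  "matching G M \<longleftrightarrow>
     M \<subseteq> edges G \<and> (\<forall>e\<in>M. \<forall>f\<in>M. e \<noteq> f \<longrightarrow> ends G e \<inter> ends G f = {})"

text \<open>
  A configuration hypergraph has no parallel edges, so it is given by its set of edges alone; its
  vertex set is \<open>edges G\<close>.
\<close>

definition configuration_hypergraph :: "('v, 'e) multi_hypergraph \<Rightarrow> 'e set set \<Rightarrow> bool" where
  "configuration_hypergraph G H \<longleftrightarrow> (\<forall>S\<in>H. matching G S \<and> 2 \<le> card S)"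

definition avoiding :: "'e set set \<Rightarrow> 'e set \<Rightarrow> bool" where
  "avoiding H M \<longleftrightarrow> \<not> (\<exists>S\<in>H. S \<subseteq> M)"

definition bounded_hypergraph :: "nat \<Rightarrow> 'a set set \<Rightarrow> bool" where
  "bounded_hypergraph g H \<longleftrightarrow> (\<forall>S\<in>H. card S \<le> g)"

definition size_degree :: "'a set set \<Rightarrow> nat \<Rightarrow> 'a \<Rightarrow> nat" where
  "size_degree H i x = card {S \<in> H. card S = i \<and> x \<in> S}"

text \<open>The maxima below range over finite sets of naturals; the inserted \<open>0\<close> only fixes the value
  of a maximum over no vertices or pairs.\<close>

definition max_size_degree :: "'a set \<Rightarrow> 'a set set \<Rightarrow> nat \<Rightarrow> nat" where
  "max_size_degree X H i = Max (insert 0 (size_degree H i ` X))"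

text \<open>Cycles are indexed from \<open>0\<close>, so that \<open>(j + 1) mod i\<close> is again an index.\<close>

definition is_cycle :: "'a set set \<Rightarrow> nat \<Rightarrow> (nat \<Rightarrow> 'a set) \<Rightarrow> (nat \<Rightarrow> 'a) \<Rightarrow> bool" where
  "is_cycle H i es xs \<longleftrightarrow>
     2 \<le> i \<and> es ` {..<i} \<subseteq> H \<and> inj_on es {..<i} \<and> inj_on xs {..<i} \<and>
     (\<forall>j<i. xs j \<in> es j \<inter> es ((j + 1) mod i))"

text \<open>The girth is \<open>\<infinity>\<close> if there are no cycles.\<close>

definition girth :: "'a set set \<Rightarrow> enat" where
  "girth H = (INF i\<in>{i. \<exists>es xs. is_cycle H i es xs}. enat i)"

definition config_codegree ::
  "('v, 'e) multi_hypergraph \<Rightarrow> 'e set set \<Rightarrow> 'v \<Rightarrow> 'e \<Rightarrow> nat" where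
  "config_codegree G H v e = card {S \<in> H. e \<in> S \<and> (\<exists>f\<in>S. v \<in> ends G f)}"

definition max_config_codegree :: "('v, 'e) multi_hypergraph \<Rightarrow> 'e set set \<Rightarrow> nat" where
  "max_config_codegree G H =
     Max (insert 0 {config_codegree G H v e | v e. v \<in> verts G \<and> e \<in> edges G \<and> v \<notin> ends G e})"

end

theory Submission
  imports Defs "HOL-Analysis.Infinite_Products" "HOL-Real_Asymp.Real_Asymp"
begin

text \<open>
  A nibble in which all choices are made by averaging a single potential, so that neither concentration
  inequalities nor the local lemma are needed. Every live edge \<open>e\<close> carries a weight \<open>y e\<close>. In a round
  each live edge is activated with probability \<open>\<epsilon> * y e\<close>, dummy trials equalise the probability that a
  vertex is hit, and surviving weights are rescaled so that the load of a surviving vertex is a martingale.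
  The danger of \<open>e\<close> is the weighted number of configurations through \<open>e\<close> that may still become blocking;
  counting an unactivated edge with the factor \<open>y f * (1 + 1 / (g * s))\<close>, where \<open>s\<close> is the fraction of
  vertices left, makes it a martingale up to the interaction of different configurations, which the girth
  and codegree hypotheses keep negligible.

  The potential is the number of matched vertices plus the expected future gain, minus
  quadratic penalties for loads and dangers above their thresholds. The Efron--Stein inequality bounds the
  expected increase of the penalties in one round, and an edge whose load or danger exceeds the hard limit
  is discarded at a cost paid for by its penalty. Hence some outcome of every round loses almost nothing,
  and after about \<open>ln D / \<epsilon>\<close> rounds the picked edges cover almost all vertices.
\<close>

section \<open>Independent trials on a finite set\<close>

text \<open>The factor \<open>1 + 1 / (g * s)\<close> comes from the recursion \<open>c s =
  \<epsilon> + (1 - \<epsilon>) * c ((1 - \<epsilon>) * s)\<close>, which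
  \<open>c s = 1 + C / s\<close> solves for every \<open>C\<close>. With \<open>C = 1 / g\<close> a
  product of fewer than \<open>g\<close> initial factors is at most 3, while a danger of at most
  \<open>K\<close> bounds the weight of the edges that would block \<open>e\<close> by
  \<open>g * s * K\<close>. As \<open>s\<close> decays geometrically, these bounds times \<epsilon>
  sum to at most \<open>g * K\<close>, which is \<open>\<beta> * ln D\<close>: blocking can inflate
  weights only by a fixed power of \<open>D\<close>, and this is why the degrees of \<open>H\<close>
  may carry a logarithm.

  Penalties are squared positive parts because the expectation of such a square exceeds its value at
  the mean by at most a variance. Variances are small because weights are far below 1 and each trial
  touches few summands.

  The girth serves twice: without cycles of length 2 and 3 the hazards of two edges of one
  configuration hardly overlap, and without cycles of length 4 a trial outside the hazard of
  \<open>e\<close> touches few configurations through \<open>e\<close>.\<close>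

text \<open>Expectation over a random subset of \<open>\<Omega>\<close> containing each \<open>z\<close> independently with probability
  \<open>p z\<close>. Conditioning on missing \<open>C\<close> amounts to replacing \<open>\<Omega>\<close> by \<open>\<Omega> - C\<close>.\<close>

definition bexp :: "('z \<Rightarrow> real) \<Rightarrow> 'z set \<Rightarrow> ('z set \<Rightarrow> real) \<Rightarrow> real" where
  "bexp p \<Omega> f = (\<Sum>Z\<in>Pow \<Omega>. (\<Prod>z\<in>Z. p z) * (\<Prod>z\<in>\<Omega> - Z. 1 - p z) * f Z)"

lemma bexp_empty [simp]: "bexp p {} f = f {}"
  by (simp add: bexp_def)

lemma bexp_cong: "(\<And>Z. Z \<subseteq> \<Omega> \<Longrightarrow> f Z = h Z) \<Longrightarrow> bexp p \<Omega> f = bexp p \<Omega> h"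
  unfolding bexp_def by (intro sum.cong) auto

lemma bexp_add: "bexp p \<Omega> (\<lambda>Z. f Z + h Z) = bexp p \<Omega> f + bexp p \<Omega> h"
  unfolding bexp_def by (simp add: algebra_simps sum.distrib)

lemma bexp_diff: "bexp p \<Omega> (\<lambda>Z. f Z - h Z) = bexp p \<Omega> f - bexp p \<Omega> h"
  unfolding bexp_def by (simp add: algebra_simps sum_subtractf)

lemma bexp_cmult: "bexp p \<Omega> (\<lambda>Z. c * f Z) = c * bexp p \<Omega> f"
  unfolding bexp_def by (simp add: sum_distrib_left algebra_simps)

lemma bexp_sum: "bexp p \<Omega> (\<lambda>Z. \<Sum>i\<in>I. f i Z) = (\<Sum>i\<in>I. bexp p \<Omega> (f i))"
  unfolding bexp_def sum_distrib_left by (rule sum.swap)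

lemma bexp_insert:
  assumes "finite \<Omega>" "z \<notin> \<Omega>"
  shows "bexp p (insert z \<Omega>) f = p z * bexp p \<Omega> (\<lambda>Z. f (insert z Z)) + (1 - p z) * bexp p \<Omega> f"
proof -
  let ?w = "\<lambda>Z. (\<Prod>z\<in>Z. p z) * (\<Prod>x\<in>insert z \<Omega> - Z. 1 - p x) * f Z"
  have fin: "finite (Pow \<Omega>)" using assms by simp
  have inj: "inj_on (insert z) (Pow \<Omega>)"
    using assms(2) by (auto simp: inj_on_def)
  have "bexp p (insert z \<Omega>) f = sum ?w (Pow \<Omega>) + sum ?w (insert z ` Pow \<Omega>)"
    unfolding bexp_def Pow_insert using assms by (subst sum.union_disjoint) auto
  moreover have "sum ?w (Pow \<Omega>) = (1 - p z) * bexp p \<Omega> f"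
    unfolding bexp_def sum_distrib_left
  proof (intro sum.cong refl)
    fix Z assume "Z \<in> Pow \<Omega>"
    then have "insert z \<Omega> - Z = insert z (\<Omega> - Z)" "z \<notin> \<Omega> - Z" "finite (\<Omega> - Z)" using assms by auto
    then show "?w Z = (1 - p z) * (prod p Z * (\<Prod>z\<in>\<Omega> - Z. 1 - p z) * f Z)" by simp
  qed
  moreover have "sum ?w (insert z ` Pow \<Omega>) = p z * bexp p \<Omega> (\<lambda>Z. f (insert z Z))"
    unfolding bexp_def sum_distrib_left sum.reindex[OF inj] o_def
  proof (intro sum.cong refl)
    fix Z assume Z: "Z \<in> Pow \<Omega>"
    then have "insert z \<Omega> - insert z Z = \<Omega> - Z" "z \<notin> Z" "finite Z"
      using assms by (auto intro: finite_subset)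
    then show "?w (insert z Z) =
        p z * (prod p Z * (\<Prod>z\<in>\<Omega> - Z. 1 - p z) * f (insert z Z))" by simp
  qed
  ultimately show ?thesis by simp
qed

lemma bexp_split:
  assumes "finite \<Omega>" "z \<in> \<Omega>"
  shows "bexp p \<Omega> f =
    p z * bexp p (\<Omega> - {z}) (\<lambda>Z. f (insert z Z)) + (1 - p z) * bexp p (\<Omega> - {z}) f"
  using bexp_insert[of "\<Omega> - {z}" z p f] assms by (simp add: insert_absorb)

lemma bexp_const [simp]: "finite \<Omega> \<Longrightarrow> bexp p \<Omega> (\<lambda>_. c) = c"
  by (induction \<Omega> rule: finite_induct) (auto simp: bexp_insert algebra_simps)

lemma bernoulli_weight_nonneg:
  assumes "\<And>z. z \<in> \<Omega> \<Longrightarrow> 0 \<le> p z \<and> p z \<le> (1::real)" "Z \<subseteq> \<Omega>"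
  shows "0 \<le> (\<Prod>z\<in>Z. p z) * (\<Prod>z\<in>\<Omega> - Z. 1 - p z)"
proof -
  have "0 \<le> (\<Prod>z\<in>Z. p z)" by (rule prod_nonneg) (use assms in blast)
  moreover have "0 \<le> (\<Prod>z\<in>\<Omega> - Z. 1 - p z)" by (rule prod_nonneg) (use assms in simp)
  ultimately show ?thesis by simp
qed

lemma bexp_mono:
  assumes "\<And>z. z \<in> \<Omega> \<Longrightarrow> 0 \<le> p z \<and> p z \<le> 1" "\<And>Z. Z \<subseteq> \<Omega> \<Longrightarrow> f Z \<le> h Z"
  shows "bexp p \<Omega> f \<le> bexp p \<Omega> h"
  unfolding bexp_def
proof (rule sum_mono)
  fix Z assume "Z \<in> Pow \<Omega>"
  then show "(\<Prod>z\<in>Z. p z) * (\<Prod>z\<in>\<Omega> - Z. 1 - p z) * f Z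
      \<le> (\<Prod>z\<in>Z. p z) * (\<Prod>z\<in>\<Omega> - Z. 1 - p z) * h Z"
    using bernoulli_weight_nonneg[of \<Omega> p Z] assms by (intro mult_left_mono) auto
qed

lemma bexp_nonneg:
  assumes "\<And>z. z \<in> \<Omega> \<Longrightarrow> 0 \<le> p z \<and> p z \<le> 1" "\<And>Z. Z \<subseteq> \<Omega> \<Longrightarrow> 0 \<le> f Z"
  shows "0 \<le> bexp p \<Omega> f"
  using bexp_mono[of \<Omega> p "\<lambda>_. 0" f] assms bexp_cmult[of p \<Omega> 0 "\<lambda>_. 0"] by simp

text \<open>The only passage from expectations to an actual outcome. It controls one real-valued
  function at a time, so a single potential has to carry every requirement of a round.\<close>

lemma bexp_le_some:
  assumes "finite \<Omega>" "\<And>z. z \<in> \<Omega> \<Longrightarrow> 0 \<le> p z \<and> p z \<le> 1"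
  shows "\<exists>Z\<subseteq>\<Omega>. bexp p \<Omega> f \<le> f Z"
proof -
  let ?m = "Max (f ` Pow \<Omega>)"
  have fin: "finite (f ` Pow \<Omega>)" "f ` Pow \<Omega> \<noteq> {}" using assms by auto
  have "bexp p \<Omega> f \<le> bexp p \<Omega> (\<lambda>_. ?m)"
    using fin(1) by (intro bexp_mono assms(2) Max_ge) auto
  then have "bexp p \<Omega> f \<le> ?m" using assms by simp
  moreover obtain Z where "Z \<in> Pow \<Omega>" "?m = f Z" using Max_in[OF fin] by (elim imageE)
  ultimately show ?thesis by auto
qed

lemma bexp_disjoint:
  assumes "finite \<Omega>" "C \<subseteq> \<Omega>"
  shows "bexp p \<Omega> (\<lambda>Z. if Z \<inter> C = {} then f Z else 0) = (\<Prod>z\<in>C. 1 - p z) * bexp p (\<Omega> - C) f"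
proof -
  have "bexp p \<Omega> (\<lambda>Z. if Z \<inter> C = {} then f Z else 0)
     = (\<Sum>Z\<in>Pow (\<Omega> - C). (\<Prod>z\<in>Z. p z) * (\<Prod>z\<in>\<Omega> - Z. 1 - p z) * f Z)"
    unfolding bexp_def
  proof (rule sum.mono_neutral_cong_right)
    show "finite (Pow \<Omega>)" using assms by simp
    show "Pow (\<Omega> - C) \<subseteq> Pow \<Omega>" by blast
  next
    show "\<forall>Z\<in>Pow \<Omega> - Pow (\<Omega> - C).
      prod p Z * (\<Prod>z\<in>\<Omega> - Z. 1 - p z) * (if Z \<inter> C = {} then f Z else 0) = 0"
      by (intro ballI) (use assms in \<open>simp, blast\<close>)
  next
    fix Z assume "Z \<in> Pow (\<Omega> - C)"
    then have "Z \<inter> C = {}" by blast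
    then show "prod p Z * (\<Prod>z\<in>\<Omega> - Z. 1 - p z) * (if Z \<inter> C = {} then f Z else 0) =
      prod p Z * (\<Prod>z\<in>\<Omega> - Z. 1 - p z) * f Z" by simp
  qed
  also have "\<dots> = (\<Sum>Z\<in>Pow (\<Omega> - C).
      (\<Prod>z\<in>C. 1 - p z) * ((\<Prod>z\<in>Z. p z) * (\<Prod>z\<in>\<Omega> - C - Z. 1 - p z) * f Z))"
  proof (intro sum.cong refl)
    fix Z assume "Z \<in> Pow (\<Omega> - C)"
    then have "\<Omega> - Z = C \<union> (\<Omega> - C - Z)" using assms by auto
    then have "(\<Prod>z\<in>\<Omega> - Z. 1 - p z) = (\<Prod>z\<in>C. 1 - p z) * (\<Prod>z\<in>\<Omega> - C - Z. 1 - p z)"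
      using prod.union_disjoint[of C "\<Omega> - C - Z" "\<lambda>z. 1 - p z"] finite_subset[OF assms(2,1)] assms(1)
      by (simp only: finite_Diff) blast
    then show "prod p Z * (\<Prod>z\<in>\<Omega> - Z. 1 - p z) * f Z =
      (\<Prod>z\<in>C. 1 - p z) * (prod p Z * (\<Prod>z\<in>\<Omega> - C - Z. 1 - p z) * f Z)" by simp
  qed
  finally show ?thesis by (simp add: bexp_def sum_distrib_left)
qed

lemma bexp_supset:
  assumes "finite \<Omega>" "W \<subseteq> \<Omega>"
  shows "bexp p \<Omega> (\<lambda>Z. if W \<subseteq> Z then 1 else 0) = (\<Prod>z\<in>W. p z)"
  using assms
proof (induction \<Omega> arbitrary: W rule: finite_induct)
  case (insert z \<Omega>)
  show ?case
  proof (cases "z \<in> W")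
    case True
    have "bexp p \<Omega> (\<lambda>Z. if W \<subseteq> Z then 1 else 0) = bexp p \<Omega> (\<lambda>Z. 0)"
      using True insert.hyps by (intro bexp_cong) auto
    moreover have "bexp p \<Omega> (\<lambda>Z. if W \<subseteq> insert z Z then 1 else 0)
        = bexp p \<Omega> (\<lambda>Z. if W - {z} \<subseteq> Z then 1 else 0)"
      by (intro bexp_cong) (auto simp: subset_insert_iff)
    moreover have "\<dots> = prod p (W - {z})" using insert.prems by (intro insert.IH) auto
    moreover have "prod p W = p z * prod p (W - {z})"
      using True insert by (intro prod.remove) (auto intro: finite_subset)
    ultimately show ?thesis using insert.hyps by (simp add: bexp_insert)
  next
    case False
    then have "W \<subseteq> \<Omega>" using insert.prems by auto
    moreover from False have "(\<lambda>Z. if W \<subseteq> insert z Z then 1 else 0 :: real) = (\<lambda>Z. if W \<subseteq> Z then 1 else 0)"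
      by (auto simp: fun_eq_iff subset_insert_iff)
    ultimately show ?thesis using insert by (simp add: bexp_insert algebra_simps)
  qed
qed auto

text \<open>If \<open>W\<close> and \<open>C\<close> meet, the event is impossible; otherwise
  independence gives equality. The inequality spares its users this distinction.\<close>

lemma bexp_supset_disjoint_le:
  assumes "finite \<Omega>" "W \<subseteq> \<Omega>" "C \<subseteq> \<Omega>" "\<And>z. z \<in> \<Omega> \<Longrightarrow> 0 \<le> p z \<and> p z \<le> 1"
  shows "bexp p \<Omega> (\<lambda>Z. if W \<subseteq> Z \<and> Z \<inter> C = {} then 1 else 0) \<le> (\<Prod>z\<in>W. p z) * (\<Prod>z\<in>C. 1 - p z)"
proof (cases "W \<inter> C = {}")
  case True
  have "bexp p \<Omega> (\<lambda>Z. if W \<subseteq> Z \<and> Z \<inter> C = {} then 1 else 0)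
      = bexp p \<Omega> (\<lambda>Z. if Z \<inter> C = {} then (if W \<subseteq> Z then 1 else 0) else 0)"
    by (intro bexp_cong) auto
  also have "\<dots> = (\<Prod>z\<in>C. 1 - p z) * (\<Prod>z\<in>W. p z)"
    using True assms by (subst bexp_disjoint) (auto intro!: bexp_supset)
  finally show ?thesis by simp
next
  case False
  then have "bexp p \<Omega> (\<lambda>Z. if W \<subseteq> Z \<and> Z \<inter> C = {} then 1 else 0) = bexp p \<Omega> (\<lambda>_. 0)"
    by (intro bexp_cong) auto
  then show ?thesis using assms by (auto intro!: mult_nonneg_nonneg prod_nonneg)
qed

section \<open>Variance and the Efron--Stein inequality\<close>

lemma bexp_variance:
  assumes "finite \<Omega>"
  shows "bexp p \<Omega> (\<lambda>Z. (f Z - bexp p \<Omega> f)\<^sup>2) = bexp p \<Omega> (\<lambda>Z. (f Z)\<^sup>2) - (bexp p \<Omega> f)\<^sup>2"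
proof -
  let ?m = "bexp p \<Omega> f"
  have "bexp p \<Omega> (\<lambda>Z. (f Z - ?m)\<^sup>2) = bexp p \<Omega> (\<lambda>Z. ((f Z)\<^sup>2 + ?m\<^sup>2) - (2 * ?m) * f Z)"
    by (intro bexp_cong) (simp add: power2_diff)
  also have "\<dots> = bexp p \<Omega> (\<lambda>Z. (f Z)\<^sup>2) - ?m\<^sup>2"
    using assms unfolding bexp_diff bexp_add bexp_cmult by (simp add: power2_eq_square)
  finally show ?thesis .
qed

lemma bexp_square_le:
  assumes "finite \<Omega>" "\<And>z. z \<in> \<Omega> \<Longrightarrow> 0 \<le> p z \<and> p z \<le> 1"
  shows "(bexp p \<Omega> f)\<^sup>2 \<le> bexp p \<Omega> (\<lambda>Z. (f Z)\<^sup>2)"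
proof -
  have "0 \<le> bexp p \<Omega> (\<lambda>Z. (f Z - bexp p \<Omega> f)\<^sup>2)"
    using assms(2) by (intro bexp_nonneg) auto
  then show ?thesis unfolding bexp_variance[OF assms(1)] by simp
qed

text \<open>By the law of total variance, a new coordinate \<open>z\<close> adds to the averaged
  conditional variances, handled by induction, the variance
  \<open>p z * (1 - p z) * (a1 - a0)^2\<close> of the two conditional means. Jensen's inequality
  bounds \<open>(a1 - a0)^2\<close> by the mean squared effect of \<open>z\<close>.\<close>

lemma efron_stein:
  assumes "finite \<Omega>" "\<And>z. z \<in> \<Omega> \<Longrightarrow> 0 \<le> p z \<and> p z \<le> 1"
  shows "bexp p \<Omega> (\<lambda>Z. (f Z)\<^sup>2) - (bexp p \<Omega> f)\<^sup>2
    \<le> (\<Sum>z\<in>\<Omega>. p z * bexp p \<Omega> (\<lambda>Z. (f (insert z Z) - f (Z - {z}))\<^sup>2))"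
  using assms
proof (induction \<Omega> arbitrary: f rule: finite_induct)
  case (insert z \<Omega>)
  let ?f1 = "\<lambda>Z. f (insert z Z)"
  let ?D = "\<lambda>w Z. (f (insert w Z) - f (Z - {w}))\<^sup>2"
  let ?D1 = "\<lambda>w Z. (?f1 (insert w Z) - ?f1 (Z - {w}))\<^sup>2"
  define a1 a0 where "a1 = bexp p \<Omega> ?f1" and "a0 = bexp p \<Omega> f"
  have p: "0 \<le> p z" "p z \<le> 1" "\<And>w. w \<in> \<Omega> \<Longrightarrow> 0 \<le> p w \<and> p w \<le> 1" using insert.prems by auto
  have IH: "bexp p \<Omega> (\<lambda>Z. (h Z)\<^sup>2) - (bexp p \<Omega> h)\<^sup>2
      \<le> (\<Sum>z\<in>\<Omega>. p z * bexp p \<Omega> (\<lambda>Z. (h (insert z Z) - h (Z - {z}))\<^sup>2))" for h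
    using insert.IH p(3) by blast
  \<comment> \<open>The discrete derivative in direction \<open>z\<close> ignores whether
    \<open>z\<close> belongs to the set, so both branches of the split at \<open>z\<close>
    agree.\<close>
  have Dz: "bexp p (insert z \<Omega>) (?D z) = bexp p \<Omega> (\<lambda>Z. (?f1 Z - f Z)\<^sup>2)"
  proof -
    have "bexp p \<Omega> (\<lambda>Z. ?D z (insert z Z)) = bexp p \<Omega> (\<lambda>Z. (?f1 Z - f Z)\<^sup>2)"
    proof (intro bexp_cong)
      fix Z assume "Z \<subseteq> \<Omega>"
      then have "insert z Z - {z} = Z" using insert.hyps by auto
      then show "?D z (insert z Z) = (?f1 Z - f Z)\<^sup>2" by simp
    qed
    moreover have "bexp p \<Omega> (?D z) = bexp p \<Omega> (\<lambda>Z. (?f1 Z - f Z)\<^sup>2)"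
    proof (intro bexp_cong)
      fix Z assume "Z \<subseteq> \<Omega>"
      then have "Z - {z} = Z" using insert.hyps by auto
      then show "?D z Z = (?f1 Z - f Z)\<^sup>2" by simp
    qed
    ultimately show ?thesis using insert.hyps by (simp add: bexp_insert algebra_simps)
  qed
  have Dw: "bexp p (insert z \<Omega>) (?D w) = p z * bexp p \<Omega> (?D1 w) + (1 - p z) * bexp p \<Omega> (?D w)"
    if "w \<in> \<Omega>" for w
  proof -
    have "z \<noteq> w" using that insert.hyps by auto
    then have "bexp p \<Omega> (\<lambda>Z. ?D w (insert z Z)) = bexp p \<Omega> (?D1 w)"
      by (intro bexp_cong) (simp add: insert_commute insert_Diff_if)
    then show ?thesis using insert.hyps by (simp add: bexp_insert)
  qed
  have "(a1 - a0)\<^sup>2 = (bexp p \<Omega> (\<lambda>Z. ?f1 Z - f Z))\<^sup>2" by (simp add: a1_def a0_def bexp_diff)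
  also have "\<dots> \<le> bexp p \<Omega> (\<lambda>Z. (?f1 Z - f Z)\<^sup>2)"
    using insert.hyps p by (intro bexp_square_le) auto
  finally have J: "(a1 - a0)\<^sup>2 \<le> bexp p \<Omega> (\<lambda>Z. (?f1 Z - f Z)\<^sup>2)" .
  have "p z * a1\<^sup>2 + (1 - p z) * a0\<^sup>2 - (p z * a1 + (1 - p z) * a0)\<^sup>2 = p z * (1 - p z) * (a1 - a0)\<^sup>2"
    by (simp add: power2_eq_square algebra_simps)
  also have "\<dots> \<le> p z * (a1 - a0)\<^sup>2"
    using p by (intro mult_right_mono) (auto simp: mult_left_le)
  also have "\<dots> \<le> p z * bexp p \<Omega> (\<lambda>Z. (?f1 Z - f Z)\<^sup>2)"
    using p J by (intro mult_left_mono) auto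
  finally have 1: "p z * a1\<^sup>2 + (1 - p z) * a0\<^sup>2 - (p z * a1 + (1 - p z) * a0)\<^sup>2
      \<le> p z * bexp p (insert z \<Omega>) (?D z)" unfolding Dz .
  have 2: "p z * bexp p \<Omega> (\<lambda>Z. (?f1 Z)\<^sup>2) + (1 - p z) * bexp p \<Omega> (\<lambda>Z. (f Z)\<^sup>2)
      \<le> p z * (a1\<^sup>2 + (\<Sum>w\<in>\<Omega>. p w * bexp p \<Omega> (?D1 w)))
        + (1 - p z) * (a0\<^sup>2 + (\<Sum>w\<in>\<Omega>. p w * bexp p \<Omega> (?D w)))"
    using IH[of ?f1] IH[of f] p unfolding a1_def a0_def by (intro add_mono mult_left_mono) auto
  have 3: "(\<Sum>w\<in>\<Omega>. p w * bexp p (insert z \<Omega>) (?D w))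
      = p z * (\<Sum>w\<in>\<Omega>. p w * bexp p \<Omega> (?D1 w)) + (1 - p z) * (\<Sum>w\<in>\<Omega>. p w * bexp p \<Omega> (?D w))"
    unfolding sum_distrib_left sum.distrib[symmetric]
    by (intro sum.cong refl) (simp only: Dw, simp add: algebra_simps)
  have 4: "(\<Sum>w\<in>insert z \<Omega>. p w * bexp p (insert z \<Omega>) (?D w))
     = p z * bexp p (insert z \<Omega>) (?D z) + (\<Sum>w\<in>\<Omega>. p w * bexp p (insert z \<Omega>) (?D w))"
    using insert.hyps by simp
  have 5: "bexp p (insert z \<Omega>) (\<lambda>Z. (f Z)\<^sup>2)
     = p z * bexp p \<Omega> (\<lambda>Z. (?f1 Z)\<^sup>2) + (1 - p z) * bexp p \<Omega> (\<lambda>Z. (f Z)\<^sup>2)"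
    and 6: "bexp p (insert z \<Omega>) f = p z * a1 + (1 - p z) * a0"
    using insert.hyps by (simp_all add: bexp_insert a1_def a0_def)
  show ?case unfolding 4 5 6 3 using 1 2 by (simp add: algebra_simps)
qed auto

text \<open>Around the mean \<open>m\<close> the squared positive part lies below its tangent plus
  \<open>(x - m)^2\<close>. The linear term vanishes in expectation and the quadratic one becomes
  the variance.\<close>

lemma bexp_pos_part_square_le:
  assumes "finite \<Omega>" "\<And>z. z \<in> \<Omega> \<Longrightarrow> 0 \<le> p z \<and> p z \<le> 1"
  shows "bexp p \<Omega> (\<lambda>Z. (max 0 (f Z - c))\<^sup>2)
    \<le> (max 0 (bexp p \<Omega> f - c))\<^sup>2 + (bexp p \<Omega> (\<lambda>Z. (f Z)\<^sup>2) - (bexp p \<Omega> f)\<^sup>2)"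
proof -
  let ?m = "bexp p \<Omega> f"
  have pt: "(max 0 (x - c))\<^sup>2 \<le> (max 0 (m - c))\<^sup>2 + 2 * max 0 (m - c) * (x - m) + (x - m)\<^sup>2"
    for x m :: real
  proof (cases "m \<le> c")
    case m: True
    then have m0: "max 0 (m - c) = 0" by simp
    show ?thesis
    proof (cases "x \<le> c")
      case True
      then have "max 0 (x - c) = 0" by simp
      then show ?thesis by (simp add: m0)
    next
      case False
      then have "(x - c)\<^sup>2 \<le> (x - m)\<^sup>2" using m by (intro power_mono) auto
      moreover have "max 0 (x - c) = x - c" using False by simp
      ultimately show ?thesis by (simp add: m0)
    qed
  next
    case m: False
    then have m0: "max 0 (m - c) = m - c" by simp
    have eq: "(m - c)\<^sup>2 + 2 * (m - c) * (x - m) + (x - m)\<^sup>2 = (x - c)\<^sup>2"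
      by (simp add: power2_eq_square algebra_simps)
    have "(max 0 (x - c))\<^sup>2 \<le> (x - c)\<^sup>2"
      by (cases "x \<le> c") (auto simp: max_def)
    then show ?thesis unfolding m0 eq .
  qed
  have "bexp p \<Omega> (\<lambda>Z. (max 0 (f Z - c))\<^sup>2)
     \<le> bexp p \<Omega> (\<lambda>Z. (max 0 (?m - c))\<^sup>2 + 2 * max 0 (?m - c) * (f Z - ?m) + (f Z - ?m)\<^sup>2)"
    by (rule bexp_mono[OF assms(2) pt])
  also have "\<dots> = (max 0 (?m - c))\<^sup>2 + (bexp p \<Omega> (\<lambda>Z. (f Z)\<^sup>2) - ?m\<^sup>2)"
    using assms(1) by (simp add: bexp_add bexp_cmult bexp_diff bexp_variance)
  finally show ?thesis .
qed

text \<open>Both terms of the split at \<open>z\<close> are nonnegative, so each alone is at most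
  the whole. This turns values at a modified set back into values at the random set, at the price of
  the probability that the modification holds anyway.\<close>

lemma bexp_insert_le:
  assumes "finite \<Omega>" "z \<in> \<Omega>" "\<And>w. w \<in> \<Omega> \<Longrightarrow> 0 \<le> p w \<and> p w \<le> 1"
    "\<And>Z. Z \<subseteq> \<Omega> \<Longrightarrow> 0 \<le> f Z"
  shows "p z * bexp p \<Omega> (\<lambda>Z. f (insert z Z)) \<le> bexp p \<Omega> f"
    and "(1 - p z) * bexp p \<Omega> (\<lambda>Z. f (Z - {z})) \<le> bexp p \<Omega> f"
proof -
  have "bexp p \<Omega> (\<lambda>Z. f (insert z Z)) = bexp p (\<Omega> - {z}) (\<lambda>Z. f (insert z Z))"
    using bexp_split[OF assms(1,2), of p "\<lambda>Z. f (insert z Z)"] by (simp add: algebra_simps)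
  moreover have "0 \<le> bexp p (\<Omega> - {z}) f"
    using assms by (intro bexp_nonneg) auto
  moreover have "0 \<le> bexp p (\<Omega> - {z}) (\<lambda>Z. f (insert z Z))"
    using assms(1-3) by (intro bexp_nonneg assms(4)) auto
  moreover have "bexp p \<Omega> (\<lambda>Z. f (Z - {z})) = bexp p (\<Omega> - {z}) f"
  proof -
    have "bexp p (\<Omega> - {z}) (\<lambda>Z. f (Z - {z})) = bexp p (\<Omega> - {z}) f"
      by (intro bexp_cong arg_cong[of _ _ f]) auto
    moreover have "bexp p (\<Omega> - {z}) (\<lambda>Z. f (insert z Z - {z})) = bexp p (\<Omega> - {z}) f"
      by (intro bexp_cong arg_cong[of _ _ f]) auto
    ultimately show ?thesis
      using bexp_split[OF assms(1,2), of p "\<lambda>Z. f (Z - {z})"] by (simp add: algebra_simps)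
  qed
  ultimately show "p z * bexp p \<Omega> (\<lambda>Z. f (insert z Z)) \<le> bexp p \<Omega> f"
    and "(1 - p z) * bexp p \<Omega> (\<lambda>Z. f (Z - {z})) \<le> bexp p \<Omega> f"
    using bexp_split[OF assms(1,2), of p f] assms(2,3) by auto
qed

text \<open>By Efron--Stein, sparse overlap between the coordinate sets \<open>N i\<close> makes the variance
  linear in the summands rather than quadratic.\<close>

lemma bexp_variance_sum_le:
  fixes F :: "'i \<Rightarrow> 'z set \<Rightarrow> real" and N W :: "'i \<Rightarrow> 'z set"
  assumes fin: "finite \<Omega>" "finite I" and p: "\<And>z. z \<in> \<Omega> \<Longrightarrow> 0 \<le> p z \<and> p z \<le> 1 / 2"
    and F: "\<And>i Z. i \<in> I \<Longrightarrow> Z \<subseteq> \<Omega> \<Longrightarrow> 0 \<le> F i Z \<and> F i Z \<le> b"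
    and N: "\<And>i z Z. i \<in> I \<Longrightarrow> Z \<subseteq> \<Omega> \<Longrightarrow> z \<in> \<Omega> - N i \<Longrightarrow> F i (insert z Z) = F i (Z - {z})"
    and W: "\<And>i z Z. i \<in> I \<Longrightarrow> Z \<subseteq> \<Omega> \<Longrightarrow> z \<in> \<Omega> - W i \<Longrightarrow> F i (insert z Z) \<le> F i (Z - {z})"
    and finW: "\<And>i. i \<in> I \<Longrightarrow> finite (W i)"
    and cap: "\<And>z. z \<in> \<Omega> \<Longrightarrow> real (card {i\<in>I. z \<in> N i}) \<le> \<kappa>" and b: "0 \<le> b" and \<kappa>: "0 \<le> \<kappa>"
  shows "bexp p \<Omega> (\<lambda>Z. (\<Sum>i\<in>I. F i Z)\<^sup>2) - (bexp p \<Omega> (\<lambda>Z. \<Sum>i\<in>I. F i Z))\<^sup>2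
    \<le> \<kappa> * b * (\<Sum>i\<in>I. (real (card (W i)) + 2 * (\<Sum>z\<in>\<Omega> \<inter> N i. p z)) * bexp p \<Omega> (F i))"
proof -
  have p1: "0 \<le> p z \<and> p z \<le> 1" if "z \<in> \<Omega>" for z
    using p[OF that] by linarith
  let ?D = "\<lambda>i z Z. \<bar>F i (insert z Z) - F i (Z - {z})\<bar>"
  have F0: "0 \<le> F i Z" and Fb: "F i Z \<le> b" if "i \<in> I" "Z \<subseteq> \<Omega>" for i Z
    using F[OF that] by auto
  have ins: "insert z Z \<subseteq> \<Omega>" "Z - {z} \<subseteq> \<Omega>" if "Z \<subseteq> \<Omega>" "z \<in> \<Omega>" for z Z
    using that by auto
  have Db: "0 \<le> ?D i z Z \<and> ?D i z Z \<le> b" if "i \<in> I" "Z \<subseteq> \<Omega>" "z \<in> \<Omega>" for i z Z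
    using F0[OF that(1) ins(1)[OF that(2,3)]] F0[OF that(1) ins(2)[OF that(2,3)]]
      Fb[OF that(1) ins(1)[OF that(2,3)]] Fb[OF that(1) ins(2)[OF that(2,3)]] by linarith
  \<comment> \<open>Only the at most \<kappa> summands with \<open>z\<close> in \<open>N i\<close>
    can change, each by at most \<open>b\<close>. Bounding one of the two factors of the square in
    this way leaves an expression linear in the changes.\<close>
  have sq: "((\<Sum>i\<in>I. F i (insert z Z)) - (\<Sum>i\<in>I. F i (Z - {z})))\<^sup>2
     \<le> \<kappa> * b * (\<Sum>i | i \<in> I \<and> z \<in> N i. ?D i z Z)" if "Z \<subseteq> \<Omega>" "z \<in> \<Omega>" for z Z
  proof -
    let ?s = "\<Sum>i | i \<in> I \<and> z \<in> N i. ?D i z Z"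
    have "\<bar>(\<Sum>i\<in>I. F i (insert z Z)) - (\<Sum>i\<in>I. F i (Z - {z}))\<bar> \<le> (\<Sum>i\<in>I. ?D i z Z)"
      unfolding sum_subtractf[symmetric] by (rule sum_abs)
    also have "\<dots> = ?s"
    proof (rule sum.mono_neutral_right)
      show "\<forall>i\<in>I - {i \<in> I. z \<in> N i}. ?D i z Z = 0" using N[OF _ that(1)] that(2) by simp
    qed (use fin in auto)
    finally have 1: "\<bar>(\<Sum>i\<in>I. F i (insert z Z)) - (\<Sum>i\<in>I. F i (Z - {z}))\<bar> \<le> ?s" .
    have "?s \<le> real (card {i\<in>I. z \<in> N i}) * b"
      using Db[OF _ that] by (intro sum_bounded_above) blast
    also have "\<dots> \<le> \<kappa> * b" using cap[OF that(2)] b by (intro mult_right_mono) auto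
    finally have 2: "?s \<le> \<kappa> * b" .
    have 0: "0 \<le> ?s" by (intro sum_nonneg) auto
    have "((\<Sum>i\<in>I. F i (insert z Z)) - (\<Sum>i\<in>I. F i (Z - {z})))\<^sup>2 \<le> ?s\<^sup>2"
      using power_mono[OF 1 abs_ge_zero, of 2] by (simp only: power2_abs)
    also have "\<dots> \<le> \<kappa> * b * ?s" unfolding power2_eq_square using mult_right_mono[OF 2 0] .
    finally show ?thesis .
  qed
  \<comment> \<open>Only for \<open>z\<close> in \<open>W i\<close> can adding \<open>z\<close>
    raise the summand, and then \<open>p z\<close> is used up by the value with \<open>z\<close>
    forced in. In all other cases the change is at most the value with \<open>z\<close> forced out,
    which keeps the factor \<open>p z\<close>; the 2 bounds \<open>1 / (1 - p z)\<close>.\<close>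
  have D1: "p z * bexp p \<Omega> (?D i z) \<le> ((if z \<in> W i then 1 else 0) + 2 * p z) * bexp p \<Omega> (F i)"
    if i: "i \<in> I" and z: "z \<in> \<Omega>" for i z
  proof -
    have pz: "0 \<le> p z" "p z \<le> 1 / 2" using p[OF z] by auto
    have E0: "0 \<le> bexp p \<Omega> (F i)" by (rule bexp_nonneg[OF p1 F0[OF i]])
    have E1: "0 \<le> bexp p \<Omega> (\<lambda>Z. F i (Z - {z}))"
      by (rule bexp_nonneg[OF p1 F0[OF i ins(2)[OF _ z]]])
    have "(1 - p z) * bexp p \<Omega> (\<lambda>Z. F i (Z - {z})) \<le> bexp p \<Omega> (F i)"
      by (rule bexp_insert_le(2)[OF fin(1) z p1 F0[OF i]])
    moreover have "1 / 2 * bexp p \<Omega> (\<lambda>Z. F i (Z - {z})) \<le> (1 - p z) * bexp p \<Omega> (\<lambda>Z. F i (Z - {z}))"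
      using pz E1 by (intro mult_right_mono) auto
    ultimately have "bexp p \<Omega> (\<lambda>Z. F i (Z - {z})) \<le> 2 * bexp p \<Omega> (F i)" by linarith
    from mult_left_mono[OF this pz(1)]
    have lo: "p z * bexp p \<Omega> (\<lambda>Z. F i (Z - {z})) \<le> 2 * p z * bexp p \<Omega> (F i)" by simp
    have up: "p z * bexp p \<Omega> (\<lambda>Z. F i (insert z Z)) \<le> bexp p \<Omega> (F i)"
      by (rule bexp_insert_le(1)[OF fin(1) z p1 F0[OF i]])
    show ?thesis
    proof (cases "z \<in> W i")
      case True
      have "bexp p \<Omega> (?D i z) \<le> bexp p \<Omega> (\<lambda>Z. F i (insert z Z) + F i (Z - {z}))"
      proof (rule bexp_mono[OF p1])
        fix Z assume "Z \<subseteq> \<Omega>"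
        then show "?D i z Z \<le> F i (insert z Z) + F i (Z - {z})"
          using F0[OF i, of "insert z Z"] F0[OF i, of "Z - {z}"] ins[of Z z] z by linarith
      qed
      then have "p z * bexp p \<Omega> (?D i z)
          \<le> p z * (bexp p \<Omega> (\<lambda>Z. F i (insert z Z)) + bexp p \<Omega> (\<lambda>Z. F i (Z - {z})))"
        using pz by (intro mult_left_mono) (auto simp: bexp_add)
      then show ?thesis using lo up True by (simp add: algebra_simps)
    next
      case False
      have "bexp p \<Omega> (?D i z) \<le> bexp p \<Omega> (\<lambda>Z. F i (Z - {z}))"
      proof (rule bexp_mono[OF p1])
        fix Z assume "Z \<subseteq> \<Omega>"
        then show "?D i z Z \<le> F i (Z - {z})"
          using F0[OF i, of "insert z Z"] W[OF i, of Z z] ins[of Z z] False z by simp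
      qed
      then have "p z * bexp p \<Omega> (?D i z) \<le> p z * bexp p \<Omega> (\<lambda>Z. F i (Z - {z}))"
        using pz by (intro mult_left_mono) auto
      then show ?thesis using lo False by simp
    qed
  qed
  have "bexp p \<Omega> (\<lambda>Z. (\<Sum>i\<in>I. F i Z)\<^sup>2) - (bexp p \<Omega> (\<lambda>Z. \<Sum>i\<in>I. F i Z))\<^sup>2
     \<le> (\<Sum>z\<in>\<Omega>. p z * bexp p \<Omega> (\<lambda>Z. ((\<Sum>i\<in>I. F i (insert z Z)) - (\<Sum>i\<in>I. F i (Z - {z})))\<^sup>2))"
    by (rule efron_stein[OF fin(1) p1])
  also have "\<dots> \<le> (\<Sum>z\<in>\<Omega>. p z * bexp p \<Omega> (\<lambda>Z. \<kappa> * b * (\<Sum>i | i \<in> I \<and> z \<in> N i. ?D i z Z)))"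
  proof (rule sum_mono)
    fix z assume z: "z \<in> \<Omega>"
    show "p z * bexp p \<Omega> (\<lambda>Z. ((\<Sum>i\<in>I. F i (insert z Z)) - (\<Sum>i\<in>I. F i (Z - {z})))\<^sup>2)
      \<le> p z * bexp p \<Omega> (\<lambda>Z. \<kappa> * b * (\<Sum>i | i \<in> I \<and> z \<in> N i. ?D i z Z))"
    proof (rule mult_left_mono)
      show "0 \<le> p z" using p1[OF z] by blast
    qed (rule bexp_mono[OF p1 sq[OF _ z]])
  qed
  also have "\<dots> = \<kappa> * b * (\<Sum>z\<in>\<Omega>. \<Sum>i | i \<in> I \<and> z \<in> N i. p z * bexp p \<Omega> (?D i z))"
    unfolding bexp_cmult bexp_sum by (simp add: sum_distrib_left algebra_simps)
  also have "(\<Sum>z\<in>\<Omega>. \<Sum>i | i \<in> I \<and> z \<in> N i. p z * bexp p \<Omega> (?D i z))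
     = (\<Sum>i\<in>I. \<Sum>z | z \<in> \<Omega> \<and> z \<in> N i. p z * bexp p \<Omega> (?D i z))"
    using fin by (rule sum.swap_restrict)
  also have "\<kappa> * b * \<dots> \<le>
      \<kappa> * b * (\<Sum>i\<in>I. (real (card (W i)) + 2 * (\<Sum>z\<in>\<Omega> \<inter> N i. p z)) * bexp p \<Omega> (F i))"
  proof -
    have "(\<Sum>z | z \<in> \<Omega> \<and> z \<in> N i. p z * bexp p \<Omega> (?D i z))
       \<le> (real (card (W i)) + 2 * (\<Sum>z\<in>\<Omega> \<inter> N i. p z)) * bexp p \<Omega> (F i)" if i: "i \<in> I" for i
    proof -
      have E0: "0 \<le> bexp p \<Omega> (F i)" by (rule bexp_nonneg[OF p1 F0[OF i]])
      have s0: "0 \<le> sum p (\<Omega> \<inter> N i)" using p1 by (intro sum_nonneg) blast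
      have "(\<Sum>z | z \<in> \<Omega> \<and> z \<in> N i. p z * bexp p \<Omega> (?D i z))
         \<le> (\<Sum>z\<in>\<Omega> \<inter> N i. ((if z \<in> W i then 1 else 0) + 2 * p z) * bexp p \<Omega> (F i))"
        unfolding Int_def using D1[OF i] by (intro sum_mono) auto
      also have "\<dots> = (real (card (\<Omega> \<inter> N i \<inter> W i)) + 2 * (\<Sum>z\<in>\<Omega> \<inter> N i. p z)) * bexp p \<Omega> (F i)"
        using fin by (simp add: sum_distrib_right[symmetric] sum.distrib sum_distrib_left[symmetric]
            sum.inter_restrict[symmetric])
      also have "\<dots> \<le> (real (card (W i)) + 2 * (\<Sum>z\<in>\<Omega> \<inter> N i. p z)) * bexp p \<Omega> (F i)"
        using finW[OF i] E0 s0 by (intro mult_right_mono add_mono) (auto intro!: card_mono)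
      finally show ?thesis .
    qed
    then show ?thesis using b \<kappa> by (intro mult_left_mono sum_mono) auto
  qed
  finally show ?thesis .
qed

section \<open>Girth and codegrees\<close>

lemma not_is_cycle_if_less_girth:
  assumes "enat i < girth H"
  shows "\<not> is_cycle H i es xs"
proof
  assume "is_cycle H i es xs"
  then have "girth H \<le> enat i" unfolding girth_def by (intro INF_lower) auto
  then show False using assms by simp
qed

text \<open>The claims exclude cycles of length 2, 3 and 4 in turn; indexing into lists supplies the
  edges and vertices of the cycle.\<close>

lemma
  assumes "5 \<le> girth H"
  shows linear_if_girth: "\<lbrakk>S \<in> H; T \<in> H; a \<in> S; a \<in> T; b \<in> S; b \<in> T; a \<noteq> b\<rbrakk> \<Longrightarrow> S = T"
    and triangle_free_if_girth: "\<lbrakk>S \<in> H; T \<in> H; U \<in> H; S \<noteq> T; T \<noteq> U; S \<noteq> U;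
      a \<in> S; a \<in> T; b \<in> T; b \<in> U; c \<in> U; c \<in> S; a \<noteq> b; b \<noteq> c; a \<noteq> c\<rbrakk> \<Longrightarrow> False"
    and square_free_if_girth: "\<lbrakk>S \<in> H; T \<in> H; U \<in> H; V \<in> H; S \<noteq> T; S \<noteq> U; S \<noteq> V; T \<noteq> U; T \<noteq> V; U \<noteq> V;
      a \<in> S; a \<in> T; b \<in> T; b \<in> U; c \<in> U; c \<in> V; d \<in> V; d \<in> S;
      a \<noteq> b; a \<noteq> c; a \<noteq> d; b \<noteq> c; b \<noteq> d; c \<noteq> d\<rbrakk> \<Longrightarrow> False"
proof -
  have no: "\<not> is_cycle H i es xs" if "i < 5" for i es xs
  proof (rule not_is_cycle_if_less_girth)
    have "enat i < enat 5" using that by simp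
    also have "enat 5 = 5" by (simp add: numeral_eq_enat)
    finally show "enat i < girth H" using assms by (rule less_le_trans)
  qed
  have all_less: "(\<forall>j<n. P j) \<longleftrightarrow> (\<forall>j\<in>{..<n}. P j)" for n and P :: "nat \<Rightarrow> bool"
    by (simp add: Ball_def)
  {
    assume *: "S \<in> H" "T \<in> H" "a \<in> S" "a \<in> T" "b \<in> S" "b \<in> T" "a \<noteq> b"
    show "S = T"
    proof (rule ccontr)
      assume "S \<noteq> T"
      have 2: "{..<2} = {0, 1::nat}" by auto
      have "is_cycle H 2 (nth [S, T]) (nth [a, b])"
        unfolding is_cycle_def all_less 2
        using * \<open>S \<noteq> T\<close> by simp
      then show False using no[of 2] by simp
    qed
  next
    assume *: "S \<in> H" "T \<in> H" "U \<in> H" "S \<noteq> T" "T \<noteq> U" "S \<noteq> U"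
      "a \<in> S" "a \<in> T" "b \<in> T" "b \<in> U" "c \<in> U" "c \<in> S" "a \<noteq> b" "b \<noteq> c" "a \<noteq> c"
    have 3: "{..<3} = {0, 1, 2::nat}" by auto
    have "is_cycle H 3 (nth [S, T, U]) (nth [a, b, c])"
      unfolding is_cycle_def all_less 3 using * by simp
    then show False using no[of 3] by simp
  next
    assume *: "S \<in> H" "T \<in> H" "U \<in> H" "V \<in> H" "S \<noteq> T" "S \<noteq> U" "S \<noteq> V" "T \<noteq> U" "T \<noteq> V" "U \<noteq> V"
      "a \<in> S" "a \<in> T" "b \<in> T" "b \<in> U" "c \<in> U" "c \<in> V" "d \<in> V" "d \<in> S"
      "a \<noteq> b" "a \<noteq> c" "a \<noteq> d" "b \<noteq> c" "b \<noteq> d" "c \<noteq> d"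
    have 4: "{..<4} = {0, 1, 2, 3::nat}" by auto
    have "is_cycle H 4 (nth [S, T, U, V]) (nth [a, b, c, d])"
      unfolding is_cycle_def all_less 4 using * by simp
    then show False using no[of 4] by simp
  }
qed

lemma sum_UN_le_real:
  fixes f :: "'a \<Rightarrow> real"
  assumes "finite I" "\<And>i. i \<in> I \<Longrightarrow> finite (N i)" "\<And>x. x \<in> (\<Union>i\<in>I. N i) \<Longrightarrow> 0 \<le> f x"
  shows "sum f (\<Union>i\<in>I. N i) \<le> (\<Sum>i\<in>I. sum f (N i))"
  using assms
proof (induction I rule: finite_induct)
  case (insert i I)
  have fin: "finite (N i)" "finite (\<Union>i\<in>I. N i)" using insert.hyps insert.prems(1) by auto
  have "sum f (N i \<union> (\<Union>i\<in>I. N i)) = sum f (N i) + sum f (\<Union>i\<in>I. N i) - sum f (N i \<inter> (\<Union>i\<in>I. N i))"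
    using fin by (rule sum_Un)
  moreover have "0 \<le> sum f (N i \<inter> (\<Union>i\<in>I. N i))" using insert.prems(2) by (intro sum_nonneg) auto
  moreover have "sum f (\<Union>i\<in>I. N i) \<le> (\<Sum>i\<in>I. sum f (N i))"
    using insert.prems by (intro insert.IH) auto
  ultimately show ?case using insert.hyps by simp
qed simp

lemma prod_Un_ge:
  fixes f :: "'a \<Rightarrow> real"
  assumes "finite A" "finite B" "\<And>x. x \<in> A \<union> B \<Longrightarrow> 0 \<le> f x \<and> f x \<le> 1"
  shows "prod f A * prod f B \<le> prod f (A \<union> B)"
proof -
  have B: "prod f B = prod f (B - A) * prod f (B \<inter> A)"
    using assms(2) prod.Int_Diff[of B f A] by (simp add: mult.commute)
  have 1: "prod f (B \<inter> A) \<le> 1" using assms(3) by (intro prod_le_1) auto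
  have 2: "0 \<le> prod f A" "0 \<le> prod f (B - A)" using assms(3) by (auto intro!: prod_nonneg)
  have "prod f (A \<union> B) = prod f A * prod f (B - A)"
    using assms(1,2) prod.union_disjoint[of A "B - A" f] by simp
  moreover have "prod f A * prod f B \<le> prod f A * prod f (B - A)"
    using mult_left_le[OF 1 2(2)] 2(1) unfolding B by (intro mult_left_mono) auto
  ultimately show ?thesis by simp
qed

lemma prod_UN_ge:
  fixes f :: "'a \<Rightarrow> real"
  assumes "finite I" "\<And>i. i \<in> I \<Longrightarrow> finite (N i)"
    "\<And>x. x \<in> (\<Union>i\<in>I. N i) \<Longrightarrow> 0 \<le> f x \<and> f x \<le> 1"
  shows "(\<Prod>i\<in>I. prod f (N i)) \<le> prod f (\<Union>i\<in>I. N i)"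
  using assms
proof (induction I rule: finite_induct)
  case (insert i I)
  have "(\<Prod>i\<in>I. prod f (N i)) \<le> prod f (\<Union>i\<in>I. N i)"
    using insert.prems by (intro insert.IH) auto
  moreover have "0 \<le> prod f (N i)" using insert.prems(2) by (intro prod_nonneg) auto
  ultimately have "prod f (N i) * (\<Prod>i\<in>I. prod f (N i)) \<le> prod f (N i) * prod f (\<Union>i\<in>I. N i)"
    by (rule mult_left_mono)
  also have "\<dots> \<le> prod f (N i \<union> (\<Union>i\<in>I. N i))"
    using insert.hyps insert.prems by (intro prod_Un_ge) auto
  finally show ?case using insert.hyps by simp
qed simp

text \<open>The codegree bounds stay parameters \<open>cd\<close> and \<open>cc\<close> until the
  end, where both become the same power of \<open>ln D\<close>. Regularity and the degrees of
  \<open>H\<close> enter later, through the initial weights and the number of edges.\<close>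

locale bounded_configuration =
  fixes G :: "('v, 'e) multi_hypergraph" and H :: "'e set set" and r g :: nat and cd cc :: real
  assumes finite_multi_hypergraph: "finite_multi_hypergraph G"
    and uniform: "uniform r G" and r_ge_2: "2 \<le> r" and g_ge_2: "2 \<le> g"
    and codegree_le:
      "\<And>u v. u \<in> verts G \<Longrightarrow> v \<in> verts G \<Longrightarrow> u \<noteq> v \<Longrightarrow> real (codegree G u v) \<le> cd"
    and configuration: "configuration_hypergraph G H" and bounded: "bounded_hypergraph g H"
    and girth: "5 \<le> girth H"
    and config_codegree_le: "\<And>v e. v \<in> verts G \<Longrightarrow> e \<in> edges G \<Longrightarrow> v \<notin> ends G e \<Longrightarrow>
      real (config_codegree G H v e) \<le> cc"
    and cd_nonneg: "0 \<le> cd" and cc_nonneg: "0 \<le> cc"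
begin

lemma finite_verts: "finite (verts G)" and finite_edges: "finite (edges G)"
  using finite_multi_hypergraph by (auto simp: finite_multi_hypergraph_def)

lemma ends_subset: "e \<in> edges G \<Longrightarrow> ends G e \<subseteq> verts G"
  using finite_multi_hypergraph by (auto simp: finite_multi_hypergraph_def)

lemma card_ends: "e \<in> edges G \<Longrightarrow> card (ends G e) = r"
  using uniform by (auto simp: uniform_def)

lemma finite_ends: "e \<in> edges G \<Longrightarrow> finite (ends G e)"
  using ends_subset finite_verts by (rule finite_subset)

lemma ends_nonempty: "e \<in> edges G \<Longrightarrow> ends G e \<noteq> {}"
  using card_ends r_ge_2 by fastforce

lemma config_subset: "S \<in> H \<Longrightarrow> S \<subseteq> edges G"
  using configuration by (auto simp: configuration_hypergraph_def matching_def)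

lemma config_disjoint: "S \<in> H \<Longrightarrow> e \<in> S \<Longrightarrow> f \<in> S \<Longrightarrow> e \<noteq> f \<Longrightarrow> ends G e \<inter> ends G f = {}"
  using configuration by (auto simp: configuration_hypergraph_def matching_def)

lemma finite_config: "S \<in> H \<Longrightarrow> finite S"
  using config_subset finite_edges by (rule finite_subset)

lemma card_config_le: "S \<in> H \<Longrightarrow> card S \<le> g"
  using bounded by (auto simp: bounded_hypergraph_def)

lemma card_config_ge: "S \<in> H \<Longrightarrow> 2 \<le> card S"
  using configuration by (auto simp: configuration_hypergraph_def)

lemma finite_H: "finite H"
  by (rule finite_subset[of _ "Pow (edges G)"]) (use config_subset finite_edges in auto)

definition load :: "('e \<Rightarrow> real) \<Rightarrow> 'v \<Rightarrow> real" where
  "load y v = (\<Sum>e | e \<in> edges G \<and> v \<in> ends G e. y e)"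

definition pending :: "'e set \<Rightarrow> 'e \<Rightarrow> 'e set set" where
  "pending A e = {S \<in> H. e \<in> S \<and> \<not> S - {e} \<subseteq> A}"

definition factor :: "real \<Rightarrow> 'e set \<Rightarrow> ('e \<Rightarrow> real) \<Rightarrow> 'e \<Rightarrow> real" where
  "factor s A y f = (if f \<in> A then 1 else y f * (1 + 1 / (real g * s)))"

text \<open>A pending configuration with an unactivated edge of weight 0 contributes nothing, since
  that edge can never be activated any more. Configurations whose edges other than \<open>e\<close>
  are all activated are not summed; they are forbidden for live \<open>e\<close> instead.\<close>

definition danger :: "real \<Rightarrow> 'e set \<Rightarrow> ('e \<Rightarrow> real) \<Rightarrow> 'e \<Rightarrow> real" where
  "danger s A y e = (\<Sum>S\<in>pending A e. \<Prod>f\<in>S - {e}. factor s A y f)"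

lemma finite_pending: "finite (pending A e)"
  using finite_H by (simp add: pending_def)

lemma load_mono: "(\<And>e. y e \<le> y' e) \<Longrightarrow> load y v \<le> load y' v"
  unfolding load_def by (intro sum_mono) auto

lemma factor_nonneg: "(\<And>e. 0 \<le> y e) \<Longrightarrow> 0 < s \<Longrightarrow> 0 \<le> factor s A y f"
  unfolding factor_def by (simp add: add_nonneg_nonneg)

lemma danger_nonneg: "(\<And>e. 0 \<le> y e) \<Longrightarrow> 0 < s \<Longrightarrow> 0 \<le> danger s A y e"
  unfolding danger_def by (intro sum_nonneg prod_nonneg) (auto intro: factor_nonneg)

lemma danger_mono:
  assumes "\<And>e. 0 \<le> y e" "\<And>e. y e \<le> y' e" "0 < s"
  shows "danger s A y e \<le> danger s A y' e"
  unfolding danger_def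
proof (intro sum_mono prod_mono conjI)
  fix f show "0 \<le> factor s A y f" using assms by (intro factor_nonneg) auto
  show "factor s A y f \<le> factor s A y' f"
    unfolding factor_def using assms by (auto intro!: mult_right_mono)
qed

lemma sum_load: "(\<Sum>v\<in>verts G. load y v) = real r * (\<Sum>e\<in>edges G. y e)"
proof -
  have "(\<Sum>v\<in>verts G. load y v) = (\<Sum>e\<in>edges G. \<Sum>v | v \<in> verts G \<and> v \<in> ends G e. y e)"
    unfolding load_def using finite_verts finite_edges by (rule sum.swap_restrict)
  also have "\<dots> = (\<Sum>e\<in>edges G. real r * y e)"
  proof (rule sum.cong[OF refl])
    fix e assume e: "e \<in> edges G"
    then have "{v \<in> verts G. v \<in> ends G e} = ends G e" using ends_subset by blast
    then show "(\<Sum>v | v \<in> verts G \<and> v \<in> ends G e. y e) = real r * y e" using card_ends[OF e] by simp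
  qed
  finally show ?thesis by (simp add: sum_distrib_left)
qed

end

section \<open>One round of the nibble\<close>

text \<open>After \<open>j\<close> rounds \<open>s\<close> is \<open>(1 - \<epsilon>) ^ j\<close>.
  The quantity \<open>\<epsilon> * (2 * r + K)\<close> bounds the total probability of the trials
  that threaten one edge. \<open>Y'_ge\<close> is calibrated to the lower bound on survival; the
  rescaling cancels one factor \<open>1 - \<epsilon>\<close>, whence the exponent
  \<open>r - 1\<close>.\<close>

locale nibble_step = bounded_configuration G H r g cd cc
  for G :: "('v, 'e) multi_hypergraph" and H r g cd cc +
  fixes A :: "'e set" and y :: "'e \<Rightarrow> real" and s \<epsilon> K Y Y' :: real
  assumes A_edges: "A \<subseteq> edges G"
    and y_nonneg: "\<And>e. 0 \<le> y e" and y_edge: "\<And>e. 0 < y e \<Longrightarrow> e \<in> edges G" and y_le: "\<And>e. y e \<le> Y"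
    and y_disjoint: "\<And>e f. 0 < y e \<Longrightarrow> f \<in> A \<Longrightarrow> ends G e \<inter> ends G f = {}"
    and y_danger: "\<And>e. 0 < y e \<Longrightarrow> danger s A y e \<le> K"
    and y_open: "\<And>e S. 0 < y e \<Longrightarrow> S \<in> H \<Longrightarrow> e \<in> S \<Longrightarrow> \<not> S - {e} \<subseteq> A"
    and load_le_1: "\<And>v. v \<in> verts G \<Longrightarrow> load y v \<le> 1"
    and eps_pos: "0 < \<epsilon>" and s_pos: "0 < s" and K_nonneg: "0 \<le> K"
    and eps_small: "\<epsilon> * (2 * real r + K) \<le> 1 / 2" and eps_small': "\<epsilon> * (real g * s * K) < 1"
    and Y'_ge: "Y \<le> Y' * ((1 - \<epsilon>) ^ (r - 1) * (1 - \<epsilon> * (real g * s * K)))"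
begin

definition trials :: "('e + 'v) set" where
  "trials = Inl ` {e. 0 < y e} \<union> Inr ` verts G"

text \<open>The dummy trial \<open>Inr v\<close> makes every vertex be hit with probability exactly \<open>\<epsilon>\<close>.\<close>

definition p :: "'e + 'v \<Rightarrow> real" where
  "p z = (case z of Inl f \<Rightarrow> \<epsilon> * y f
    | Inr v \<Rightarrow> 1 - (1 - \<epsilon>) / (\<Prod>f | 0 < y f \<and> v \<in> ends G f. 1 - \<epsilon> * y f))"

definition star :: "'v \<Rightarrow> ('e + 'v) set" where
  "star v = insert (Inr v) (Inl ` {f. 0 < y f \<and> v \<in> ends G f})"

text \<open>One activation among these edges already completes a configuration around
  \<open>e\<close>. Completion by two or more simultaneous activations has probability of order
  \<open>\<epsilon>^2\<close> and is treated separately.\<close>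

definition blockers :: "'e \<Rightarrow> 'e set" where
  "blockers e = {f. 0 < y f \<and> f \<noteq> e \<and> (\<exists>S\<in>H. e \<in> S \<and> f \<in> S \<and> S - {e, f} \<subseteq> A)}"

text \<open>The activation of \<open>e\<close> itself is included, because \<open>Inl e\<close> lies
  in the stars of its vertices: an activated edge leaves the live edges whether or not it is
  picked.\<close>

definition hazard :: "'e \<Rightarrow> ('e + 'v) set" where
  "hazard e = (\<Union>v\<in>ends G e. star v) \<union> Inl ` blockers e"

definition survival :: "'e \<Rightarrow> real" where
  "survival e = (\<Prod>z\<in>hazard e. 1 - p z)"

text \<open>Dividing by the survival probability and multiplying by that of a single vertex keeps the
  expected load of a surviving vertex constant.\<close>

definition y1 :: "('e + 'v) set \<Rightarrow> 'e \<Rightarrow> real" where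
  "y1 Z e = (if 0 < y e \<and> Z \<inter> hazard e = {} then y e * (1 - \<epsilon>) / survival e else 0)"

definition A1 :: "('e + 'v) set \<Rightarrow> 'e set" where
  "A1 Z = A \<union> {f. Inl f \<in> Z}"

abbreviation "s1 \<equiv> (1 - \<epsilon>) * s"

abbreviation "\<eta> \<equiv> \<epsilon> * (2 * real r + K)"

lemma eps_le: "\<epsilon> \<le> 1 / 8"
proof -
  have "\<epsilon> * 4 \<le> \<eta>"
    using r_ge_2 K_nonneg eps_pos by (intro mult_left_mono) auto
  then show ?thesis using eps_small by linarith
qed

lemma s1_pos: "0 < s1"
  using s_pos eps_le by simp

lemma finite_live: "finite {e. 0 < y e}" and finite_live_at: "finite {f. 0 < y f \<and> v \<in> ends G f}"
proof -
  show "finite {e. 0 < y e}" by (rule finite_subset[OF _ finite_edges]) (use y_edge in blast)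
  then show "finite {f. 0 < y f \<and> v \<in> ends G f}" by (rule rev_finite_subset) blast
qed

lemma finite_trials: "finite trials"
  unfolding trials_def using finite_live finite_verts by simp

lemma live_notin_A: "0 < y e \<Longrightarrow> e \<notin> A"
  using y_disjoint[of e e] ends_nonempty[OF y_edge, of e] by auto

lemma load_eq: "load y v = (\<Sum>f | 0 < y f \<and> v \<in> ends G f. y f)"
  unfolding load_def
proof (rule sum.mono_neutral_right)
  show "finite {e \<in> edges G. v \<in> ends G e}" using finite_edges by simp
  show "{f. 0 < y f \<and> v \<in> ends G f} \<subseteq> {e \<in> edges G. v \<in> ends G e}" using y_edge by blast
  show "\<forall>i\<in>{e \<in> edges G. v \<in> ends G e} - {f. 0 < y f \<and> v \<in> ends G f}. y i = 0"
  proof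
    fix i assume "i \<in> {e \<in> edges G. v \<in> ends G e} - {f. 0 < y f \<and> v \<in> ends G f}"
    then have "\<not> 0 < y i" by blast
    then show "y i = 0" using y_nonneg[of i] by linarith
  qed
qed

lemma y_le_1: "y e \<le> 1"
proof (cases "0 < y e")
  case True
  then obtain v where v: "v \<in> ends G e" using ends_nonempty[OF y_edge] by blast
  then have "v \<in> verts G" using ends_subset[OF y_edge[OF True]] by blast
  have "y e \<le> (\<Sum>f | 0 < y f \<and> v \<in> ends G f. y f)"
    using True v finite_live_at y_nonneg by (intro member_le_sum) auto
  also have "\<dots> \<le> 1" using load_le_1[OF \<open>v \<in> verts G\<close>] load_eq by simp
  finally show ?thesis .
qed simp

lemma p_Inl: "p (Inl f) = \<epsilon> * y f"
  by (simp add: p_def)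

lemma p_Inl_bounds: "0 \<le> p (Inl f) \<and> p (Inl f) \<le> \<epsilon>"
  unfolding p_Inl using y_nonneg[of f] y_le_1[of f] eps_pos by (simp add: mult_left_le)

text \<open>As the load is at most 1, the union bound shows that the edges at \<open>v\<close> alone
  miss \<open>v\<close> with probability at least \<open>1 - \<epsilon>\<close>. This leaves room
  for a dummy trial that lowers the probability to exactly \<open>1 - \<epsilon>\<close>.\<close>

lemma vertex_product:
  assumes "v \<in> verts G"
  shows "1 - \<epsilon> \<le> (\<Prod>f | 0 < y f \<and> v \<in> ends G f. 1 - \<epsilon> * y f)"
    and "(\<Prod>f | 0 < y f \<and> v \<in> ends G f. 1 - \<epsilon> * y f) \<le> 1"
proof -
  have f01: "\<epsilon> * y f \<in> {0..1}" for f
    using p_Inl_bounds[of f] eps_le unfolding p_Inl by simp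
  have "(\<Sum>f | 0 < y f \<and> v \<in> ends G f. \<epsilon> * y f) = \<epsilon> * load y v"
    by (simp add: load_eq sum_distrib_left)
  also have "\<dots> \<le> \<epsilon>" using load_le_1[OF assms] eps_pos by (simp add: mult_left_le)
  finally show "1 - \<epsilon> \<le> (\<Prod>f | 0 < y f \<and> v \<in> ends G f. 1 - \<epsilon> * y f)"
    using Weierstrass_prod_ineq[of "{f. 0 < y f \<and> v \<in> ends G f}" "\<lambda>f. \<epsilon> * y f", OF f01] by linarith
  show "(\<Prod>f | 0 < y f \<and> v \<in> ends G f. 1 - \<epsilon> * y f) \<le> 1"
    using f01 by (intro prod_le_1) simp
qed

lemma p_Inr_bounds:
  assumes "v \<in> verts G"
  shows "0 \<le> p (Inr v) \<and> p (Inr v) \<le> \<epsilon>"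
proof -
  let ?P = "\<Prod>f | 0 < y f \<and> v \<in> ends G f. 1 - \<epsilon> * y f"
  have P: "1 - \<epsilon> \<le> ?P" "?P \<le> 1" "0 < 1 - \<epsilon>" using vertex_product[OF assms] eps_le by auto
  then have "0 < ?P" by linarith
  then have "(1 - \<epsilon>) / ?P \<le> 1" "1 - \<epsilon> \<le> (1 - \<epsilon>) / ?P"
    using P mult_left_le[of ?P "1 - \<epsilon>"] by (auto simp: pos_divide_le_eq pos_le_divide_eq)
  then show ?thesis by (simp add: p_def)
qed

lemma p_bounds: "z \<in> trials \<Longrightarrow> 0 \<le> p z \<and> p z \<le> \<epsilon>"
  unfolding trials_def using p_Inl_bounds p_Inr_bounds by blast

lemma p_half: "z \<in> trials \<Longrightarrow> 0 \<le> p z \<and> p z \<le> 1 / 2"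
  using p_bounds[of z] eps_le by linarith

lemma p_prob: "z \<in> trials \<Longrightarrow> 0 \<le> p z \<and> p z \<le> 1"
  using p_bounds[of z] eps_le by linarith

lemma one_minus_p: "z \<in> trials \<Longrightarrow> 0 \<le> 1 - p z \<and> 1 - p z \<le> 1"
  using p_bounds[of z] eps_le by linarith

lemma star_subset: "v \<in> verts G \<Longrightarrow> star v \<subseteq> trials"
  unfolding star_def trials_def by blast

lemma finite_star: "finite (star v)"
  unfolding star_def using finite_live_at by simp

lemma prod_star:
  assumes "v \<in> verts G"
  shows "(\<Prod>z\<in>star v. 1 - p z) = 1 - \<epsilon>"
proof -
  let ?P = "\<Prod>f | 0 < y f \<and> v \<in> ends G f. 1 - \<epsilon> * y f"
  have "0 < ?P" using vertex_product(1)[OF assms] eps_le by linarith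
  have "(\<Prod>z\<in>star v. 1 - p z) = (1 - p (Inr v)) * (\<Prod>z\<in>Inl ` {f. 0 < y f \<and> v \<in> ends G f}. 1 - p z)"
    unfolding star_def by (rule prod.insert) (use finite_live_at in auto)
  also have "(\<Prod>z\<in>Inl ` {f. 0 < y f \<and> v \<in> ends G f}. 1 - p z) = ?P"
    by (subst prod.reindex) (auto simp: p_Inl)
  finally show ?thesis using \<open>0 < ?P\<close> by (simp add: p_def)
qed

lemma sum_star_le:
  assumes "v \<in> verts G"
  shows "(\<Sum>z\<in>star v. p z) \<le> 2 * \<epsilon>"
proof -
  have "(\<Sum>z\<in>star v. p z) = p (Inr v) + (\<Sum>z\<in>Inl ` {f. 0 < y f \<and> v \<in> ends G f}. p z)"
    unfolding star_def by (rule sum.insert) (use finite_live_at in auto)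
  also have "(\<Sum>z\<in>Inl ` {f. 0 < y f \<and> v \<in> ends G f}. p z) = \<epsilon> * load y v"
    by (subst sum.reindex) (auto simp: p_Inl load_eq sum_distrib_left)
  also have "\<dots> \<le> \<epsilon>" using load_le_1[OF assms] eps_pos by (simp add: mult_left_le)
  finally show ?thesis using p_Inr_bounds[OF assms] by linarith
qed

lemma finite_blockers: "finite (blockers e)"
  by (rule finite_subset[OF _ finite_live]) (auto simp: blockers_def)

text \<open>A blocker is recovered from its configuration as the only edge besides \<open>e\<close>
  outside \<open>A\<close>, and the factors of the remaining edges are 1. Hence distinct blockers
  account for distinct terms of the danger.\<close>

lemma sum_blockers_le:
  assumes "0 < y e"
  shows "(\<Sum>f\<in>blockers e. y f) * (1 + 1 / (real g * s)) \<le> danger s A y e"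
  unfolding danger_def sum_distrib_right
proof (rule sum_le_included[where i = "\<lambda>S. the_elem (S - {e} - A)"])
  show "\<forall>S\<in>pending A e. 0 \<le> (\<Prod>f\<in>S - {e}. factor s A y f)"
    using factor_nonneg[OF y_nonneg s_pos] by (auto intro!: prod_nonneg)
  show "\<forall>f\<in>blockers e. \<exists>S\<in>pending A e. the_elem (S - {e} - A) = f \<and>
      y f * (1 + 1 / (real g * s)) \<le> (\<Prod>f\<in>S - {e}. factor s A y f)"
  proof
    fix f assume "f \<in> blockers e"
    then obtain S where f: "0 < y f" "f \<noteq> e" and S: "S \<in> H" "e \<in> S" "f \<in> S" "S - {e, f} \<subseteq> A"
      unfolding blockers_def by blast
    have fA: "f \<notin> A" using live_notin_A[OF f(1)] .
    have eq: "S - {e} - A = {f}" using S f fA by blast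
    have "S - {e} = insert f (S - {e, f})" using S f by blast
    then have "(\<Prod>h\<in>S - {e}. factor s A y h) = factor s A y f * (\<Prod>h\<in>S - {e, f}. factor s A y h)"
      using finite_config[OF S(1)] by simp
    moreover have "(\<Prod>h\<in>S - {e, f}. factor s A y h) = 1"
      using S(4) by (intro prod.neutral) (auto simp: factor_def)
    ultimately have "(\<Prod>h\<in>S - {e}. factor s A y h) = y f * (1 + 1 / (real g * s))"
      using fA by (simp add: factor_def)
    moreover have "S \<in> pending A e" using S f fA by (auto simp: pending_def)
    ultimately show "\<exists>S\<in>pending A e. the_elem (S - {e} - A) = f \<and>
      y f * (1 + 1 / (real g * s)) \<le> (\<Prod>f\<in>S - {e}. factor s A y f)"
      using eq by (intro bexI[of _ S]) auto
  qed
qed (use finite_blockers finite_pending in auto)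

text \<open>Each summand of \<open>1 + 1 / (g * s)\<close> yields one bound. The second improves as
  \<open>s\<close> decreases, and it is the one that controls the growth of the weights over all
  rounds.\<close>

lemma sum_blockers_bounds:
  assumes "0 < y e"
  shows "(\<Sum>f\<in>blockers e. y f) \<le> K" and "(\<Sum>f\<in>blockers e. y f) \<le> real g * s * K"
proof -
  let ?b = "\<Sum>f\<in>blockers e. y f"
  have gs: "0 < real g * s" using g_ge_2 s_pos by simp
  have b0: "0 \<le> ?b" using y_nonneg by (intro sum_nonneg) auto
  have "?b * (1 + 1 / (real g * s)) \<le> K"
    using sum_blockers_le[OF assms] y_danger[OF assms] by linarith
  then have "?b + ?b / (real g * s) \<le> K" by (simp add: algebra_simps)
  moreover have "0 \<le> ?b / (real g * s)" using b0 gs by simp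
  ultimately have "?b \<le> K" "?b / (real g * s) \<le> K" using b0 by linarith+
  then show "?b \<le> K" "?b \<le> real g * s * K" using gs by (auto simp: field_simps)
qed

lemma hazard_subset:
  assumes "0 < y e"
  shows "hazard e \<subseteq> trials"
proof -
  have "star v \<subseteq> trials" if "v \<in> ends G e" for v
    using star_subset ends_subset[OF y_edge[OF assms]] that by blast
  moreover have "Inl ` blockers e \<subseteq> trials" by (auto simp: blockers_def trials_def)
  ultimately show ?thesis unfolding hazard_def by blast
qed

lemma finite_hazard: "0 < y e \<Longrightarrow> finite (hazard e)"
  using hazard_subset finite_trials by (rule finite_subset)

lemma Inl_in_hazard: "0 < y e \<Longrightarrow> Inl e \<in> hazard e"
  using ends_nonempty[OF y_edge] by (fastforce simp: hazard_def star_def)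

lemma star_subset_hazard: "v \<in> ends G e \<Longrightarrow> star v \<subseteq> hazard e"
  unfolding hazard_def by blast

lemma sum_hazard_le:
  assumes "0 < y e"
  shows "(\<Sum>z\<in>hazard e. p z) \<le> \<eta>"
proof -
  have ed: "e \<in> edges G" using y_edge[OF assms] .
  have sub: "(\<Union>v\<in>ends G e. star v) \<subseteq> trials" "Inl ` blockers e \<subseteq> trials"
    using hazard_subset[OF assms] unfolding hazard_def by auto
  have fin: "finite (\<Union>v\<in>ends G e. star v)" "finite (Inl ` blockers e :: ('e + 'v) set)"
    using finite_subset[OF sub(1) finite_trials] finite_subset[OF sub(2) finite_trials] by auto
  have nn: "0 \<le> sum p ((\<Union>v\<in>ends G e. star v) \<inter> Inl ` blockers e)"
    by (rule sum_nonneg) (use sub(1) p_bounds in blast)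
  have "sum p (hazard e) = sum p (\<Union>v\<in>ends G e. star v) + sum p (Inl ` blockers e)
      - sum p ((\<Union>v\<in>ends G e. star v) \<inter> Inl ` blockers e)"
    unfolding hazard_def using fin by (rule sum_Un)
  moreover have "sum p (\<Union>v\<in>ends G e. star v) \<le> (\<Sum>v\<in>ends G e. sum p (star v))"
  proof (rule sum_UN_le_real[OF finite_ends[OF ed] finite_star])
    fix x assume "x \<in> (\<Union>v\<in>ends G e. star v)"
    then show "0 \<le> p x" using sub(1) p_bounds by blast
  qed
  moreover have "(\<Sum>v\<in>ends G e. sum p (star v)) \<le> real (card (ends G e)) * (2 * \<epsilon>)"
    by (rule sum_bounded_above) (use sum_star_le ends_subset[OF ed] in blast)
  moreover have "sum p (Inl ` blockers e) = \<epsilon> * (\<Sum>f\<in>blockers e. y f)"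
    by (subst sum.reindex) (auto simp: p_Inl sum_distrib_left)
  moreover have "\<epsilon> * (\<Sum>f\<in>blockers e. y f) \<le> \<epsilon> * K"
    using sum_blockers_bounds(1)[OF assms] eps_pos by (intro mult_left_mono) auto
  ultimately show ?thesis using nn by (simp add: card_ends[OF ed] algebra_simps)
qed

text \<open>Trials shared by several parts of the hazard only help survival, so the stars and the
  blockers may be treated as if they were disjoint.\<close>

lemma survival_ge:
  assumes "0 < y e"
  shows "(1 - \<epsilon>) ^ r * (1 - \<epsilon> * (real g * s * K)) \<le> survival e"
proof -
  have ed: "e \<in> edges G" using y_edge[OF assms] .
  have sub: "(\<Union>v\<in>ends G e. star v) \<subseteq> trials" "Inl ` blockers e \<subseteq> trials"
    using hazard_subset[OF assms] unfolding hazard_def by auto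
  have fin: "finite (\<Union>v\<in>ends G e. star v)" "finite (Inl ` blockers e :: ('e + 'v) set)"
    using finite_subset[OF sub(1) finite_trials] finite_subset[OF sub(2) finite_trials] by auto
  let ?f = "\<lambda>z. 1 - p z"
  have "(\<Prod>v\<in>ends G e. prod ?f (star v)) = (\<Prod>v\<in>ends G e. 1 - \<epsilon>)"
    by (rule prod.cong[OF refl]) (use prod_star ends_subset[OF ed] in blast)
  then have 1: "(\<Prod>v\<in>ends G e. prod ?f (star v)) = (1 - \<epsilon>) ^ r"
    by (simp add: card_ends[OF ed])
  have 2: "(\<Prod>v\<in>ends G e. prod ?f (star v)) \<le> prod ?f (\<Union>v\<in>ends G e. star v)"
  proof (rule prod_UN_ge[OF finite_ends[OF ed] finite_star])
    fix x assume "x \<in> (\<Union>v\<in>ends G e. star v)"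
    then show "0 \<le> ?f x \<and> ?f x \<le> 1" using sub(1) one_minus_p by blast
  qed
  have "1 - sum p (Inl ` blockers e) \<le> prod ?f (Inl ` blockers e)"
  proof (rule Weierstrass_prod_ineq)
    fix x :: "'e + 'v" assume "x \<in> Inl ` blockers e"
    then have "x \<in> trials" using sub(2) by blast
    then show "p x \<in> {0..1}" using p_prob by simp
  qed
  moreover have "sum p (Inl ` blockers e) = \<epsilon> * (\<Sum>f\<in>blockers e. y f)"
    by (subst sum.reindex) (auto simp: p_Inl sum_distrib_left)
  moreover have "\<epsilon> * (\<Sum>f\<in>blockers e. y f) \<le> \<epsilon> * (real g * s * K)"
    using sum_blockers_bounds(2)[OF assms] eps_pos by (intro mult_left_mono) auto
  ultimately have 3: "1 - \<epsilon> * (real g * s * K) \<le> prod ?f (Inl ` blockers e)" by linarith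
  have "(1 - \<epsilon>) ^ r * (1 - \<epsilon> * (real g * s * K))
      \<le> prod ?f (\<Union>v\<in>ends G e. star v) * prod ?f (Inl ` blockers e)"
    using 1 2 3 eps_le eps_small' by (intro mult_mono) (auto intro!: order_trans[OF _ 2])
  also have "\<dots> \<le> survival e"
    unfolding survival_def hazard_def
  proof (rule prod_Un_ge[OF fin])
    fix x assume "x \<in> (\<Union>v\<in>ends G e. star v) \<union> Inl ` blockers e"
    then show "0 \<le> ?f x \<and> ?f x \<le> 1" using sub one_minus_p by blast
  qed
  finally show ?thesis .
qed

lemma survival_pos: "0 < y e \<Longrightarrow> 0 < survival e"
  using eps_le eps_small' by (intro less_le_trans[OF _ survival_ge]) auto

lemma survival_le_1: "0 < y e \<Longrightarrow> survival e \<le> 1"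
  unfolding survival_def using hazard_subset one_minus_p by (intro prod_le_1) blast

lemma y1_nonneg: "0 \<le> y1 Z e"
proof (cases "0 < y e")
  case True
  then show ?thesis unfolding y1_def using survival_pos[OF True] eps_le by simp
qed (simp add: y1_def)

lemma y1_le: "y1 Z e \<le> Y'"
proof -
  have q: "0 < (1 - \<epsilon>) ^ (r - 1) * (1 - \<epsilon> * (real g * s * K))"
    using eps_le eps_small' by simp
  have Y: "0 \<le> Y" using y_nonneg[of e] y_le[of e] by linarith
  have Y': "0 \<le> Y'"
  proof (rule ccontr)
    assume "\<not> 0 \<le> Y'"
    then have "Y' * ((1 - \<epsilon>) ^ (r - 1) * (1 - \<epsilon> * (real g * s * K))) < 0"
      using q by (intro mult_neg_pos) auto
    then show False using Y'_ge Y by linarith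
  qed
  show ?thesis
  proof (cases "0 < y e")
    case True
    have "y e * (1 - \<epsilon>) \<le> Y' * ((1 - \<epsilon>) ^ (r - 1) * (1 - \<epsilon> * (real g * s * K))) * (1 - \<epsilon>)"
      using y_le[of e] Y'_ge eps_le by (intro mult_right_mono) auto
    also have "\<dots> = Y' * ((1 - \<epsilon>) ^ r * (1 - \<epsilon> * (real g * s * K)))"
      using r_ge_2 power_Suc[of "1 - \<epsilon>" "r - 1"] by (simp add: mult_ac)
    also have "\<dots> \<le> Y' * survival e"
      using survival_ge[OF True] Y' by (rule mult_left_mono)
    finally have "y e * (1 - \<epsilon>) / survival e \<le> Y'"
      using survival_pos[OF True] by (simp add: pos_divide_le_eq)
    then show ?thesis using Y' unfolding y1_def by simp
  qed (use Y' in \<open>simp add: y1_def\<close>)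
qed

lemma Y'_nonneg: "0 \<le> Y'"
  using y1_nonneg y1_le by (rule order_trans)

lemma y1_pos: "0 < y1 Z e \<Longrightarrow> 0 < y e \<and> Z \<inter> hazard e = {}"
  unfolding y1_def by (simp split: if_splits)

lemma y1_at_node: "v \<in> ends G e \<Longrightarrow> Z \<inter> star v \<noteq> {} \<Longrightarrow> y1 Z e = 0"
  using star_subset_hazard[of v e] unfolding y1_def by auto

lemma load_y1_hit: "Z \<inter> star v \<noteq> {} \<Longrightarrow> load (y1 Z) v = 0"
  unfolding load_def by (intro sum.neutral) (auto intro: y1_at_node)

text \<open>\<open>C\<close> collects trials conditioned to be missed: it is empty for the
  unconditional mean, and \<open>star v\<close> for the mean at a vertex \<open>v\<close> that
  survives.\<close>

lemma expectation_y1: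
  assumes "0 < y e" "C \<subseteq> trials"
  shows "bexp p (trials - C) (\<lambda>Z. y1 Z e) = y e * (1 - \<epsilon>) / survival e * (\<Prod>z\<in>hazard e - C. 1 - p z)"
proof -
  let ?a = "y e * (1 - \<epsilon>) / survival e"
  have "bexp p (trials - C) (\<lambda>Z. y1 Z e)
     = bexp p (trials - C) (\<lambda>Z. if Z \<inter> (hazard e - C) = {} then ?a else 0)"
    using assms(1) by (intro bexp_cong) (auto simp: y1_def)
  also have "\<dots> = (\<Prod>z\<in>hazard e - C. 1 - p z) * bexp p (trials - C - (hazard e - C)) (\<lambda>_. ?a)"
    using finite_trials hazard_subset[OF assms(1)] by (intro bexp_disjoint) auto
  also have "\<dots> = (\<Prod>z\<in>hazard e - C. 1 - p z) * ?a" using finite_trials by simp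
  finally show ?thesis by simp
qed

lemma expectation_y1_full: "bexp p trials (\<lambda>Z. y1 Z e) = (1 - \<epsilon>) * y e"
proof (cases "0 < y e")
  case True
  then show ?thesis
    using expectation_y1[OF True, of "{}"] survival_pos[OF True] by (simp add: survival_def)
next
  case False
  then have "y e = 0" "\<And>Z. y1 Z e = 0" using y_nonneg[of e] by (auto simp: y1_def)
  then show ?thesis using finite_trials by simp
qed

end

section \<open>Counting edges and configurations near a given edge\<close>

context bounded_configuration
begin

lemma card_common_neighbours_le:
  assumes "v \<in> verts G" "f \<in> edges G" "v \<notin> ends G f"
  shows "real (card {e \<in> edges G. v \<in> ends G e \<and> ends G e \<inter> ends G f \<noteq> {}}) \<le> real r * cd"
proof -
  have "{e \<in> edges G. v \<in> ends G e \<and> ends G e \<inter> ends G f \<noteq> {}}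
      = (\<Union>u\<in>ends G f. {e \<in> edges G. u \<in> ends G e \<and> v \<in> ends G e})" by blast
  then have "card {e \<in> edges G. v \<in> ends G e \<and> ends G e \<inter> ends G f \<noteq> {}}
      \<le> (\<Sum>u\<in>ends G f. codegree G u v)"
    unfolding codegree_def using card_UN_le[OF finite_ends[OF assms(2)]] by simp
  then have "real (card {e \<in> edges G. v \<in> ends G e \<and> ends G e \<inter> ends G f \<noteq> {}})
      \<le> (\<Sum>u\<in>ends G f. real (codegree G u v))" by (simp flip: of_nat_sum)
  also have "\<dots> \<le> real (card (ends G f)) * cd"
  proof (rule sum_bounded_above)
    fix u assume "u \<in> ends G f"
    then show "real (codegree G u v) \<le> cd"
      using assms ends_subset[OF assms(2)] by (intro codegree_le) auto
  qed
  finally show ?thesis by (simp add: card_ends[OF assms(2)])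
qed

text \<open>A configuration is a matching, so it determines its edge at \<open>v\<close>; counting
  these edges reduces to counting the configurations behind \<open>config_codegree\<close>.\<close>

lemma card_config_neighbours_le:
  assumes "v \<in> verts G" "f \<in> edges G" "v \<notin> ends G f"
  shows "real (card {e. v \<in> ends G e \<and> (\<exists>S\<in>H. e \<in> S \<and> f \<in> S)}) \<le> cc"
proof -
  let ?B = "{S \<in> H. f \<in> S \<and> (\<exists>h\<in>S. v \<in> ends G h)}"
  have "{e. v \<in> ends G e \<and> (\<exists>S\<in>H. e \<in> S \<and> f \<in> S)} \<subseteq> (\<lambda>S. the_elem {h \<in> S. v \<in> ends G h}) ` ?B"
  proof
    fix e assume "e \<in> {e. v \<in> ends G e \<and> (\<exists>S\<in>H. e \<in> S \<and> f \<in> S)}"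
    then obtain S where S: "v \<in> ends G e" "S \<in> H" "e \<in> S" "f \<in> S" by blast
    then have "{h \<in> S. v \<in> ends G h} = {e}" using config_disjoint[of S] by blast
    then have "e = the_elem {h \<in> S. v \<in> ends G h}" by simp
    moreover have "S \<in> ?B" using S by blast
    ultimately show "e \<in> (\<lambda>S. the_elem {h \<in> S. v \<in> ends G h}) ` ?B" by (rule image_eqI)
  qed
  then have "card {e. v \<in> ends G e \<and> (\<exists>S\<in>H. e \<in> S \<and> f \<in> S)} \<le> card ?B"
    using finite_H by (intro surj_card_le) auto
  also have "\<dots> = config_codegree G H v f" by (simp add: config_codegree_def)
  finally show ?thesis using config_codegree_le[OF assms] by linarith
qed

text \<open>If a member meets \<open>h\<close>, the configuration is counted by a codegree at one of
  the \<open>r\<close> vertices of \<open>h\<close>. If \<open>h\<close> is a member, linearity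
  leaves one configuration. If a further configuration joins \<open>h\<close> to a member, there is
  again only one: a second would close a triangle or a 4-cycle through \<open>e\<close>. This is the
  only use of the absence of 4-cycles.\<close>

lemma card_configs_near_le:
  assumes "e \<in> edges G" "h \<in> edges G" "ends G e \<inter> ends G h = {}"
  shows "real (card {S \<in> H. e \<in> S \<and> ((\<exists>f\<in>S. ends G f \<inter> ends G h \<noteq> {})
    \<or> (\<exists>f\<in>S. f \<noteq> e \<and> f \<noteq> h \<and> (\<exists>T\<in>H. f \<in> T \<and> h \<in> T)))}) \<le> real r * cc + 2"
proof -
  let ?B1 = "{S \<in> H. e \<in> S \<and> (\<exists>f\<in>S. ends G f \<inter> ends G h \<noteq> {})}"
  let ?B2 = "{S \<in> H. e \<in> S \<and> h \<in> S}"
  let ?B3 = "{S \<in> H. e \<in> S \<and> h \<notin> S \<and> (\<exists>f\<in>S. f \<noteq> e \<and> (\<exists>T\<in>H. f \<in> T \<and> h \<in> T))}"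
  have eh: "e \<noteq> h" using assms ends_nonempty by fastforce
  have fin: "finite ?B1" "finite ?B2" "finite ?B3" using finite_H by auto
  have "?B1 = (\<Union>u\<in>ends G h. {S \<in> H. e \<in> S \<and> (\<exists>f\<in>S. u \<in> ends G f)})" by blast
  then have "card ?B1 \<le> (\<Sum>u\<in>ends G h. config_codegree G H u e)"
    unfolding config_codegree_def using card_UN_le[OF finite_ends[OF assms(2)]] by simp
  then have "real (card ?B1) \<le> (\<Sum>u\<in>ends G h. real (config_codegree G H u e))"
    by (simp flip: of_nat_sum)
  also have "\<dots> \<le> real (card (ends G h)) * cc"
  proof (rule sum_bounded_above)
    fix u assume "u \<in> ends G h"
    then show "real (config_codegree G H u e) \<le> cc"
      using assms ends_subset[OF assms(2)] by (intro config_codegree_le) auto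
  qed
  finally have 1: "real (card ?B1) \<le> real r * cc" by (simp add: card_ends[OF assms(2)])
  have "S = T" if "S \<in> ?B2" "T \<in> ?B2" for S T
    using linear_if_girth[OF girth, of S T e h] that eh by blast
  then have 2: "card ?B2 \<le> 1" using fin(2) by (simp add: card_le_Suc0_iff_eq)
  have "S1 = S2" if S: "S1 \<in> ?B3" "S2 \<in> ?B3" for S1 S2
  proof (rule ccontr)
    assume ne: "S1 \<noteq> S2"
    from S(1) obtain f1 T1 where *: "S1 \<in> H" "e \<in> S1" "h \<notin> S1" "f1 \<in> S1" "f1 \<noteq> e" "T1 \<in> H"
      "f1 \<in> T1" "h \<in> T1" by auto
    from S(2) obtain f2 T2 where **: "S2 \<in> H" "e \<in> S2" "h \<notin> S2" "f2 \<in> S2" "f2 \<noteq> e" "T2 \<in> H"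
      "f2 \<in> T2" "h \<in> T2" by auto
    have f: "f1 \<noteq> f2"
      using linear_if_girth[OF girth *(1) **(1) *(2) **(2) *(4)] **(4) *(5) ne by auto
    have d: "f1 \<noteq> h" "f2 \<noteq> h" "S1 \<noteq> T1" "S1 \<noteq> T2" "S2 \<noteq> T1" "S2 \<noteq> T2"
      using *(3,4,8) **(3,4,8) by auto
    show False
    proof (cases "T1 = T2")
      case True
      show False
        by (rule triangle_free_if_girth[OF girth, of S1 T1 S2 f1 f2 e]) (use * ** f d ne True in simp_all)
    next
      case False
      show False
        by (rule square_free_if_girth[OF girth, of S1 T1 T2 S2 f1 h f2 e])
          (use * ** f d ne False eh in simp_all)
    qed
  qed
  then have 3: "card ?B3 \<le> 1" using fin(3) by (simp add: card_le_Suc0_iff_eq)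
  have "{S \<in> H. e \<in> S \<and> ((\<exists>f\<in>S. ends G f \<inter> ends G h \<noteq> {})
    \<or> (\<exists>f\<in>S. f \<noteq> e \<and> f \<noteq> h \<and> (\<exists>T\<in>H. f \<in> T \<and> h \<in> T)))} \<subseteq> ?B1 \<union> (?B2 \<union> ?B3)" by blast
  then have "card {S \<in> H. e \<in> S \<and> ((\<exists>f\<in>S. ends G f \<inter> ends G h \<noteq> {})
    \<or> (\<exists>f\<in>S. f \<noteq> e \<and> f \<noteq> h \<and> (\<exists>T\<in>H. f \<in> T \<and> h \<in> T)))} \<le> card (?B1 \<union> (?B2 \<union> ?B3))"
    using fin by (intro card_mono) auto
  also have "\<dots> \<le> card ?B1 + (card ?B2 + card ?B3)"
    using card_Un_le[of ?B1 "?B2 \<union> ?B3"] card_Un_le[of ?B2 ?B3] by linarith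
  finally show ?thesis using 1 2 3 by linarith
qed

end

section \<open>Loads after one round\<close>

context nibble_step
begin

lemma Inr_in_hazard: "Inr u \<in> hazard e \<longleftrightarrow> u \<in> ends G e"
  by (auto simp: hazard_def star_def)

lemma Inl_in_hazard_iff:
  "Inl f \<in> hazard e \<longleftrightarrow> 0 < y f \<and> ends G e \<inter> ends G f \<noteq> {} \<or> f \<in> blockers e"
  by (auto simp: hazard_def star_def)

lemma blockers_config:
  "f \<in> blockers e \<Longrightarrow> 0 < y f \<and> f \<noteq> e \<and> (\<exists>S\<in>H. e \<in> S \<and> f \<in> S)"
  by (auto simp: blockers_def)

lemma y1_antimono: "Z \<subseteq> Z' \<Longrightarrow> y1 Z' e \<le> y1 Z e"
  using y1_nonneg[of Z e] unfolding y1_def by auto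

lemma y1_local: "Z \<inter> hazard e = Z' \<inter> hazard e \<Longrightarrow> y1 Z e = y1 Z' e"
  unfolding y1_def by simp

text \<open>The trials in \<open>star v\<close> threaten every edge at \<open>v\<close>, and they
  are removed by conditioning on \<open>v\<close> not being hit. Any other trial reaches an edge at
  \<open>v\<close> only through a common vertex or a common configuration, both rare.\<close>

lemma card_hazards_at_le:
  assumes v: "v \<in> verts G" and z: "z \<in> trials - star v"
  shows "real (card {e \<in> {e. 0 < y e \<and> v \<in> ends G e}. z \<in> hazard e}) \<le> real r * cd + cc"
proof (cases z)
  case (Inr u)
  then have u: "u \<in> verts G" "u \<noteq> v" using z by (auto simp: trials_def star_def)
  have "{e \<in> {e. 0 < y e \<and> v \<in> ends G e}. z \<in> hazard e} \<subseteq> {e \<in> edges G. u \<in> ends G e \<and> v \<in> ends G e}"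
    using y_edge Inr Inr_in_hazard by blast
  then have "card {e \<in> {e. 0 < y e \<and> v \<in> ends G e}. z \<in> hazard e} \<le> codegree G u v"
    unfolding codegree_def using finite_edges by (intro card_mono) auto
  then have "real (card {e \<in> {e. 0 < y e \<and> v \<in> ends G e}. z \<in> hazard e}) \<le> cd"
    using codegree_le[OF u(1) v u(2)] by linarith
  also have "cd \<le> real r * cd" using r_ge_2 cd_nonneg mult_right_mono[of 1 "real r" cd] by simp
  finally show ?thesis using cc_nonneg by linarith
next
  case (Inl f)
  then have f: "0 < y f" "v \<notin> ends G f" using z by (auto simp: trials_def star_def)
  have fE: "f \<in> edges G" using y_edge[OF f(1)] .
  let ?B1 = "{e \<in> edges G. v \<in> ends G e \<and> ends G e \<inter> ends G f \<noteq> {}}"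
  let ?B2 = "{e. v \<in> ends G e \<and> (\<exists>S\<in>H. e \<in> S \<and> f \<in> S)}"
  have fin: "finite ?B1" "finite ?B2"
    using finite_edges by (auto intro: finite_subset[OF _ finite_edges] dest: config_subset)
  have "{e \<in> {e. 0 < y e \<and> v \<in> ends G e}. z \<in> hazard e} \<subseteq> ?B1 \<union> ?B2"
  proof
    fix e assume "e \<in> {e \<in> {e. 0 < y e \<and> v \<in> ends G e}. z \<in> hazard e}"
    then have e: "0 < y e" "v \<in> ends G e" "Inl f \<in> hazard e" using Inl by auto
    from e(3) consider "ends G e \<inter> ends G f \<noteq> {}" | "f \<in> blockers e" unfolding Inl_in_hazard_iff by auto
    then show "e \<in> ?B1 \<union> ?B2"
    proof cases
      case 1
      then show ?thesis using e(2) y_edge[OF e(1)] by simp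
    next
      case 2
      then show ?thesis using e(2) blockers_config[OF 2] by simp
    qed
  qed
  then have "card {e \<in> {e. 0 < y e \<and> v \<in> ends G e}. z \<in> hazard e} \<le> card (?B1 \<union> ?B2)"
    using fin by (intro card_mono) auto
  also have "\<dots> \<le> card ?B1 + card ?B2" by (rule card_Un_le)
  finally show ?thesis
    using card_common_neighbours_le[OF v fE f(2)] card_config_neighbours_le[OF v fE f(2)] by linarith
qed

text \<open>A hit vertex has load 0 and no excess. Given that \<open>star v\<close> is missed, each
  weight at \<open>v\<close> has mean \<open>y e\<close>, so the mean load does not move and the
  excess grows only by the variance.\<close>

lemma expected_load_excess:
  assumes v: "v \<in> verts G" and c: "0 \<le> c"
  shows "bexp p trials (\<lambda>Z. (max 0 (load (y1 Z) v - c))\<^sup>2)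
    \<le> (max 0 (load y v - c))\<^sup>2 + 2 * \<eta> * (real r * cd + cc) * Y'"
proof -
  define I where "I = {e. 0 < y e \<and> v \<in> ends G e}"
  define \<Omega> where "\<Omega> = trials - star v"
  let ?f = "\<lambda>Z. (max 0 (load (y1 Z) v - c))\<^sup>2"
  have finI: "finite I" unfolding I_def by (rule finite_live_at)
  have fin\<Omega>: "finite \<Omega>" unfolding \<Omega>_def using finite_trials by simp
  have sub\<Omega>: "\<Omega> \<subseteq> trials" unfolding \<Omega>_def by blast
  have pO: "0 \<le> p z \<and> p z \<le> 1" if "z \<in> \<Omega>" for z using p_prob sub\<Omega> that by blast
  have load1: "load (y1 Z) v = (\<Sum>e\<in>I. y1 Z e)" for Z
    unfolding load_def
  proof (rule sum.mono_neutral_right)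
    show "\<forall>i\<in>{e \<in> edges G. v \<in> ends G e} - I. y1 Z i = 0" by (auto simp: I_def y1_def)
  qed (use finite_edges y_edge in \<open>auto simp: I_def\<close>)
  have mean1: "bexp p \<Omega> (\<lambda>Z. y1 Z e) = y e" if "e \<in> I" for e
  proof -
    have e: "0 < y e" "v \<in> ends G e" using that by (auto simp: I_def)
    have "survival e = (\<Prod>z\<in>hazard e - star v. 1 - p z) * (\<Prod>z\<in>star v. 1 - p z)"
      unfolding survival_def
      by (rule prod.subset_diff[OF star_subset_hazard[OF e(2)] finite_hazard[OF e(1)]])
    then have "survival e = (1 - \<epsilon>) * (\<Prod>z\<in>hazard e - star v. 1 - p z)"
      using prod_star[OF v] by simp
    then have "y e * (1 - \<epsilon>) / survival e * (\<Prod>z\<in>hazard e - star v. 1 - p z) = y e * (survival e / survival e)"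
      by simp
    then show ?thesis
      unfolding \<Omega>_def expectation_y1[OF e(1) star_subset[OF v]]
      using survival_pos[OF e(1)] by simp
  qed
  have mean: "bexp p \<Omega> (\<lambda>Z. \<Sum>e\<in>I. y1 Z e) = load y v"
    unfolding bexp_sum load_eq using mean1 by (simp add: I_def)
  \<comment> \<open>Further trials can only lower a weight, so the sets \<open>W\<close> of the
    variance bound are empty.\<close>
  have Var: "bexp p \<Omega> (\<lambda>Z. (\<Sum>e\<in>I. y1 Z e)\<^sup>2) - (bexp p \<Omega> (\<lambda>Z. \<Sum>e\<in>I. y1 Z e))\<^sup>2
    \<le> (real r * cd + cc) * Y' *
      (\<Sum>e\<in>I. (real (card ({} :: ('e + 'v) set)) + 2 * (\<Sum>z\<in>\<Omega> \<inter> hazard e. p z)) * bexp p \<Omega> (\<lambda>Z. y1 Z e))"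
  proof (rule bexp_variance_sum_le[where F = "\<lambda>e Z. y1 Z e" and N = hazard and W = "\<lambda>_. {}", OF fin\<Omega> finI])
    show "0 \<le> p z \<and> p z \<le> 1 / 2" if "z \<in> \<Omega>" for z using p_half sub\<Omega> that by blast
    show "0 \<le> y1 Z i \<and> y1 Z i \<le> Y'" for i Z using y1_nonneg y1_le by blast
    show "y1 (insert z Z) i = y1 (Z - {z}) i" if "z \<in> \<Omega> - hazard i" for i z Z
      using that by (intro y1_local) auto
    show "y1 (insert z Z) i \<le> y1 (Z - {z}) i" for i z Z by (rule y1_antimono) blast
    show "real (card {i \<in> I. z \<in> hazard i}) \<le> real r * cd + cc" if "z \<in> \<Omega>" for z
      using card_hazards_at_le[OF v] that unfolding \<Omega>_def I_def by blast
    show "0 \<le> Y'" by (rule Y'_nonneg)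
    show "0 \<le> real r * cd + cc" using cd_nonneg cc_nonneg by simp
  qed simp
  have "(\<Sum>e\<in>I. (real (card ({} :: ('e + 'v) set)) + 2 * (\<Sum>z\<in>\<Omega> \<inter> hazard e. p z)) * bexp p \<Omega> (\<lambda>Z. y1 Z e))
      \<le> (\<Sum>e\<in>I. 2 * \<eta> * y e)"
  proof (rule sum_mono)
    fix e assume e: "e \<in> I"
    then have "0 < y e" by (simp add: I_def)
    have "(\<Sum>z\<in>\<Omega> \<inter> hazard e. p z) \<le> (\<Sum>z\<in>hazard e. p z)"
    proof (rule sum_mono2[OF finite_hazard[OF \<open>0 < y e\<close>]])
      fix z assume "z \<in> hazard e - \<Omega> \<inter> hazard e"
      then show "0 \<le> p z" using hazard_subset[OF \<open>0 < y e\<close>] p_bounds by blast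
    qed blast
    also have "\<dots> \<le> \<eta>" using sum_hazard_le[OF \<open>0 < y e\<close>] .
    finally have "2 * (\<Sum>z\<in>\<Omega> \<inter> hazard e. p z) * y e \<le> 2 * \<eta> * y e"
      using y_nonneg[of e] by (intro mult_right_mono) auto
    then show "(real (card ({} :: ('e + 'v) set)) + 2 * (\<Sum>z\<in>\<Omega> \<inter> hazard e. p z)) * bexp p \<Omega> (\<lambda>Z. y1 Z e) \<le> 2 * \<eta> * y e"
      unfolding mean1[OF e] by simp
  qed
  also have "\<dots> = 2 * \<eta> * load y v" by (simp add: I_def load_eq sum_distrib_left)
  also have "\<dots> \<le> 2 * \<eta>"
    using load_le_1[OF v] eps_pos K_nonneg by (intro mult_left_le) auto
  finally have "(real r * cd + cc) * Y' *
      (\<Sum>e\<in>I. (real (card ({} :: ('e + 'v) set)) + 2 * (\<Sum>z\<in>\<Omega> \<inter> hazard e. p z)) * bexp p \<Omega> (\<lambda>Z. y1 Z e))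
      \<le> (real r * cd + cc) * Y' * (2 * \<eta>)"
    using cd_nonneg cc_nonneg Y'_nonneg by (intro mult_left_mono) auto
  with Var have Var': "bexp p \<Omega> (\<lambda>Z. (\<Sum>e\<in>I. y1 Z e)\<^sup>2) - (bexp p \<Omega> (\<lambda>Z. \<Sum>e\<in>I. y1 Z e))\<^sup>2
    \<le> (real r * cd + cc) * Y' * (2 * \<eta>)" by linarith
  have "bexp p trials ?f = bexp p trials (\<lambda>Z. if Z \<inter> star v = {} then ?f Z else 0)"
    by (rule bexp_cong) (use c in \<open>auto simp: load_y1_hit max_def\<close>)
  also have "\<dots> = (1 - \<epsilon>) * bexp p \<Omega> ?f"
    unfolding \<Omega>_def bexp_disjoint[OF finite_trials star_subset[OF v]] prod_star[OF v] ..
  also have "\<dots> \<le> bexp p \<Omega> ?f"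
  proof (rule mult_left_le_one_le)
    show "0 \<le> bexp p \<Omega> ?f" by (rule bexp_nonneg[OF pO]) simp_all
  qed (use eps_le eps_pos in auto)
  also have "\<dots> \<le> (max 0 (load y v - c))\<^sup>2 + (real r * cd + cc) * Y' * (2 * \<eta>)"
    using bexp_pos_part_square_le[where p = p and f = "\<lambda>Z. load (y1 Z) v" and c = c, OF fin\<Omega> pO] Var'
    unfolding load1 mean by linarith
  finally show ?thesis by (simp add: algebra_simps)
qed

text \<open>Disjointness of \<open>e\<close> and \<open>f\<close> rules out common dummy trials, and
  a common blocker would close a triangle with \<open>S\<close>. What remains are edges meeting
  both, or meeting one while sharing a configuration with the other; codegrees count these.\<close>

lemma sum_hazard_overlap_le:
  assumes e: "0 < y e" and f: "0 < y f" and S: "S \<in> H" "e \<in> S" "f \<in> S" "e \<noteq> f"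
  shows "(\<Sum>z\<in>hazard e \<inter> hazard f. p z) \<le> \<epsilon> * Y * ((real r)\<^sup>2 * cd + 2 * real r * cc)"
proof -
  have eE: "e \<in> edges G" and fE: "f \<in> edges G" using y_edge e f by auto
  have dis: "ends G e \<inter> ends G f = {}" using config_disjoint[OF S] .
  define Q where "Q = {h. Inl h \<in> hazard e \<inter> hazard f}"
  have eq: "hazard e \<inter> hazard f = Inl ` Q"
  proof -
    have "z \<in> Inl ` Q" if "z \<in> hazard e \<inter> hazard f" for z
      using that dis Inr_in_hazard by (cases z) (auto simp: Q_def)
    then show ?thesis by (auto simp: Q_def)
  qed
  have QE: "Q \<subseteq> edges G" using hazard_subset[OF e] y_edge by (auto simp: Q_def trials_def)
  let ?B1 = "\<Union>u\<in>ends G e. {h \<in> edges G. u \<in> ends G h \<and> ends G h \<inter> ends G f \<noteq> {}}"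
  let ?B2 = "\<Union>u\<in>ends G e. {h. u \<in> ends G h \<and> (\<exists>S\<in>H. h \<in> S \<and> f \<in> S)}"
  let ?B3 = "\<Union>u\<in>ends G f. {h. u \<in> ends G h \<and> (\<exists>S\<in>H. h \<in> S \<and> e \<in> S)}"
  \<comment> \<open>Live edges lie outside \<open>A\<close>, so neither blocking configuration can
    be \<open>S\<close>; linearity separates the two from each other, and with \<open>S\<close> they
    form a triangle on \<open>h\<close>, \<open>f\<close>, \<open>e\<close>.\<close>
  have no: "False" if "h \<in> blockers e" "h \<in> blockers f" for h
  proof -
    from that obtain S1 S2 where *: "S1 \<in> H" "e \<in> S1" "h \<in> S1" "S1 - {e, h} \<subseteq> A" "h \<noteq> e" "h \<noteq> f"
      "S2 \<in> H" "f \<in> S2" "h \<in> S2" "S2 - {f, h} \<subseteq> A"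
      unfolding blockers_def by blast
    have n1: "S1 \<noteq> S"
    proof
      assume "S1 = S"
      then have "f \<in> S1 - {e, h}" using S(3,4) *(6) by simp
      then show False using *(4) live_notin_A[OF f] by auto
    qed
    have n2: "S2 \<noteq> S"
    proof
      assume "S2 = S"
      then have "e \<in> S2 - {f, h}" using S(2,4) *(5) by simp
      then show False using *(10) live_notin_A[OF e] by auto
    qed
    have n3: "S1 \<noteq> S2"
      using linear_if_girth[OF girth *(1) S(1) *(2) S(2) _ S(3,4)] *(8) n1 by auto
    show False
      by (rule triangle_free_if_girth[OF girth, of S1 S2 S h f e]) (use * S n1 n2 n3 in simp_all)
  qed
  have "Q \<subseteq> ?B1 \<union> (?B2 \<union> ?B3)"
  proof
    fix h assume h: "h \<in> Q"
    then have h: "Inl h \<in> hazard e" "Inl h \<in> hazard f" "h \<in> edges G" using QE by (auto simp: Q_def)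
    from h(1,2) no[of h] consider "ends G e \<inter> ends G h \<noteq> {}" "ends G f \<inter> ends G h \<noteq> {}"
      | "ends G e \<inter> ends G h \<noteq> {}" "h \<in> blockers f" | "h \<in> blockers e" "ends G f \<inter> ends G h \<noteq> {}"
      unfolding Inl_in_hazard_iff by auto
    then show "h \<in> ?B1 \<union> (?B2 \<union> ?B3)"
    proof cases
      case 1
      then have "h \<in> ?B1" using h(3) by auto
      then show ?thesis by simp
    next
      case 2
      then have "h \<in> ?B2" using blockers_config[OF 2(2)] by auto
      then show ?thesis by simp
    next
      case 3
      then have "h \<in> ?B3" using blockers_config[OF 3(1)] by auto
      then show ?thesis by simp
    qed
  qed
  moreover have "finite (?B1 \<union> (?B2 \<union> ?B3))"
    using finite_edges by (rule rev_finite_subset) (auto dest: config_subset)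
  ultimately have "card Q \<le> card (?B1 \<union> (?B2 \<union> ?B3))" by (intro card_mono) auto
  also have "\<dots> \<le> card ?B1 + (card ?B2 + card ?B3)"
    using card_Un_le[of ?B1 "?B2 \<union> ?B3"] card_Un_le[of ?B2 ?B3] by linarith
  finally have Q: "real (card Q) \<le> real (card ?B1) + (real (card ?B2) + real (card ?B3))" by linarith
  have UN: "real (card (\<Union>u\<in>ends G x. N u)) \<le> real r * b"
    if "x \<in> edges G" "\<And>u. u \<in> ends G x \<Longrightarrow> real (card (N u)) \<le> b" for x and N :: "'v \<Rightarrow> 'e set" and b
  proof -
    have "real (card (\<Union>u\<in>ends G x. N u)) \<le> (\<Sum>u\<in>ends G x. real (card (N u)))"
      using card_UN_le[OF finite_ends[OF that(1)], of N] by (simp flip: of_nat_sum)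
    also have "\<dots> \<le> real (card (ends G x)) * b" by (rule sum_bounded_above[OF that(2)])
    finally show ?thesis by (simp add: card_ends[OF that(1)])
  qed
  have uv: "u \<in> verts G" "u \<notin> ends G f" if "u \<in> ends G e" for u
    using that dis ends_subset[OF eE] by auto
  have uv': "u \<in> verts G" "u \<notin> ends G e" if "u \<in> ends G f" for u
    using that dis ends_subset[OF fE] by auto
  have "real (card ?B1) \<le> real r * (real r * cd)"
    by (rule UN[OF eE card_common_neighbours_le[OF uv(1) fE uv(2)]])
  moreover have "real (card ?B2) \<le> real r * cc"
    by (rule UN[OF eE card_config_neighbours_le[OF uv(1) fE uv(2)]])
  moreover have "real (card ?B3) \<le> real r * cc"
    by (rule UN[OF fE card_config_neighbours_le[OF uv'(1) eE uv'(2)]])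
  ultimately have cQ: "real (card Q) \<le> (real r)\<^sup>2 * cd + 2 * real r * cc"
    using Q by (simp add: power2_eq_square)
  have "(\<Sum>z\<in>hazard e \<inter> hazard f. p z) = (\<Sum>h\<in>Q. \<epsilon> * y h)"
    unfolding eq by (subst sum.reindex) (auto simp: p_Inl)
  also have "\<dots> \<le> real (card Q) * (\<epsilon> * Y)"
    using y_le eps_pos by (intro sum_bounded_above mult_left_mono) auto
  also have "\<dots> \<le> ((real r)\<^sup>2 * cd + 2 * real r * cc) * (\<epsilon> * Y)"
    using cQ eps_pos order_trans[OF y_nonneg[of e] y_le[of e]] by (intro mult_right_mono) auto
  finally show ?thesis by (simp add: mult_ac)
qed

end

section \<open>Dangers after one round\<close>

locale sparse_nibble_step = nibble_step G H r g cd cc A y s \<epsilon> K Y Y'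
  for G :: "('v, 'e) multi_hypergraph" and H r g cd cc A y s \<epsilon> K Y Y' +
  assumes overlap_small: "(real g)\<^sup>2 * (\<epsilon> * Y * ((real r)\<^sup>2 * cd + 2 * real r * cc)) \<le> 1 / 2"
    and gain_small: "Y' * (1 + 1 / (real g * ((1 - \<epsilon>) * s))) \<le> 1"
begin

abbreviation "\<tau> \<equiv> \<epsilon> * Y * ((real r)\<^sup>2 * cd + 2 * real r * cc)"

abbreviation "boost \<equiv> 1 + 1 / (real g * s1)"

abbreviation "\<upsilon> \<equiv> Y' * boost"

text \<open>The contribution of one configuration to the new danger. A completed configuration
  counts 0 rather than 1 because it is no longer pending; so a nonzero value always retains a factor
  of an unactivated edge and is at most \<upsilon>.\<close>

definition gain :: "'e \<Rightarrow> 'e set \<Rightarrow> ('e + 'v) set \<Rightarrow> real" where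
  "gain e S Z = (if Inl ` (S - {e} - A) \<subseteq> Z then 0
    else \<Prod>f\<in>S - {e} - A. if Inl f \<in> Z then 1 else boost * y1 Z f)"

lemma Y_nonneg: "0 \<le> Y"
  using order_trans[OF y_nonneg[of undefined] y_le[of undefined]] .

lemma tau_nonneg: "0 \<le> \<tau>"
  using eps_pos Y_nonneg cd_nonneg cc_nonneg by simp

lemma boost_pos: "0 < boost"
  using s1_pos g_ge_2 by (simp add: add_pos_nonneg)

text \<open>Multiplied by \<open>y f\<close>, the left side is the expected next factor of a single
  edge: \<open>\<epsilon> * y f\<close> from activation and
  \<open>boost * (1 - \<epsilon>) * y f\<close> from survival.\<close>

lemma boost_balance: "\<epsilon> + boost * (1 - \<epsilon>) = 1 + 1 / (real g * s)"
proof -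
  have "1 - \<epsilon> \<noteq> 0" using eps_le by simp
  then have "1 / (real g * s1) * (1 - \<epsilon>) = 1 / (real g * s)" by simp
  then show ?thesis by (simp only: distrib_right) simp
qed

lemma g_tau_le: "real g * \<tau> \<le> 1 / 2"
proof -
  have "real g * \<tau> \<le> real g * (real g * \<tau>)"
    using g_ge_2 tau_nonneg mult_right_mono[of 1 "real g" "real g * \<tau>"] by simp
  then show ?thesis using overlap_small by (simp only: power2_eq_square mult.assoc)
qed

lemma finite_open: "S \<in> H \<Longrightarrow> finite (S - {e} - A)"
  using finite_config by simp

lemma card_open_le: "S \<in> H \<Longrightarrow> card (S - {e} - A) \<le> g"
  using card_mono[of S "S - {e} - A"] finite_config[of S] card_config_le[of S] by fastforce

lemma prod_factor:
  assumes "S \<in> H"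
  shows "(\<Prod>f\<in>S - {e}. factor s A y f) = (\<Prod>f\<in>S - {e} - A. y f * (1 + 1 / (real g * s)))"
proof (rule prod.mono_neutral_cong_right)
  show "\<forall>i\<in>S - {e} - (S - {e} - A). factor s A y i = 1" by (auto simp: factor_def)
qed (use finite_config[OF assms] in \<open>auto simp: factor_def\<close>)

lemma completes_iff: "S - {e} \<subseteq> A1 Z \<longleftrightarrow> Inl ` (S - {e} - A) \<subseteq> Z"
  unfolding A1_def by blast

lemma danger_eq_sum_gain: "danger s1 (A1 Z) (y1 Z) e = (\<Sum>S\<in>pending A e. gain e S Z)"
proof -
  have "(\<Sum>S\<in>pending A e. gain e S Z) = (\<Sum>S\<in>pending (A1 Z) e. \<Prod>f\<in>S - {e}. factor s1 (A1 Z) (y1 Z) f)"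
  proof (rule sum.mono_neutral_cong_right[OF finite_pending])
    show "pending (A1 Z) e \<subseteq> pending A e" by (auto simp: pending_def A1_def)
    show "\<forall>S\<in>pending A e - pending (A1 Z) e. gain e S Z = 0"
    proof
      fix S assume "S \<in> pending A e - pending (A1 Z) e"
      then have "S - {e} \<subseteq> A1 Z" by (simp add: pending_def)
      then show "gain e S Z = 0" unfolding completes_iff gain_def by simp
    qed
    fix S assume S: "S \<in> pending (A1 Z) e"
    then have SH: "S \<in> H" "\<not> S - {e} \<subseteq> A1 Z" by (auto simp: pending_def)
    then have "gain e S Z = (\<Prod>f\<in>S - {e} - A. if Inl f \<in> Z then 1 else boost * y1 Z f)"
      unfolding completes_iff gain_def by simp
    also have "\<dots> = (\<Prod>f\<in>S - {e}. factor s1 (A1 Z) (y1 Z) f)"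
    proof (rule prod.mono_neutral_cong_left)
      show "\<forall>i\<in>S - {e} - (S - {e} - A). factor s1 (A1 Z) (y1 Z) i = 1"
        by (auto simp: factor_def A1_def)
      show "(if Inl x \<in> Z then 1 else boost * y1 Z x) = factor s1 (A1 Z) (y1 Z) x"
        if "x \<in> S - {e} - A" for x using that by (simp add: factor_def A1_def)
    qed (use finite_config[OF SH(1)] in auto)
    finally show "gain e S Z = (\<Prod>f\<in>S - {e}. factor s1 (A1 Z) (y1 Z) f)" .
  qed
  then show ?thesis by (simp add: danger_def)
qed

text \<open>With disjoint hazards the edges of \<open>Q\<close> would survive independently, also
  given that the hazard of \<open>e\<close> is missed. Each further hazard overlaps those of
  \<open>e\<close> and of the earlier edges in trials of total probability at most
  \<open>g * \<tau>\<close>, so independence fails by at most a factor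
  \<open>1 / (1 - g * \<tau>)\<close> per edge.\<close>

lemma prod_hazards_le:
  assumes "finite Q" "0 < y e" "S \<in> H" "e \<in> S" "Q \<subseteq> S - {e}" "\<And>f. f \<in> Q \<Longrightarrow> 0 < y f"
  shows "(\<Prod>z\<in>(\<Union>f\<in>Q. hazard f) - hazard e. 1 - p z) * (1 - real g * \<tau>) ^ card Q
    \<le> (\<Prod>f\<in>Q. survival f)"
  using assms(1,5,6)
proof (induction Q rule: finite_induct)
  case (insert f Q)
  let ?q = "\<lambda>z. 1 - p z" and ?U = "(\<Union>f\<in>Q. hazard f) - hazard e"
  let ?X = "\<Union>i\<in>insert e Q. hazard i \<inter> hazard f"
  have f: "0 < y f" "f \<in> S" "f \<noteq> e" "f \<notin> Q" using insert.prems insert.hyps by auto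
  have live: "0 < y i" "i \<in> S" "i \<noteq> f" if "i \<in> insert e Q" for i
    using that f insert.prems assms(2,4) by auto
  have hz: "hazard f \<subseteq> trials" "finite (hazard f)"
    using hazard_subset[OF f(1)] finite_hazard[OF f(1)] by auto
  have finU: "finite ?U" using finite_hazard insert.hyps insert.prems(2) by auto
  have Usub: "?U \<subseteq> trials" using hazard_subset insert.prems(2) by blast
  have Xsub: "?X \<subseteq> hazard f" by blast
  have finX: "finite ?X" using finite_subset[OF Xsub hz(2)] .
  have nonneg: "0 \<le> prod ?q B" if "B \<subseteq> trials" for B
    using that one_minus_p by (intro prod_nonneg) blast
  have "sum p ?X \<le> (\<Sum>i\<in>insert e Q. sum p (hazard i \<inter> hazard f))"
  proof (rule sum_UN_le_real)
    fix x assume "x \<in> ?X"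
    then show "0 \<le> p x" using Xsub hz(1) p_bounds by blast
  qed (use insert.hyps hz in auto)
  also have "\<dots> \<le> real (card (insert e Q)) * \<tau>"
    by (rule sum_bounded_above)
      (use sum_hazard_overlap_le[OF live(1) f(1) assms(3) live(2) f(2) live(3)] in blast)
  also have "\<dots> \<le> real g * \<tau>"
  proof (rule mult_right_mono[OF _ tau_nonneg])
    have "card (insert e Q) \<le> card S"
      using insert.prems assms(4) finite_config[OF assms(3)] by (intro card_mono) auto
    then show "real (card (insert e Q)) \<le> real g" using card_config_le[OF assms(3)] by linarith
  qed
  finally have sX: "sum p ?X \<le> real g * \<tau>" .
  have "1 - sum p ?X \<le> prod ?q ?X"
  proof (rule Weierstrass_prod_ineq)
    fix x assume "x \<in> ?X"
    then have "x \<in> trials" using Xsub hz(1) by blast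
    then show "p x \<in> {0..1}" using p_prob by simp
  qed
  then have pX: "1 - real g * \<tau> \<le> prod ?q ?X" using sX by linarith
  have sf: "survival f = prod ?q (hazard f - ?X) * prod ?q ?X"
    unfolding survival_def by (rule prod.subset_diff[OF Xsub hz(2)])
  have "prod ?q (hazard f - ?X) * (1 - real g * \<tau>) \<le> survival f"
    unfolding sf using pX nonneg[of "hazard f - ?X"] hz(1) by (intro mult_left_mono) auto
  moreover have IH: "prod ?q ?U * (1 - real g * \<tau>) ^ card Q \<le> (\<Prod>f\<in>Q. survival f)"
    using insert.prems by (intro insert.IH) auto
  ultimately have "(prod ?q ?U * (1 - real g * \<tau>) ^ card Q) * (prod ?q (hazard f - ?X) * (1 - real g * \<tau>))
      \<le> (\<Prod>f\<in>Q. survival f) * survival f"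
  proof (intro mult_mono)
    show "0 \<le> (\<Prod>f\<in>Q. survival f)"
      using survival_pos insert.prems(2) by (intro prod_nonneg) (meson insertI2 less_imp_le)
    show "0 \<le> prod ?q (hazard f - ?X) * (1 - real g * \<tau>)"
      using nonneg[of "hazard f - ?X"] hz(1) g_tau_le by (intro mult_nonneg_nonneg) auto
  qed auto
  moreover have "(\<Union>f\<in>insert f Q. hazard f) - hazard e = ?U \<union> (hazard f - ?X)"
    by auto
  moreover have "prod ?q (?U \<union> (hazard f - ?X)) = prod ?q ?U * prod ?q (hazard f - ?X)"
    using finU hz(2) by (intro prod.union_disjoint) auto
  ultimately show ?case using insert.hyps by (simp add: mult_ac)
qed simp

text \<open>The product is expanded over the set \<open>W\<close> of activated edges. Up to the
  overlap of hazards each term factorises into activation and survival probabilities, and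
  \<open>boost_balance\<close> reassembles the sum into the old product. Bernoulli's inequality
  merges the losses per edge into \<open>1 - g^2 * \<tau>\<close>.\<close>

lemma expected_gain_le:
  assumes e: "0 < y e" and S: "S \<in> pending A e"
  shows "(1 - (real g)\<^sup>2 * \<tau>) * bexp p (trials - hazard e) (gain e S) \<le> (\<Prod>f\<in>S - {e}. factor s A y f)"
proof -
  define R where "R = S - {e} - A"
  define \<Omega> where "\<Omega> = trials - hazard e"
  have SH: "S \<in> H" "e \<in> S" using S by (auto simp: pending_def)
  have finR: "finite R" unfolding R_def by (rule finite_open[OF SH(1)])
  have cR: "card R \<le> g" unfolding R_def by (rule card_open_le[OF SH(1)])
  have fin\<Omega>: "finite \<Omega>" unfolding \<Omega>_def using finite_trials by simp
  have pO: "0 \<le> p z \<and> p z \<le> 1" if "z \<in> \<Omega>" for z using p_prob that unfolding \<Omega>_def by blast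
  have x: "0 \<le> 1 - (real g)\<^sup>2 * \<tau>" using overlap_small by linarith
  show ?thesis
  proof (cases "\<forall>f\<in>R. 0 < y f")
    case False
    then obtain f where f: "f \<in> R" "\<not> 0 < y f" by blast
    have "gain e S Z = 0" if Z: "Z \<subseteq> \<Omega>" for Z
    proof -
      have "Inl f \<notin> Z" using Z f(2) unfolding \<Omega>_def trials_def by blast
      then have "\<exists>f\<in>S - {e} - A. (if Inl f \<in> Z then 1 else boost * y1 Z f) = 0"
        using f unfolding R_def by (intro bexI[of _ f]) (auto simp: y1_def)
      then have "(\<Prod>f\<in>S - {e} - A. if Inl f \<in> Z then 1 else boost * y1 Z f) = 0"
        by (rule prod_zero[OF finite_open[OF SH(1)]])
      then show ?thesis unfolding gain_def by simp
    qed
    then have "bexp p \<Omega> (gain e S) = bexp p \<Omega> (\<lambda>_. 0)" by (intro bexp_cong)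
    then show ?thesis
      using fin\<Omega> factor_nonneg[OF y_nonneg s_pos] unfolding \<Omega>_def[symmetric] by (simp add: prod_nonneg)
  next
    case live: True
    \<comment> \<open>\<open>a W\<close> is the value of the factors outside \<open>W\<close> if all
      these edges survive; \<open>C W\<close> consists of the trials that must then be missed in
      addition to the hazard of \<open>e\<close>.\<close>
    define a where "a W = (\<Prod>f\<in>R - W. boost * (y f * (1 - \<epsilon>) / survival f))" for W
    define C where "C W = (\<Union>f\<in>R - W. hazard f) - hazard e" for W
    have anonneg: "0 \<le> a W" for W
      unfolding a_def
    proof (rule prod_nonneg)
      fix f assume "f \<in> R - W"
      then have "0 < y f" using live by blast
      then show "0 \<le> boost * (y f * (1 - \<epsilon>) / survival f)"
        using boost_pos survival_pos[of f] eps_le by (intro mult_nonneg_nonneg divide_nonneg_nonneg) auto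
    qed
    have term1: "(\<Prod>f\<in>W. if Inl f \<in> Z then 1 else 0) * (\<Prod>f\<in>R - W. boost * y1 Z f)
        = a W * (if Inl ` W \<subseteq> Z \<and> Z \<inter> C W = {} then 1 else 0)"
      if W: "W \<subseteq> R" and Z: "Z \<subseteq> \<Omega>" for W Z
    proof -
      have finW: "finite W" using finite_subset[OF W finR] .
      consider "\<not> Inl ` W \<subseteq> Z" | "Inl ` W \<subseteq> Z" "Z \<inter> C W \<noteq> {}" | "Inl ` W \<subseteq> Z" "Z \<inter> C W = {}" by blast
      then show ?thesis
      proof cases
        case 1
        then have "\<exists>f\<in>W. (if Inl f \<in> Z then 1 else 0 :: real) = 0" by auto
        then have "(\<Prod>f\<in>W. if Inl f \<in> Z then 1 else 0 :: real) = 0" by (rule prod_zero[OF finW])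
        then show ?thesis using 1 by simp
      next
        case 2
        then obtain f where "f \<in> R - W" "Z \<inter> hazard f \<noteq> {}" unfolding C_def by blast
        then have "\<exists>f\<in>R - W. boost * y1 Z f = 0" by (intro bexI[of _ f]) (auto simp: y1_def)
        then have "(\<Prod>f\<in>R - W. boost * y1 Z f) = 0" using finR by (intro prod_zero) auto
        then show ?thesis using 2 by simp
      next
        case 3
        have "(\<Prod>f\<in>W. if Inl f \<in> Z then 1 else 0 :: real) = 1" using 3(1) by (intro prod.neutral) auto
        moreover have "(\<Prod>f\<in>R - W. boost * y1 Z f) = a W"
          unfolding a_def
        proof (rule prod.cong[OF refl])
          fix f assume f: "f \<in> R - W"
          have "Z \<inter> hazard f = {}" using 3(2) Z f unfolding C_def \<Omega>_def by blast
          then show "boost * y1 Z f = boost * (y f * (1 - \<epsilon>) / survival f)"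
            using live f by (simp add: y1_def)
        qed
        ultimately show ?thesis using 3 by simp
      qed
    qed
    have pt: "gain e S Z \<le> (\<Sum>W\<in>Pow R. a W * (if Inl ` W \<subseteq> Z \<and> Z \<inter> C W = {} then 1 else 0))"
      if Z: "Z \<subseteq> \<Omega>" for Z
    proof -
      have "0 \<le> (\<Prod>f\<in>R. if Inl f \<in> Z then 1 else boost * y1 Z f)"
        using y1_nonneg boost_pos by (intro prod_nonneg) auto
      then have "gain e S Z \<le> (\<Prod>f\<in>R. if Inl f \<in> Z then 1 else boost * y1 Z f)"
        unfolding gain_def R_def[symmetric] by simp
      \<comment> \<open>An upper bound suffices, so the case distinction on activation becomes a
        sum, which can be expanded over subsets of \<open>R\<close>.\<close>
      also have "\<dots> \<le> (\<Prod>f\<in>R. (if Inl f \<in> Z then 1 else 0) + boost * y1 Z f)"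
      proof (rule prod_mono)
        fix f assume "f \<in> R"
        have "0 \<le> boost * y1 Z f" using y1_nonneg boost_pos by (intro mult_nonneg_nonneg) auto
        then show "0 \<le> (if Inl f \<in> Z then 1 else boost * y1 Z f) \<and>
            (if Inl f \<in> Z then 1 else boost * y1 Z f) \<le> (if Inl f \<in> Z then 1 else 0) + boost * y1 Z f"
          by simp
      qed
      also have "\<dots> = (\<Sum>W\<in>Pow R. (\<Prod>f\<in>W. if Inl f \<in> Z then 1 else 0) * (\<Prod>f\<in>R - W. boost * y1 Z f))"
        by (rule prod_add[OF finR])
      also have "\<dots> = (\<Sum>W\<in>Pow R. a W * (if Inl ` W \<subseteq> Z \<and> Z \<inter> C W = {} then 1 else 0))"
        by (rule sum.cong[OF refl], rule term1[OF _ Z]) simp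
      finally show ?thesis .
    qed
    have bnd: "(1 - (real g)\<^sup>2 * \<tau>) *
        (a W * bexp p \<Omega> (\<lambda>Z. if Inl ` W \<subseteq> Z \<and> Z \<inter> C W = {} then 1 else 0))
        \<le> (\<Prod>f\<in>W. \<epsilon> * y f) * (\<Prod>f\<in>R - W. boost * (1 - \<epsilon>) * y f)"
      if W: "W \<subseteq> R" for W
    proof -
      have rhs: "0 \<le> (\<Prod>f\<in>W. \<epsilon> * y f) * (\<Prod>f\<in>R - W. boost * (1 - \<epsilon>) * y f)"
        using y_nonneg eps_pos eps_le boost_pos by (intro mult_nonneg_nonneg prod_nonneg) auto
      show ?thesis
      proof (cases "Inl ` W \<subseteq> \<Omega>")
        case False
        then have "bexp p \<Omega> (\<lambda>Z. if Inl ` W \<subseteq> Z \<and> Z \<inter> C W = {} then 1 else 0) = bexp p \<Omega> (\<lambda>_. 0)"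
          by (intro bexp_cong) auto
        then show ?thesis using rhs fin\<Omega> by simp
      next
        case True
        have RW: "finite (R - W)" "R - W \<subseteq> S - {e}" using finR unfolding R_def by auto
        have Csub: "C W \<subseteq> \<Omega>" unfolding C_def \<Omega>_def using hazard_subset live by blast
        have "bexp p \<Omega> (\<lambda>Z. if Inl ` W \<subseteq> Z \<and> Z \<inter> C W = {} then 1 else 0)
            \<le> (\<Prod>z\<in>Inl ` W. p z) * (\<Prod>z\<in>C W. 1 - p z)"
          by (rule bexp_supset_disjoint_le[OF fin\<Omega> True Csub pO])
        also have "(\<Prod>z\<in>Inl ` W. p z) = (\<Prod>f\<in>W. \<epsilon> * y f)"
          by (subst prod.reindex) (auto simp: p_Inl)
        finally have E: "bexp p \<Omega> (\<lambda>Z. if Inl ` W \<subseteq> Z \<and> Z \<inter> C W = {} then 1 else 0)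
            \<le> (\<Prod>f\<in>W. \<epsilon> * y f) * (\<Prod>z\<in>C W. 1 - p z)" .
        have "1 - (real g)\<^sup>2 * \<tau> = 1 + real g * (- (real g * \<tau>))" by (simp add: power2_eq_square)
        also have "\<dots> \<le> (1 + - (real g * \<tau>)) ^ g"
          using g_tau_le by (intro Bernoulli_inequality) auto
        also have "\<dots> \<le> (1 - real g * \<tau>) ^ card (R - W)"
          using g_tau_le tau_nonneg card_mono[OF finR, of "R - W"] cR
          by (simp only: add_uminus_conv_diff) (intro power_decreasing, auto)
        finally have "(\<Prod>z\<in>C W. 1 - p z) * (1 - (real g)\<^sup>2 * \<tau>)
            \<le> (\<Prod>z\<in>C W. 1 - p z) * (1 - real g * \<tau>) ^ card (R - W)"
          using Csub one_minus_p unfolding \<Omega>_def by (intro mult_left_mono prod_nonneg) blast+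
        also have "\<dots> \<le> (\<Prod>f\<in>R - W. survival f)"
          unfolding C_def by (rule prod_hazards_le[OF RW(1) e SH RW(2)]) (use live in blast)
        finally have "(\<Prod>z\<in>C W. 1 - p z) * (1 - (real g)\<^sup>2 * \<tau>) \<le> (\<Prod>f\<in>R - W. survival f)" .
        then have "a W * ((\<Prod>z\<in>C W. 1 - p z) * (1 - (real g)\<^sup>2 * \<tau>)) \<le> a W * (\<Prod>f\<in>R - W. survival f)"
          by (rule mult_left_mono[OF _ anonneg])
        also have "\<dots> = (\<Prod>f\<in>R - W. boost * (1 - \<epsilon>) * y f)"
          unfolding a_def prod.distrib[symmetric]
        proof (rule prod.cong[OF refl])
          fix f assume "f \<in> R - W"
          then have "survival f \<noteq> 0" using live survival_pos[of f] by auto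
          then show "boost * (y f * (1 - \<epsilon>) / survival f) * survival f = boost * (1 - \<epsilon>) * y f" by simp
        qed
        finally have aC: "a W * ((\<Prod>z\<in>C W. 1 - p z) * (1 - (real g)\<^sup>2 * \<tau>))
            \<le> (\<Prod>f\<in>R - W. boost * (1 - \<epsilon>) * y f)" .
        have "(1 - (real g)\<^sup>2 * \<tau>) * (a W * bexp p \<Omega> (\<lambda>Z. if Inl ` W \<subseteq> Z \<and> Z \<inter> C W = {} then 1 else 0))
            \<le> (1 - (real g)\<^sup>2 * \<tau>) * (a W * ((\<Prod>f\<in>W. \<epsilon> * y f) * (\<Prod>z\<in>C W. 1 - p z)))"
          by (intro mult_left_mono E anonneg x)
        also have "\<dots> = (\<Prod>f\<in>W. \<epsilon> * y f) * (a W * ((\<Prod>z\<in>C W. 1 - p z) * (1 - (real g)\<^sup>2 * \<tau>)))"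
          by (simp only: mult_ac)
        also have "\<dots> \<le> (\<Prod>f\<in>W. \<epsilon> * y f) * (\<Prod>f\<in>R - W. boost * (1 - \<epsilon>) * y f)"
          using aC y_nonneg eps_pos by (intro mult_left_mono prod_nonneg) auto
        finally show ?thesis .
      qed
    qed
    have "bexp p \<Omega> (gain e S) \<le> bexp p \<Omega> (\<lambda>Z. \<Sum>W\<in>Pow R. a W * (if Inl ` W \<subseteq> Z \<and> Z \<inter> C W = {} then 1 else 0))"
      by (rule bexp_mono[OF pO pt])
    also have "\<dots> = (\<Sum>W\<in>Pow R. a W * bexp p \<Omega> (\<lambda>Z. if Inl ` W \<subseteq> Z \<and> Z \<inter> C W = {} then 1 else 0))"
      unfolding bexp_sum bexp_cmult ..
    finally have "(1 - (real g)\<^sup>2 * \<tau>) * bexp p \<Omega> (gain e S) \<le> (1 - (real g)\<^sup>2 * \<tau>) *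
      (\<Sum>W\<in>Pow R. a W * bexp p \<Omega> (\<lambda>Z. if Inl ` W \<subseteq> Z \<and> Z \<inter> C W = {} then 1 else 0))"
      by (rule mult_left_mono[OF _ x])
    also have "\<dots> \<le> (\<Sum>W\<in>Pow R. (\<Prod>f\<in>W. \<epsilon> * y f) * (\<Prod>f\<in>R - W. boost * (1 - \<epsilon>) * y f))"
      unfolding sum_distrib_left by (rule sum_mono, rule bnd) simp
    also have "\<dots> = (\<Prod>f\<in>R. \<epsilon> * y f + boost * (1 - \<epsilon>) * y f)" by (rule prod_add[OF finR, symmetric])
    also have "\<dots> = (\<Prod>f\<in>R. y f * (\<epsilon> + boost * (1 - \<epsilon>)))"
      by (rule prod.cong[OF refl]) (simp only: distrib_left mult_ac)
    also have "\<dots> = (\<Prod>f\<in>S - {e}. factor s A y f)"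
      unfolding boost_balance prod_factor[OF SH(1)] R_def ..
    finally show ?thesis unfolding \<Omega>_def .
  qed
qed

text \<open>A trial outside the hazard of \<open>e\<close> is a dummy at a vertex off
  \<open>e\<close> or a live edge disjoint from \<open>e\<close>. In both cases the codegree and
  girth counts apply.\<close>

lemma card_gains_hit_le:
  assumes e: "0 < y e" and z: "z \<in> trials - hazard e"
  shows "real (card {S \<in> {S \<in> pending A e. \<forall>f\<in>S - {e} - A. 0 < y f}.
    z \<in> (\<Union>f\<in>S - {e} - A. hazard f)}) \<le> real r * cc + 2" (is "real (card ?L) \<le> _")
proof (cases z)
  case (Inr u)
  have u: "u \<in> verts G" "u \<notin> ends G e" using z Inr by (auto simp: trials_def Inr_in_hazard)
  have "?L \<subseteq> {S \<in> H. e \<in> S \<and> (\<exists>f\<in>S. u \<in> ends G f)}"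
    using Inr by (auto simp: pending_def Inr_in_hazard)
  then have "card ?L \<le> config_codegree G H u e"
    unfolding config_codegree_def using finite_H by (intro card_mono) auto
  then have "real (card ?L) \<le> cc" using config_codegree_le[OF u(1) y_edge[OF e] u(2)] by linarith
  also have "cc \<le> real r * cc" using r_ge_2 cc_nonneg mult_right_mono[of 1 "real r" cc] by simp
  finally show ?thesis by linarith
next
  case (Inl h)
  have h: "0 < y h" using z Inl by (auto simp: trials_def)
  have eh: "ends G e \<inter> ends G h = {}" using z Inl h by (auto simp: Inl_in_hazard_iff)
  have "?L \<subseteq> {S \<in> H. e \<in> S \<and> ((\<exists>f\<in>S. ends G f \<inter> ends G h \<noteq> {})
    \<or> (\<exists>f\<in>S. f \<noteq> e \<and> f \<noteq> h \<and> (\<exists>T\<in>H. f \<in> T \<and> h \<in> T)))}" (is "_ \<subseteq> ?R")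
  proof
    fix S assume "S \<in> ?L"
    then obtain f where f: "S \<in> H" "e \<in> S" "f \<in> S" "f \<noteq> e" "Inl h \<in> hazard f"
      using Inl by (auto simp: pending_def)
    from f(5) consider "ends G f \<inter> ends G h \<noteq> {}" | "h \<in> blockers f"
      unfolding Inl_in_hazard_iff by auto
    then show "S \<in> ?R"
    proof cases
      case 1
      then show ?thesis using f(1-3) by auto
    next
      case 2
      then show ?thesis using f(1-4) blockers_config[OF 2] by auto
    qed
  qed
  then have "card ?L \<le> card ?R" using finite_H by (intro card_mono) auto
  then show ?thesis using card_configs_near_le[OF y_edge[OF e] y_edge[OF h] eh] by linarith
qed

lemma gain_eq_0_if_not_live:
  assumes "S \<in> H" "Z \<subseteq> trials" "\<not> (\<forall>f\<in>S - {e} - A. 0 < y f)"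
  shows "gain e S Z = 0"
proof -
  obtain f where f: "f \<in> S - {e} - A" "\<not> 0 < y f" using assms(3) by blast
  then have "Inl f \<notin> Z" using assms(2) by (auto simp: trials_def)
  then have "\<exists>f\<in>S - {e} - A. (if Inl f \<in> Z then 1 else boost * y1 Z f) = 0"
    using f by (intro bexI[of _ f]) (auto simp: y1_def)
  then have "(\<Prod>f\<in>S - {e} - A. if Inl f \<in> Z then 1 else boost * y1 Z f) = 0"
    by (rule prod_zero[OF finite_open[OF assms(1)]])
  then show ?thesis unfolding gain_def by simp
qed

lemma gain_bounds:
  assumes "S \<in> H"
  shows "0 \<le> gain e S Z \<and> gain e S Z \<le> \<upsilon>"
proof (cases "Inl ` (S - {e} - A) \<subseteq> Z")
  case True
  then show ?thesis using boost_pos Y'_nonneg by (simp add: gain_def mult_nonneg_nonneg)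
next
  case False
  let ?t = "\<lambda>f. if Inl f \<in> Z then 1 else boost * y1 Z f"
  have ty: "0 \<le> boost * y1 Z f" "boost * y1 Z f \<le> \<upsilon>" for f
    using y1_nonneg[of Z f] y1_le[of Z f] boost_pos
    by (auto intro!: mult_nonneg_nonneg mult_left_mono simp: mult.commute[of Y'])
  have t01: "0 \<le> ?t f \<and> ?t f \<le> 1" for f using ty[of f] gain_small by auto
  from False obtain f where f: "f \<in> S - {e} - A" "Inl f \<notin> Z" by blast
  have "(\<Prod>f\<in>S - {e} - A. ?t f) = ?t f * (\<Prod>f\<in>S - {e} - A - {f}. ?t f)"
    by (rule prod.remove[OF finite_open[OF assms] f(1)])
  also have "\<dots> \<le> ?t f * 1" using t01 by (intro mult_left_mono prod_le_1) auto
  also have "\<dots> \<le> \<upsilon>" using f(2) ty(2)[of f] by simp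
  finally have "(\<Prod>f\<in>S - {e} - A. ?t f) \<le> \<upsilon>" .
  moreover have "0 \<le> (\<Prod>f\<in>S - {e} - A. ?t f)" using t01 by (intro prod_nonneg) auto
  ultimately show ?thesis using False unfolding gain_def by simp
qed

lemma gain_local:
  assumes z: "z \<notin> (\<Union>f\<in>S - {e} - A. hazard f)" and live: "\<forall>f\<in>S - {e} - A. 0 < y f"
  shows "gain e S (insert z Z) = gain e S (Z - {z})"
proof -
  have 1: "Inl f \<in> insert z Z \<longleftrightarrow> Inl f \<in> Z - {z}" if "f \<in> S - {e} - A" for f
    using z that Inl_in_hazard[of f] live by blast
  have 2: "y1 (insert z Z) f = y1 (Z - {z}) f" if "f \<in> S - {e} - A" for f
    using z that by (intro y1_local) blast
  have 3: "Inl ` (S - {e} - A) \<subseteq> insert z Z \<longleftrightarrow> Inl ` (S - {e} - A) \<subseteq> Z - {z}"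
    using 1 by (simp only: image_subset_iff) blast
  have 4: "(\<Prod>f\<in>S - {e} - A. if Inl f \<in> insert z Z then 1 else boost * y1 (insert z Z) f)
    = (\<Prod>f\<in>S - {e} - A. if Inl f \<in> Z - {z} then 1 else boost * y1 (Z - {z}) f)"
    by (rule prod.cong[OF refl]) (simp only: 1 2)
  show ?thesis unfolding gain_def 3 4 ..
qed

lemma gain_antimono:
  assumes z: "z \<notin> Inl ` (S - {e} - A)" and S: "S \<in> H"
  shows "gain e S (insert z Z) \<le> gain e S (Z - {z})"
proof -
  have 1: "Inl f \<in> insert z Z \<longleftrightarrow> Inl f \<in> Z - {z}" if "f \<in> S - {e} - A" for f
    using z that by blast
  have 3: "Inl ` (S - {e} - A) \<subseteq> insert z Z \<longleftrightarrow> Inl ` (S - {e} - A) \<subseteq> Z - {z}"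
    using 1 by (simp only: image_subset_iff) blast
  have 4: "(\<Prod>f\<in>S - {e} - A. if Inl f \<in> insert z Z then 1 else boost * y1 (insert z Z) f)
    \<le> (\<Prod>f\<in>S - {e} - A. if Inl f \<in> Z - {z} then 1 else boost * y1 (Z - {z}) f)"
  proof (rule prod_mono)
    fix f assume f: "f \<in> S - {e} - A"
    have "0 \<le> boost * y1 (insert z Z) f" using boost_pos y1_nonneg by (intro mult_nonneg_nonneg) auto
    moreover have "boost * y1 (insert z Z) f \<le> boost * y1 (Z - {z}) f"
      using boost_pos by (intro mult_left_mono y1_antimono) auto
    ultimately show "0 \<le> (if Inl f \<in> insert z Z then 1 else boost * y1 (insert z Z) f) \<and>
      (if Inl f \<in> insert z Z then 1 else boost * y1 (insert z Z) f)
      \<le> (if Inl f \<in> Z - {z} then 1 else boost * y1 (Z - {z}) f)"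
      unfolding 1[OF f] by simp
  qed
  show ?thesis unfolding gain_def 3 using 4 by simp
qed

abbreviation "danger_variance \<equiv> 6 * ((real g)\<^sup>2 * \<tau>) * K\<^sup>2 + 4 * real g * (real r * cc + 2) * \<upsilon> * K"

text \<open>Dead edges pay no penalty, so only outcomes missing the hazard of \<open>e\<close>
  matter. Conditioned on these, the mean danger rises by at most a drift due to overlapping hazards,
  the first term of \<open>danger_variance\<close>; the second term is the genuine variance.\<close>

lemma expected_danger_excess:
  assumes e: "0 < y e" and c: "0 \<le> c"
  shows "bexp p trials (\<lambda>Z. if Z \<inter> hazard e = {} then (max 0 (danger s1 (A1 Z) (y1 Z) e - c))\<^sup>2 else 0)
    \<le> (max 0 (danger s A y e - c))\<^sup>2 + danger_variance"
proof -
  define I where "I = {S \<in> pending A e. \<forall>f\<in>S - {e} - A. 0 < y f}"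
  define \<Omega> where "\<Omega> = trials - hazard e"
  define N :: "'e set \<Rightarrow> ('e + 'v) set" where "N S = (\<Union>f\<in>S - {e} - A. hazard f)" for S
  define W :: "'e set \<Rightarrow> ('e + 'v) set" where "W S = Inl ` (S - {e} - A)" for S
  define x where "x = (real g)\<^sup>2 * \<tau>"
  define \<Phi> where "\<Phi> = danger s A y e"
  define F where "F Z = (\<Sum>S\<in>I. gain e S Z)" for Z
  define m where "m = bexp p \<Omega> F"
  let ?f = "\<lambda>Z. (max 0 (danger s1 (A1 Z) (y1 Z) e - c))\<^sup>2"
  have finI: "finite I" unfolding I_def using finite_pending by simp
  have fin\<Omega>: "finite \<Omega>" unfolding \<Omega>_def using finite_trials by simp
  have sub\<Omega>: "\<Omega> \<subseteq> trials" unfolding \<Omega>_def by blast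
  have pO: "0 \<le> p z \<and> p z \<le> 1" if "z \<in> \<Omega>" for z using p_prob sub\<Omega> that by blast
  have SH: "S \<in> H" if "S \<in> I" for S using that by (auto simp: I_def pending_def)
  have dF: "danger s1 (A1 Z) (y1 Z) e = F Z" if "Z \<subseteq> \<Omega>" for Z
    unfolding danger_eq_sum_gain F_def
  proof (rule sum.mono_neutral_right[OF finite_pending])
    show "\<forall>S\<in>pending A e - I. gain e S Z = 0"
    proof
      fix S assume "S \<in> pending A e - I"
      then have "S \<in> H" "\<not> (\<forall>f\<in>S - {e} - A. 0 < y f)" by (auto simp: I_def pending_def)
      then show "gain e S Z = 0" using that sub\<Omega> by (intro gain_eq_0_if_not_live) auto
    qed
  qed (auto simp: I_def)
  have x: "0 \<le> x" "x \<le> 1 / 2" unfolding x_def using overlap_small tau_nonneg by auto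
  have \<Phi>: "0 \<le> \<Phi>" "\<Phi> \<le> K" unfolding \<Phi>_def using danger_nonneg[OF y_nonneg s_pos] y_danger[OF e] by auto
  have ups: "0 \<le> \<upsilon>" using boost_pos Y'_nonneg by (simp add: mult_nonneg_nonneg)
  have k0: "0 \<le> (real r * cc + 2) * \<upsilon>" using cc_nonneg by (intro mult_nonneg_nonneg[OF _ ups]) simp
  have msum: "m = (\<Sum>S\<in>I. bexp p \<Omega> (gain e S))" unfolding m_def F_def bexp_sum ..
  have gnn: "0 \<le> bexp p \<Omega> (gain e S)" if "S \<in> I" for S
    by (rule bexp_nonneg[OF pO]) (use gain_bounds[OF SH[OF that]] in auto)
  have m0: "0 \<le> m" unfolding msum by (rule sum_nonneg[OF gnn])
  have "(1 - x) * m \<le> (\<Sum>S\<in>I. \<Prod>f\<in>S - {e}. factor s A y f)"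
    unfolding msum sum_distrib_left x_def \<Omega>_def
    by (rule sum_mono, rule expected_gain_le[OF e]) (auto simp: I_def)
  also have "\<dots> \<le> \<Phi>"
    unfolding \<Phi>_def danger_def
    using finite_pending factor_nonneg[OF y_nonneg s_pos]
    by (intro sum_mono2) (auto simp: I_def intro!: prod_nonneg)
  finally have xm: "m - x * m \<le> \<Phi>" by (simp add: algebra_simps)
  \<comment> \<open>The crude bound \<open>m \<le> 2 * \<Phi>\<close> is fed back into the term
    \<open>x * m\<close>, so that the drift of the mean is only of order
    \<open>x * K\<close>.\<close>
  moreover have "x * m \<le> 1 / 2 * m" using x m0 by (intro mult_right_mono) auto
  ultimately have m2: "m \<le> 2 * \<Phi>" by linarith
  then have "m \<le> 2 * K" using \<Phi> by linarith
  then have "x * m \<le> x * (2 * K)" using x by (intro mult_left_mono) auto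
  then have m\<Phi>: "m \<le> \<Phi> + 2 * x * K" using xm by linarith
  have "bexp p \<Omega> (\<lambda>Z. (F Z)\<^sup>2) - (bexp p \<Omega> F)\<^sup>2 \<le> (real r * cc + 2) * \<upsilon> *
      (\<Sum>S\<in>I. (real (card (W S)) + 2 * (\<Sum>z\<in>\<Omega> \<inter> N S. p z)) * bexp p \<Omega> (gain e S))"
    unfolding F_def
  proof (rule bexp_variance_sum_le[where F = "gain e" and N = N and W = W, OF fin\<Omega> finI])
    show "0 \<le> p z \<and> p z \<le> 1 / 2" if "z \<in> \<Omega>" for z using p_half sub\<Omega> that by blast
    show "0 \<le> gain e S Z \<and> gain e S Z \<le> \<upsilon>" if "S \<in> I" for S Z using gain_bounds[OF SH[OF that]] .
    show "gain e S (insert z Z) = gain e S (Z - {z})" if "S \<in> I" "z \<in> \<Omega> - N S" for S z Z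
      using that by (intro gain_local) (auto simp: N_def I_def)
    show "gain e S (insert z Z) \<le> gain e S (Z - {z})" if "S \<in> I" "z \<in> \<Omega> - W S" for S z Z
      using that by (intro gain_antimono SH) (auto simp: W_def)
    show "finite (W S)" if "S \<in> I" for S unfolding W_def using finite_open[OF SH[OF that]] by simp
    show "real (card {S \<in> I. z \<in> N S}) \<le> real r * cc + 2" if "z \<in> \<Omega>" for z
      using card_gains_hit_le[OF e, of z] that unfolding I_def N_def \<Omega>_def .
    show "0 \<le> real r * cc + 2" using cc_nonneg by simp
  qed (rule ups)
  \<comment> \<open>Of the \<open>2 * g\<close>, one \<open>g\<close> counts the members of
    \<open>S\<close>, whose activation may raise the gain; the other bounds twice the hazard mass of
    at most \<open>g\<close> members, each at most \<open>1 / 2\<close>.\<close>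
  also have "\<dots> \<le> (real r * cc + 2) * \<upsilon> * (\<Sum>S\<in>I. 2 * real g * bexp p \<Omega> (gain e S))"
  proof (rule mult_left_mono[OF sum_mono])
    fix S assume S: "S \<in> I"
    have live: "0 < y f" if "f \<in> S - {e} - A" for f using S that by (auto simp: I_def)
    have cW: "card (W S) \<le> g"
      unfolding W_def using card_image_le[OF finite_open[OF SH[OF S], of e], where f = "Inl :: 'e \<Rightarrow> 'e + 'v"] card_open_le[OF SH[OF S], of e]
      by linarith
    have Nsub: "N S \<subseteq> trials" unfolding N_def using hazard_subset live by blast
    have "(\<Sum>z\<in>\<Omega> \<inter> N S. p z) \<le> sum p (N S)"
      by (rule sum_mono2[OF finite_subset[OF Nsub finite_trials]]) (use Nsub p_bounds in blast)+
    also have "\<dots> \<le> (\<Sum>f\<in>S - {e} - A. sum p (hazard f))"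
      unfolding N_def
    proof (rule sum_UN_le_real[OF finite_open[OF SH[OF S]] finite_hazard[OF live]])
      fix z assume "z \<in> (\<Union>f\<in>S - {e} - A. hazard f)"
      then show "0 \<le> p z" using Nsub p_bounds unfolding N_def by blast
    qed
    also have "\<dots> \<le> real (card (S - {e} - A)) * \<eta>" by (rule sum_bounded_above[OF sum_hazard_le[OF live]])
    also have "\<dots> \<le> real g * (1 / 2)"
      using card_open_le[OF SH[OF S], of e] eps_small eps_pos K_nonneg by (intro mult_mono) auto
    finally have "real (card (W S)) + 2 * (\<Sum>z\<in>\<Omega> \<inter> N S. p z) \<le> 2 * real g" using cW by simp
    then show "(real (card (W S)) + 2 * (\<Sum>z\<in>\<Omega> \<inter> N S. p z)) * bexp p \<Omega> (gain e S)
      \<le> 2 * real g * bexp p \<Omega> (gain e S)" by (rule mult_right_mono[OF _ gnn[OF S]])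
  qed (rule k0)
  also have "\<dots> = (real r * cc + 2) * \<upsilon> * (2 * real g) * m"
    unfolding msum by (simp add: sum_distrib_left mult_ac)
  also have "\<dots> \<le> (real r * cc + 2) * \<upsilon> * (2 * real g) * (2 * K)"
    by (rule mult_left_mono[OF \<open>m \<le> 2 * K\<close>], rule mult_nonneg_nonneg[OF k0]) simp
  also have "\<dots> = 4 * real g * (real r * cc + 2) * \<upsilon> * K"
  proof -
    have "a * b * (2 * c) * (2 * d) = 4 * c * a * b * d" for a b c d :: real by simp
    then show ?thesis .
  qed
  finally have Var: "bexp p \<Omega> (\<lambda>Z. (F Z)\<^sup>2) - (bexp p \<Omega> F)\<^sup>2 \<le> 4 * real g * (real r * cc + 2) * \<upsilon> * K" .
  \<comment> \<open>The old excess \<open>a\<close> and the drift \<open>d = 2 * x * K\<close> are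
    both at most \<open>K\<close>, so \<open>2 * a + d \<le> 3 * K\<close>; this is the origin of
    the constant 6.\<close>
  have mm: "(max 0 (m - c))\<^sup>2 \<le> (max 0 (\<Phi> - c))\<^sup>2 + 6 * x * K\<^sup>2"
  proof -
    define a where "a = max 0 (\<Phi> - c)"
    define d where "d = 2 * x * K"
    have d: "0 \<le> d" "d \<le> K" unfolding d_def
      using x K_nonneg mult_right_mono[of "2 * x" 1 K] by auto
    have a: "0 \<le> a" "a \<le> K" unfolding a_def using \<Phi> c by auto
    have "max 0 (m - c) \<le> a + d" unfolding a_def d_def using m\<Phi> d(1) by (simp add: d_def)
    then have "(max 0 (m - c))\<^sup>2 \<le> (a + d)\<^sup>2" by (rule power_mono) simp
    also have "\<dots> = a\<^sup>2 + (2 * a + d) * d" by (simp add: power2_eq_square algebra_simps)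
    also have "(2 * a + d) * d \<le> (3 * K) * d" using a d by (intro mult_right_mono) auto
    also have "3 * K * d = 6 * x * K\<^sup>2" unfolding d_def by (simp add: power2_eq_square)
    finally show ?thesis unfolding a_def by simp
  qed
  have "bexp p trials (\<lambda>Z. if Z \<inter> hazard e = {} then ?f Z else 0) = survival e * bexp p \<Omega> ?f"
    unfolding \<Omega>_def survival_def by (rule bexp_disjoint[OF finite_trials hazard_subset[OF e]])
  also have "\<dots> \<le> bexp p \<Omega> ?f"
  proof (rule mult_left_le_one_le)
    show "0 \<le> bexp p \<Omega> ?f" by (rule bexp_nonneg[OF pO]) simp_all
  qed (use survival_pos[OF e] survival_le_1[OF e] in auto)
  also have "\<dots> = bexp p \<Omega> (\<lambda>Z. (max 0 (F Z - c))\<^sup>2)" by (rule bexp_cong) (simp add: dF)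
  also have "\<dots> \<le> (max 0 (m - c))\<^sup>2 + 4 * real g * (real r * cc + 2) * \<upsilon> * K"
    using bexp_pos_part_square_le[where p = p and f = F and c = c, OF fin\<Omega> pO] Var
    unfolding m_def[symmetric] by linarith
  finally show ?thesis using mm unfolding \<Phi>_def x_def by linarith
qed

section \<open>Completed configurations and picked edges\<close>

lemma prod_open_le:
  assumes S: "S \<in> pending A e" and k: "k \<le> card (S - {e} - A)"
  shows "(\<Prod>f\<in>S - {e} - A. \<epsilon> * y f) \<le> \<epsilon> ^ k * (\<Prod>f\<in>S - {e}. factor s A y f)"
proof -
  let ?R = "S - {e} - A"
  have SH: "S \<in> H" using S by (simp add: pending_def)
  have gs: "0 \<le> 1 / (real g * s)" using s_pos by simp
  have "(\<Prod>f\<in>?R. \<epsilon> * y f) = \<epsilon> ^ card ?R * (\<Prod>f\<in>?R. y f)"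
    by (simp add: prod.distrib)
  also have "\<dots> \<le> \<epsilon> ^ k * (\<Prod>f\<in>?R. y f * (1 + 1 / (real g * s)))"
  proof (rule mult_mono)
    show "\<epsilon> ^ card ?R \<le> \<epsilon> ^ k" using k eps_pos eps_le by (intro power_decreasing) auto
    show "(\<Prod>f\<in>?R. y f) \<le> (\<Prod>f\<in>?R. y f * (1 + 1 / (real g * s)))"
    proof (rule prod_mono)
      fix f show "0 \<le> y f \<and> y f \<le> y f * (1 + 1 / (real g * s))"
        using y_nonneg[of f] gs mult_left_mono[of 1 "1 + 1 / (real g * s)" "y f"] by simp
    qed
  qed (use eps_pos y_nonneg in \<open>auto intro!: prod_nonneg\<close>)
  finally show ?thesis unfolding prod_factor[OF SH] .
qed

lemma card_open_pos: "S \<in> pending A e \<Longrightarrow> 1 \<le> card (S - {e} - A)"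
  using finite_open[of S e] by (auto simp: pending_def Suc_le_eq card_gt_0_iff)

text \<open>A configuration lacking a single live edge makes that edge a blocker, which survival
  excludes. Completion therefore takes two simultaneous activations, hence
  \<open>\<epsilon>^2\<close>, and the danger sums up the rest.\<close>

lemma completion_probability_le:
  assumes e: "0 < y e"
  shows "bexp p trials (\<lambda>Z. if Z \<inter> hazard e = {} \<and> (\<exists>S\<in>H. e \<in> S \<and> S - {e} \<subseteq> A1 Z) then 1 else 0)
    \<le> survival e * (\<epsilon>\<^sup>2 * K)"
proof -
  let ?i = "\<lambda>S Z. if Inl ` (S - {e} - A) \<subseteq> Z \<and> Z \<inter> hazard e = {} then 1 else 0 :: real"
  have "bexp p trials (\<lambda>Z. if Z \<inter> hazard e = {} \<and> (\<exists>S\<in>H. e \<in> S \<and> S - {e} \<subseteq> A1 Z) then 1 else 0)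
      \<le> bexp p trials (\<lambda>Z. \<Sum>S\<in>pending A e. ?i S Z)"
  proof (rule bexp_mono[OF p_prob])
    fix Z
    show "(if Z \<inter> hazard e = {} \<and> (\<exists>S\<in>H. e \<in> S \<and> S - {e} \<subseteq> A1 Z) then 1 else 0) \<le> (\<Sum>S\<in>pending A e. ?i S Z)"
    proof (cases "Z \<inter> hazard e = {} \<and> (\<exists>S\<in>H. e \<in> S \<and> S - {e} \<subseteq> A1 Z)")
      case True
      then obtain S where S: "S \<in> H" "e \<in> S" "S - {e} \<subseteq> A1 Z" by blast
      then have "S \<in> pending A e" using y_open[OF e] by (simp add: pending_def)
      then have "?i S Z \<le> (\<Sum>S\<in>pending A e. ?i S Z)" using finite_pending by (intro member_le_sum) auto
      moreover have "?i S Z = 1" using S(3) conjunct1[OF True] unfolding completes_iff by simp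
      ultimately show ?thesis unfolding if_P[OF True] by linarith
    next
      case False
      show ?thesis unfolding if_not_P[OF False] by (rule sum_nonneg) simp
    qed
  qed
  also have "\<dots> = (\<Sum>S\<in>pending A e. bexp p trials (?i S))" unfolding bexp_sum ..
  also have "\<dots> \<le> (\<Sum>S\<in>pending A e. survival e * \<epsilon>\<^sup>2 * (\<Prod>f\<in>S - {e}. factor s A y f))"
  proof (rule sum_mono)
    fix S assume S: "S \<in> pending A e"
    let ?R = "S - {e} - A"
    have SH: "S \<in> H" "e \<in> S" using S by (auto simp: pending_def)
    have rhs: "0 \<le> survival e * \<epsilon>\<^sup>2 * (\<Prod>f\<in>S - {e}. factor s A y f)"
      using survival_pos[OF e] factor_nonneg[OF y_nonneg s_pos] by (intro mult_nonneg_nonneg prod_nonneg) auto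
    show "bexp p trials (?i S) \<le> survival e * \<epsilon>\<^sup>2 * (\<Prod>f\<in>S - {e}. factor s A y f)"
    proof (cases "Inl ` ?R \<subseteq> trials \<and> Inl ` ?R \<inter> hazard e = {}")
      case False
      then have "bexp p trials (?i S) = bexp p trials (\<lambda>_. 0)" by (intro bexp_cong) auto
      then show ?thesis using rhs finite_trials by simp
    next
      case True
      have "card ?R \<noteq> 1"
      proof
        assume "card ?R = 1"
        then obtain f where f: "?R = {f}" by (rule card_1_singletonE)
        then have "0 < y f" using True by (auto simp: trials_def)
        moreover have "S - {e, f} \<subseteq> A" "f \<in> S" "f \<noteq> e" using f by auto
        ultimately have "f \<in> blockers e" using SH by (auto simp: blockers_def)
        then show False using True f by (auto simp: hazard_def)
      qed
      then have "2 \<le> card ?R" using card_open_pos[OF S] by linarith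
      have "bexp p trials (?i S) \<le> (\<Prod>z\<in>Inl ` ?R. p z) * survival e"
        unfolding survival_def
        using True by (intro bexp_supset_disjoint_le[OF finite_trials _ hazard_subset[OF e] p_prob]) auto
      also have "(\<Prod>z\<in>Inl ` ?R. p z) = (\<Prod>f\<in>?R. \<epsilon> * y f)"
        by (subst prod.reindex) (auto simp: p_Inl)
      also have "\<dots> * survival e \<le> \<epsilon>\<^sup>2 * (\<Prod>f\<in>S - {e}. factor s A y f) * survival e"
        using prod_open_le[OF S \<open>2 \<le> card ?R\<close>] survival_pos[OF e] by (intro mult_right_mono) auto
      finally show ?thesis by (simp add: mult_ac)
    qed
  qed
  also have "\<dots> = survival e * \<epsilon>\<^sup>2 * danger s A y e" by (simp add: danger_def sum_distrib_left)
  also have "\<dots> \<le> survival e * \<epsilon>\<^sup>2 * K"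
    using y_danger[OF e] survival_pos[OF e] by (intro mult_left_mono) auto
  finally show ?thesis by (simp add: mult_ac)
qed

text \<open>All parties to a conflict are rejected instead of all but one. This is affordable
  because an activated edge meets a conflict only with probability of order \<epsilon>, up to the
  factor \<open>r + K\<close>.\<close>

definition picked :: "('e + 'v) set \<Rightarrow> 'e set" where
  "picked Z = {f. Inl f \<in> Z \<and> (\<forall>h. Inl h \<in> Z \<longrightarrow> h \<noteq> f \<longrightarrow> ends G f \<inter> ends G h = {})
    \<and> \<not> (\<exists>S\<in>H. f \<in> S \<and> S \<subseteq> A1 Z)}"

text \<open>Bonferroni: the probability of activation minus the expected number of conflicts. Loads
  of at most 1 at the \<open>r\<close> vertices give the term \<open>r\<close> for intersecting
  edges, the danger gives the term \<open>K\<close> for configurations.\<close>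

lemma picked_probability_ge:
  assumes f: "0 < y f"
  shows "\<epsilon> * y f * (1 - \<epsilon> * (real r + K)) \<le> bexp p trials (\<lambda>Z. if f \<in> picked Z then 1 else 0)"
proof -
  define M where "M = {h. 0 < y h \<and> h \<noteq> f \<and> ends G f \<inter> ends G h \<noteq> {}}"
  let ?I = "\<lambda>W Z. if Inl ` W \<subseteq> Z then 1 else 0 :: real"
  let ?S = "\<lambda>S. insert f (S - {f} - A)"
  have fE: "f \<in> edges G" using y_edge[OF f] .
  have finM: "finite M" unfolding M_def using finite_live by (rule rev_finite_subset) blast
  have EI: "bexp p trials (?I W) = (\<Prod>h\<in>W. \<epsilon> * y h)" if "\<And>h. h \<in> W \<Longrightarrow> 0 < y h" for W
  proof -
    have "Inl ` W \<subseteq> trials" using that by (auto simp: trials_def)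
    then have "bexp p trials (?I W) = (\<Prod>z\<in>Inl ` W. p z)" by (rule bexp_supset[OF finite_trials])
    also have "\<dots> = (\<Prod>h\<in>W. \<epsilon> * y h)" by (subst prod.reindex) (auto simp: p_Inl)
    finally show ?thesis .
  qed
  have "bexp p trials (\<lambda>Z. ?I {f} Z - ((\<Sum>h\<in>M. ?I {f, h} Z) + (\<Sum>S\<in>pending A f. ?I (?S S) Z)))
      \<le> bexp p trials (\<lambda>Z. if f \<in> picked Z then 1 else 0)"
  proof (rule bexp_mono[OF p_prob])
    fix Z assume Z: "Z \<subseteq> trials"
    have nn: "0 \<le> (\<Sum>h\<in>M. ?I {f, h} Z)" "0 \<le> (\<Sum>S\<in>pending A f. ?I (?S S) Z)"
      by (auto intro!: sum_nonneg)
    show "?I {f} Z - ((\<Sum>h\<in>M. ?I {f, h} Z) + (\<Sum>S\<in>pending A f. ?I (?S S) Z))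
      \<le> (if f \<in> picked Z then 1 else 0)"
    proof (cases "Inl f \<in> Z \<and> f \<notin> picked Z")
      case True
      then consider h where "Inl h \<in> Z" "h \<noteq> f" "ends G f \<inter> ends G h \<noteq> {}"
        | S where "S \<in> H" "f \<in> S" "S \<subseteq> A1 Z" unfolding picked_def by blast
      then have "1 \<le> (\<Sum>h\<in>M. ?I {f, h} Z) + (\<Sum>S\<in>pending A f. ?I (?S S) Z)"
      proof cases
        case 1
        then have "0 < y h" using Z by (auto simp: trials_def)
        then have "h \<in> M" using 1 by (simp add: M_def)
        then have "?I {f, h} Z \<le> (\<Sum>h\<in>M. ?I {f, h} Z)" using finM by (intro member_le_sum) auto
        moreover have "?I {f, h} Z = 1" using True 1 by simp
        ultimately show ?thesis using nn by linarith
      next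
        case 2
        then have S: "S \<in> pending A f" using y_open[OF f] by (simp add: pending_def)
        have "S - {f} \<subseteq> A1 Z" using 2 by blast
        then have "?I (?S S) Z = 1" using True unfolding completes_iff by simp
        moreover have "?I (?S S) Z \<le> (\<Sum>S\<in>pending A f. ?I (?S S) Z)"
          using S finite_pending by (intro member_le_sum) auto
        ultimately show ?thesis using nn by linarith
      qed
      then show ?thesis using True by simp
    next
      case False
      then have "?I {f} Z \<le> (if f \<in> picked Z then 1 else 0)" by auto
      then show ?thesis using nn by linarith
    qed
  qed
  moreover have "bexp p trials (?I {f}) = \<epsilon> * y f" using EI[of "{f}"] f by simp
  moreover have "(\<Sum>h\<in>M. bexp p trials (?I {f, h})) \<le> \<epsilon> * y f * (\<epsilon> * real r)"
  proof -
    have "(\<Sum>h\<in>M. bexp p trials (?I {f, h})) = (\<Sum>h\<in>M. (\<epsilon> * y f) * (\<epsilon> * y h))"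
    proof (rule sum.cong[OF refl])
      fix h assume "h \<in> M"
      then have h: "0 < y h" "h \<noteq> f" by (auto simp: M_def)
      have "bexp p trials (?I {f, h}) = (\<Prod>h\<in>{f, h}. \<epsilon> * y h)" by (rule EI) (use f h in auto)
      then show "bexp p trials (?I {f, h}) = (\<epsilon> * y f) * (\<epsilon> * y h)" using h(2) by simp
    qed
    also have "\<dots> = \<epsilon> * y f * (\<epsilon> * (\<Sum>h\<in>M. y h))" by (simp add: sum_distrib_left)
    also have "\<dots> \<le> \<epsilon> * y f * (\<epsilon> * real r)"
    proof (intro mult_left_mono)
      have "(\<Sum>h\<in>M. y h) \<le> sum y (\<Union>v\<in>ends G f. {h. 0 < y h \<and> v \<in> ends G h})"
        using finite_ends[OF fE] finite_live_at y_nonneg by (intro sum_mono2) (auto simp: M_def)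
      also have "\<dots> \<le> (\<Sum>v\<in>ends G f. sum y {h. 0 < y h \<and> v \<in> ends G h})"
        using y_nonneg by (intro sum_UN_le_real finite_ends[OF fE] finite_live_at)
      also have "\<dots> = (\<Sum>v\<in>ends G f. load y v)" unfolding load_eq ..
      also have "\<dots> \<le> real (card (ends G f)) * 1"
        by (rule sum_bounded_above) (use load_le_1 ends_subset[OF fE] in blast)
      finally show "(\<Sum>h\<in>M. y h) \<le> real r" by (simp add: card_ends[OF fE])
    qed (use eps_pos f in auto)
    finally show ?thesis .
  qed
  moreover have "(\<Sum>S\<in>pending A f. bexp p trials (?I (?S S))) \<le> \<epsilon> * y f * (\<epsilon> * K)"
  proof -
    have "bexp p trials (?I (?S S)) \<le> \<epsilon> * y f * (\<epsilon> ^ 1 * (\<Prod>h\<in>S - {f}. factor s A y h))"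
      if S: "S \<in> pending A f" for S
    proof (cases "\<forall>h\<in>?S S. 0 < y h")
      case True
      have SH: "S \<in> H" using S by (simp add: pending_def)
      have "bexp p trials (?I (?S S)) = (\<Prod>h\<in>?S S. \<epsilon> * y h)" by (rule EI) (use True in blast)
      also have "\<dots> = \<epsilon> * y f * (\<Prod>h\<in>S - {f} - A. \<epsilon> * y h)"
        using finite_open[OF SH] by (intro prod.insert) auto
      also have "\<dots> \<le> \<epsilon> * y f * (\<epsilon> ^ 1 * (\<Prod>h\<in>S - {f}. factor s A y h))"
        using prod_open_le[OF S card_open_pos[OF S]] eps_pos f by (intro mult_left_mono) auto
      finally show ?thesis .
    next
      case False
      then obtain h where "h \<in> ?S S" "Inl h \<notin> trials" by (auto simp: trials_def)
      then have "bexp p trials (?I (?S S)) = bexp p trials (\<lambda>_. 0)" by (intro bexp_cong) auto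
      also have "\<dots> = 0" using finite_trials by simp
      also have "0 \<le> \<epsilon> * y f * (\<epsilon> ^ 1 * (\<Prod>h\<in>S - {f}. factor s A y h))"
        using eps_pos f factor_nonneg[OF y_nonneg s_pos] by (intro mult_nonneg_nonneg prod_nonneg) auto
      finally show ?thesis .
    qed
    then have "(\<Sum>S\<in>pending A f. bexp p trials (?I (?S S)))
        \<le> (\<Sum>S\<in>pending A f. \<epsilon> * y f * (\<epsilon> ^ 1 * (\<Prod>h\<in>S - {f}. factor s A y h)))"
      by (rule sum_mono)
    also have "\<dots> = \<epsilon> * y f * (\<epsilon> * danger s A y f)" by (simp add: danger_def sum_distrib_left)
    also have "\<dots> \<le> \<epsilon> * y f * (\<epsilon> * K)"
      using y_danger[OF f] eps_pos f by (intro mult_left_mono) auto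
    finally show ?thesis .
  qed
  ultimately have "\<epsilon> * y f - (\<epsilon> * y f * (\<epsilon> * real r) + \<epsilon> * y f * (\<epsilon> * K))
      \<le> bexp p trials (\<lambda>Z. if f \<in> picked Z then 1 else 0)"
    unfolding bexp_diff bexp_add bexp_sum by linarith
  then show ?thesis by (simp add: algebra_simps)
qed

end

section \<open>The potential and its change in one round\<close>

context bounded_configuration
begin

definition load_excess :: "real \<Rightarrow> ('e \<Rightarrow> real) \<Rightarrow> real" where
  "load_excess c y = (\<Sum>v\<in>verts G. (max 0 (load y v - c))\<^sup>2)"

definition danger_excess :: "real \<Rightarrow> real \<Rightarrow> 'e set \<Rightarrow> ('e \<Rightarrow> real) \<Rightarrow> real" where
  "danger_excess c s A y = (\<Sum>e | 0 < y e. (max 0 (danger s A y e - c))\<^sup>2)"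

text \<open>\<open>A\<close> contains every edge activated so far and \<open>M\<close> those that were also picked; blocking is measured
  against \<open>A\<close>, which is stronger than needed for \<open>M\<close> but keeps the trials independent.\<close>

definition nibble_state :: "real \<Rightarrow> real \<Rightarrow> real \<Rightarrow> 'e set \<Rightarrow> 'e set \<Rightarrow> ('e \<Rightarrow> real) \<Rightarrow> bool" where
  "nibble_state K s Y A M y \<longleftrightarrow>
     A \<subseteq> edges G \<and> M \<subseteq> A \<and> matching G M \<and> avoiding H M \<and> (\<forall>e. 0 \<le> y e \<and> y e \<le> Y) \<and>
     (\<forall>e. 0 < y e \<longrightarrow> e \<in> edges G \<and> (\<forall>f\<in>A. ends G e \<inter> ends G f = {}) \<and>
       danger s A y e \<le> K \<and> (\<forall>S\<in>H. e \<in> S \<longrightarrow> \<not> S - {e} \<subseteq> A)) \<and>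
     (\<forall>v\<in>verts G. load y v \<le> 1)"

end

context sparse_nibble_step
begin

definition completed :: "('e + 'v) set \<Rightarrow> 'e \<Rightarrow> bool" where
  "completed Z e \<longleftrightarrow> (\<exists>S\<in>H. e \<in> S \<and> S - {e} \<subseteq> A1 Z)"

text \<open>These are the requirements of \<open>nibble_state\<close> that an outcome may violate.
  Setting weights to 0 only lowers the loads and dangers of the other edges, so a single pass of
  discarding suffices.\<close>

definition discarded :: "('e + 'v) set \<Rightarrow> 'e \<Rightarrow> bool" where
  "discarded Z e \<longleftrightarrow> (\<exists>v\<in>ends G e. 1 < load (y1 Z) v) \<or> K < danger s1 (A1 Z) (y1 Z) e \<or> completed Z e"

definition y2 :: "('e + 'v) set \<Rightarrow> 'e \<Rightarrow> real" where
  "y2 Z e = (if discarded Z e then 0 else y1 Z e)"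

lemma y2_nonneg: "0 \<le> y2 Z e" and y2_le_y1: "y2 Z e \<le> y1 Z e"
  using y1_nonneg[of Z e] by (auto simp: y2_def)

lemma y2_pos: "0 < y2 Z e \<Longrightarrow> 0 < y1 Z e \<and> \<not> discarded Z e"
  by (auto simp: y2_def split: if_splits)

lemma load_y2_le: "load (y2 Z) v \<le> load (y1 Z) v"
  by (rule load_mono) (rule y2_le_y1)

lemma danger_y2_le: "danger s1 A' (y2 Z) e \<le> danger s1 A' (y1 Z) e"
  by (rule danger_mono[OF _ _ s1_pos]) (rule y2_nonneg y2_le_y1)+

lemma load_y2_overloaded: "1 < load (y1 Z) v \<Longrightarrow> load (y2 Z) v = 0"
  unfolding load_def[of "y2 Z"] by (rule sum.neutral) (auto simp: y2_def discarded_def)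

lemma nibble_state_next:
  assumes M: "M \<subseteq> A" "matching G M" "avoiding H M" and Z: "Z \<subseteq> trials"
  shows "nibble_state K s1 Y' (A1 Z) (M \<union> picked Z) (y2 Z)"
proof -
  have liveZ: "0 < y f" if "Inl f \<in> Z" for f using Z that by (auto simp: trials_def)
  have A1E: "A1 Z \<subseteq> edges G" using A_edges y_edge[OF liveZ] by (auto simp: A1_def)
  have pickA: "picked Z \<subseteq> A1 Z" by (auto simp: picked_def A1_def)
  have MA: "M \<union> picked Z \<subseteq> A1 Z" using M(1) pickA by (auto simp: A1_def)
  have dis: "ends G e \<inter> ends G f = {}" if ef: "e \<in> M \<union> picked Z" "f \<in> M \<union> picked Z" "e \<noteq> f" for e f
  proof -
    have mp: "ends G e \<inter> ends G f = {}" if "e \<in> M" "f \<in> picked Z" for e f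
      using y_disjoint[OF liveZ, of f e] that M(1) by (auto simp: picked_def)
    show ?thesis
    proof (cases "e \<in> picked Z \<and> f \<in> picked Z")
      case True
      then show ?thesis using ef(3) by (auto simp: picked_def)
    next
      case False
      then consider "e \<in> M" "f \<in> M" | "e \<in> M" "f \<in> picked Z" | "f \<in> M" "e \<in> picked Z"
        using ef by blast
      then show ?thesis
      proof cases
        case 1
        then show ?thesis using M(2) ef(3) by (auto simp: matching_def)
      next
        case 2
        then show ?thesis by (rule mp)
      next
        case 3
        then show ?thesis using mp[of f e] by (simp add: Int_commute)
      qed
    qed
  qed
  have av: "avoiding H (M \<union> picked Z)"
    unfolding avoiding_def
  proof (rule notI, elim bexE)
    fix S assume S: "S \<in> H" "S \<subseteq> M \<union> picked Z"
    show False
    proof (cases "S \<subseteq> M")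
      case True
      then show False using M(3) S(1) by (auto simp: avoiding_def)
    next
      case False
      then obtain f where "f \<in> S" "f \<in> picked Z" using S(2) by blast
      moreover have "S \<subseteq> A1 Z" using S(2) MA by (rule order_trans)
      ultimately show False using S(1) by (auto simp: picked_def)
    qed
  qed
  have y2: "e \<in> edges G \<and> (\<forall>f\<in>A1 Z. ends G e \<inter> ends G f = {}) \<and>
       danger s1 (A1 Z) (y2 Z) e \<le> K \<and> (\<forall>S\<in>H. e \<in> S \<longrightarrow> \<not> S - {e} \<subseteq> A1 Z)" if e: "0 < y2 Z e" for e
  proof -
    have e1: "0 < y e" "Z \<inter> hazard e = {}" "\<not> discarded Z e" using y2_pos[OF e] y1_pos[of Z e] by auto
    have "ends G e \<inter> ends G f = {}" if "f \<in> A1 Z" for f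
    proof (cases "f \<in> A")
      case True
      then show ?thesis by (rule y_disjoint[OF e1(1)])
    next
      case False
      then have f: "Inl f \<in> Z" using that by (simp add: A1_def)
      then have "Inl f \<notin> hazard e" using e1(2) by blast
      then show ?thesis using liveZ[OF f] unfolding Inl_in_hazard_iff by blast
    qed
    moreover have "danger s1 (A1 Z) (y2 Z) e \<le> danger s1 (A1 Z) (y1 Z) e"
      by (rule danger_y2_le)
    ultimately show ?thesis using y_edge[OF e1(1)] e1(3) by (auto simp: discarded_def completed_def)
  qed
  have "load (y2 Z) v \<le> 1" for v
    using load_y2_overloaded[of Z v] load_y2_le[of Z v] by linarith
  moreover have "0 \<le> y2 Z e \<and> y2 Z e \<le> Y'" for e
    using y2_nonneg[of Z e] y2_le_y1[of Z e] y1_le[of Z e] by linarith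
  moreover have "matching G (M \<union> picked Z)" using dis MA A1E by (auto simp: matching_def)
  ultimately show ?thesis using A1E MA av y2 unfolding nibble_state_def by blast
qed

text \<open>An overloaded vertex loses all its edges and with them its whole penalty, which by the
  choice of \<open>B\<close> is worth at least \<open>r\<close> times the load given up.\<close>

lemma load_loss:
  assumes B: "\<And>x. 1 < x \<Longrightarrow> real r * x \<le> B * (max 0 (x - c))\<^sup>2" and c: "0 \<le> c" "0 \<le> B"
  shows "real r * (if 1 < load (y1 Z) v then load (y1 Z) v else 0) + B * (max 0 (load (y2 Z) v - c))\<^sup>2
    \<le> B * (max 0 (load (y1 Z) v - c))\<^sup>2"
proof (cases "1 < load (y1 Z) v")
  case True
  have "max 0 (load (y2 Z) v - c) = 0" using load_y2_overloaded[OF True] c by simp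
  then show ?thesis using B[OF True] True by simp
next
  case False
  have "(max 0 (load (y2 Z) v - c))\<^sup>2 \<le> (max 0 (load (y1 Z) v - c))\<^sup>2"
    using load_y2_le[of Z v] by (intro power_mono) auto
  then show ?thesis using False mult_left_mono[OF _ c(2)] by simp
qed

text \<open>The soft threshold lies at least 1 below the limit \<open>K\<close>, so an edge beyond
  the limit releases a penalty of at least \<open>B'\<close>, and this covers \<open>r\<close> times
  any admissible weight.\<close>

lemma danger_loss:
  assumes B: "real r * Y' \<le> B" and c: "c + 1 \<le> K"
  shows "real r * (if K < danger s1 (A1 Z) (y1 Z) e then y1 Z e else 0)
      + (if 0 < y2 Z e then B * (max 0 (danger s1 (A1 Z) (y2 Z) e - c))\<^sup>2 else 0)
    \<le> B * (if Z \<inter> hazard e = {} then (max 0 (danger s1 (A1 Z) (y1 Z) e - c))\<^sup>2 else 0)"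
proof -
  have B0: "0 \<le> B" using B Y'_nonneg order_trans[of 0 "real r * Y'" B] by simp
  show ?thesis
  proof (cases "0 < y1 Z e")
    case False
    then have "y1 Z e = 0" "\<not> 0 < y2 Z e" using y1_nonneg[of Z e] y2_le_y1[of Z e] by auto
    then show ?thesis using B0 by simp
  next
    case True
    then have surv: "Z \<inter> hazard e = {}" using y1_pos by blast
    show ?thesis
    proof (cases "K < danger s1 (A1 Z) (y1 Z) e")
      case K: True
      then have "y2 Z e = 0" by (simp add: y2_def discarded_def)
      have "1 \<le> (max 0 (danger s1 (A1 Z) (y1 Z) e - c))\<^sup>2"
        using K c by (intro one_le_power) auto
      then have "B * 1 \<le> B * (max 0 (danger s1 (A1 Z) (y1 Z) e - c))\<^sup>2"
        by (rule mult_left_mono[OF _ B0])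
      moreover have "real r * y1 Z e \<le> real r * Y'" using y1_le by (intro mult_left_mono) auto
      ultimately have "real r * y1 Z e \<le> B * (max 0 (danger s1 (A1 Z) (y1 Z) e - c))\<^sup>2" using B by linarith
      then show ?thesis using K \<open>y2 Z e = 0\<close> surv by simp
    next
      case K: False
      have "(max 0 (danger s1 (A1 Z) (y2 Z) e - c))\<^sup>2 \<le> (max 0 (danger s1 (A1 Z) (y1 Z) e - c))\<^sup>2"
        using danger_y2_le[of "A1 Z" Z e] by (intro power_mono) auto
      then have "B * (max 0 (danger s1 (A1 Z) (y2 Z) e - c))\<^sup>2 \<le> B * (max 0 (danger s1 (A1 Z) (y1 Z) e - c))\<^sup>2"
        by (rule mult_left_mono[OF _ B0])
      then show ?thesis using K surv B0 by simp
    qed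
  qed
qed

lemma discarded_loss:
  "(\<Sum>e\<in>edges G. y1 Z e) - (\<Sum>e\<in>edges G. y2 Z e)
    \<le> (\<Sum>v\<in>verts G. if 1 < load (y1 Z) v then load (y1 Z) v else 0)
      + (\<Sum>e | 0 < y e. if K < danger s1 (A1 Z) (y1 Z) e then y1 Z e else 0)
      + (\<Sum>e | 0 < y e. if completed Z e then y1 Z e else 0)"
proof -
  let ?o = "\<lambda>v. 1 < load (y1 Z) v"
  let ?k = "\<lambda>e. if K < danger s1 (A1 Z) (y1 Z) e then y1 Z e else 0"
  let ?t = "\<lambda>e. if completed Z e then y1 Z e else 0"
  have live: "(\<Sum>e | 0 < y e. h e) = (\<Sum>e\<in>edges G. h e)" if "\<And>e. y1 Z e = 0 \<Longrightarrow> h e = 0" for h :: "'e \<Rightarrow> real"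
    by (rule sum.mono_neutral_left[OF finite_edges]) (use that y_edge in \<open>auto simp: y1_def\<close>)
  have "(\<Sum>e\<in>edges G. y1 Z e) - (\<Sum>e\<in>edges G. y2 Z e) = (\<Sum>e\<in>edges G. y1 Z e - y2 Z e)"
    by (simp add: sum_subtractf)
  also have "\<dots> \<le> (\<Sum>e\<in>edges G. (\<Sum>v | v \<in> verts G \<and> v \<in> ends G e. if ?o v then y1 Z e else 0) + ?k e + ?t e)"
  proof (rule sum_mono)
    fix e assume e: "e \<in> edges G"
    have nn: "0 \<le> (\<Sum>v | v \<in> verts G \<and> v \<in> ends G e. if ?o v then y1 Z e else 0)" "0 \<le> ?k e" "0 \<le> ?t e"
      using y1_nonneg[of Z e] by (auto intro!: sum_nonneg)
    show "y1 Z e - y2 Z e \<le> (\<Sum>v | v \<in> verts G \<and> v \<in> ends G e. if ?o v then y1 Z e else 0) + ?k e + ?t e"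
    proof (cases "discarded Z e")
      case False
      then show ?thesis using nn by (simp add: y2_def)
    next
      case True
      then consider v where "v \<in> ends G e" "?o v" | "K < danger s1 (A1 Z) (y1 Z) e" | "completed Z e"
        unfolding discarded_def by blast
      then have "y1 Z e \<le> (\<Sum>v | v \<in> verts G \<and> v \<in> ends G e. if ?o v then y1 Z e else 0) + ?k e + ?t e"
      proof cases
        case 1
        then have "v \<in> {v. v \<in> verts G \<and> v \<in> ends G e}" using ends_subset[OF e] by blast
        then have "(if ?o v then y1 Z e else 0) \<le> (\<Sum>v | v \<in> verts G \<and> v \<in> ends G e. if ?o v then y1 Z e else 0)"
          using y1_nonneg finite_verts by (intro member_le_sum) auto
        then show ?thesis using 1 nn by simp
      next
        case 2
        then show ?thesis using nn by simp
      next
        case 3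
        then show ?thesis using nn by simp
      qed
      then show ?thesis using True by (simp add: y2_def)
    qed
  qed
  also have "\<dots> = (\<Sum>e\<in>edges G. \<Sum>v | v \<in> verts G \<and> v \<in> ends G e. if ?o v then y1 Z e else 0)
      + (\<Sum>e\<in>edges G. ?k e) + (\<Sum>e\<in>edges G. ?t e)"
    by (simp add: sum.distrib)
  also have "(\<Sum>e\<in>edges G. \<Sum>v | v \<in> verts G \<and> v \<in> ends G e. if ?o v then y1 Z e else 0)
      = (\<Sum>v\<in>verts G. \<Sum>e | e \<in> edges G \<and> v \<in> ends G e. if ?o v then y1 Z e else 0)"
    by (rule sum.swap_restrict[OF finite_edges finite_verts])
  also have "\<dots> = (\<Sum>v\<in>verts G. if ?o v then load (y1 Z) v else 0)"
    by (rule sum.cong[OF refl]) (simp add: load_def)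
  also have "(\<Sum>e\<in>edges G. ?k e) = (\<Sum>e | 0 < y e. ?k e)" by (rule live[symmetric]) simp
  also have "(\<Sum>e\<in>edges G. ?t e) = (\<Sum>e | 0 < y e. ?t e)" by (rule live[symmetric]) simp
  finally show ?thesis .
qed

text \<open>Since \<open>w \<le> 1\<close>, discarding weight costs the potential at most
  \<open>r\<close> times that weight. The released penalties pay for overloaded vertices and
  endangered edges; only the loss from completed configurations remains as an explicit term.\<close>

lemma potential_gain_pointwise:
  assumes B: "\<And>x. 1 < x \<Longrightarrow> real r * x \<le> B * (max 0 (x - c))\<^sup>2" and c: "0 \<le> c" "0 \<le> B"
    and B': "real r * Y' \<le> B'" "c' + 1 \<le> K" and w: "0 \<le> w" "w \<le> 1"
  shows "real r * w * (\<Sum>e\<in>edges G. y1 Z e) - B * (\<Sum>v\<in>verts G. (max 0 (load (y1 Z) v - c))\<^sup>2)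
      - B' * (\<Sum>e | 0 < y e. if Z \<inter> hazard e = {} then (max 0 (danger s1 (A1 Z) (y1 Z) e - c'))\<^sup>2 else 0)
      - real r * (\<Sum>e | 0 < y e. if completed Z e then y1 Z e else 0)
    \<le> real r * w * (\<Sum>e\<in>edges G. y2 Z e) - B * load_excess c (y2 Z) - B' * danger_excess c' s1 (A1 Z) (y2 Z)"
proof -
  let ?l = "\<Sum>v\<in>verts G. if 1 < load (y1 Z) v then load (y1 Z) v else 0"
  let ?k = "\<Sum>e | 0 < y e. if K < danger s1 (A1 Z) (y1 Z) e then y1 Z e else 0"
  let ?t = "\<Sum>e | 0 < y e. if completed Z e then y1 Z e else 0"
  let ?d = "(\<Sum>e\<in>edges G. y1 Z e) - (\<Sum>e\<in>edges G. y2 Z e)"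
  have d0: "0 \<le> ?d" using sum_mono[of "edges G" "y2 Z" "y1 Z"] y2_le_y1 by simp
  have "w * ?d \<le> 1 * ?d" using w(2) d0 by (rule mult_right_mono)
  also have "1 * ?d = ?d" by simp
  also have "?d \<le> ?l + ?k + ?t" by (rule discarded_loss)
  finally have 1: "real r * (w * ?d) \<le> real r * (?l + ?k + ?t)" by (rule mult_left_mono) simp
  have "(\<Sum>v\<in>verts G. real r * (if 1 < load (y1 Z) v then load (y1 Z) v else 0)
      + B * (max 0 (load (y2 Z) v - c))\<^sup>2) \<le> (\<Sum>v\<in>verts G. B * (max 0 (load (y1 Z) v - c))\<^sup>2)"
    by (rule sum_mono, rule load_loss[OF B c])
  then have 2: "real r * ?l + B * load_excess c (y2 Z) \<le> B * (\<Sum>v\<in>verts G. (max 0 (load (y1 Z) v - c))\<^sup>2)"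
    by (simp only: sum.distrib load_excess_def sum_distrib_left)
  have "(\<Sum>e | 0 < y e. if 0 < y2 Z e then B' * (max 0 (danger s1 (A1 Z) (y2 Z) e - c'))\<^sup>2 else 0)
      = (\<Sum>e | 0 < y2 Z e. B' * (max 0 (danger s1 (A1 Z) (y2 Z) e - c'))\<^sup>2)"
  proof (rule sum.mono_neutral_cong_right[OF finite_live])
    show "{e. 0 < y2 Z e} \<subseteq> {e. 0 < y e}" using y2_pos y1_pos by blast
  qed auto
  moreover have "(\<Sum>e | 0 < y e. real r * (if K < danger s1 (A1 Z) (y1 Z) e then y1 Z e else 0)
      + (if 0 < y2 Z e then B' * (max 0 (danger s1 (A1 Z) (y2 Z) e - c'))\<^sup>2 else 0))
    \<le> (\<Sum>e | 0 < y e. B' * (if Z \<inter> hazard e = {} then (max 0 (danger s1 (A1 Z) (y1 Z) e - c'))\<^sup>2 else 0))"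
    by (rule sum_mono, rule danger_loss[OF B'])
  ultimately have 3: "real r * ?k + B' * danger_excess c' s1 (A1 Z) (y2 Z)
    \<le> B' * (\<Sum>e | 0 < y e. if Z \<inter> hazard e = {} then (max 0 (danger s1 (A1 Z) (y1 Z) e - c'))\<^sup>2 else 0)"
    by (simp only: sum.distrib danger_excess_def sum_distrib_left)
  from 1 2 3 show ?thesis by (simp add: algebra_simps)
qed

lemma sum_y_live: "(\<Sum>e | 0 < y e. y e) = (\<Sum>e\<in>edges G. y e)"
proof (rule sum.mono_neutral_left[OF finite_edges])
  show "\<forall>i\<in>edges G - {e. 0 < y e}. y i = 0"
    using y_nonneg by (force simp: not_less intro: antisym)
qed (use y_edge in auto)

lemma expected_completed_loss:
  "bexp p trials (\<lambda>Z. \<Sum>e | 0 < y e. if completed Z e then y1 Z e else 0) \<le> \<epsilon>\<^sup>2 * K * (\<Sum>e\<in>edges G. y e)"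
proof -
  have "bexp p trials (\<lambda>Z. \<Sum>e | 0 < y e. if completed Z e then y1 Z e else 0)
    = (\<Sum>e | 0 < y e. bexp p trials (\<lambda>Z. if completed Z e then y1 Z e else 0))" by (rule bexp_sum)
  also have "\<dots> \<le> (\<Sum>e | 0 < y e. \<epsilon>\<^sup>2 * K * y e)"
  proof (rule sum_mono)
    fix e assume "e \<in> {e. 0 < y e}"
    then have e: "0 < y e" by simp
    let ?a = "y e * (1 - \<epsilon>) / survival e"
    let ?i = "\<lambda>Z. if Z \<inter> hazard e = {} \<and> (\<exists>S\<in>H. e \<in> S \<and> S - {e} \<subseteq> A1 Z) then 1 else 0 :: real"
    have "0 \<le> ?a" using e eps_le survival_pos[OF e] by simp
    have "bexp p trials (\<lambda>Z. if completed Z e then y1 Z e else 0) = bexp p trials (\<lambda>Z. ?a * ?i Z)"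
      unfolding completed_def[symmetric] by (rule bexp_cong) (simp add: y1_def e)
    also have "\<dots> \<le> ?a * (survival e * (\<epsilon>\<^sup>2 * K))"
      unfolding bexp_cmult using completion_probability_le[OF e] \<open>0 \<le> ?a\<close> by (rule mult_left_mono)
    also have "\<dots> = (1 - \<epsilon>) * (\<epsilon>\<^sup>2 * K * y e)" using survival_pos[OF e] by simp
    also have "\<dots> \<le> \<epsilon>\<^sup>2 * K * y e"
      using e K_nonneg eps_pos eps_le by (intro mult_left_le_one_le) auto
    finally show "bexp p trials (\<lambda>Z. if completed Z e then y1 Z e else 0) \<le> \<epsilon>\<^sup>2 * K * y e" .
  qed
  also have "\<dots> = \<epsilon>\<^sup>2 * K * (\<Sum>e | 0 < y e. y e)" by (simp add: sum_distrib_left)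
  also note sum_y_live
  finally show ?thesis .
qed

abbreviation "load_variance \<equiv> 2 * \<eta> * (real r * cd + cc) * Y'"

text \<open>\<open>w\<close> values a unit of remaining weight by the part of it that later rounds
  can still turn into matching edges. In one round a unit yields picked edges at rate
  \<open>\<epsilon> * (1 - \<epsilon> * (r + K))\<close> and keeps mean weight
  \<open>1 - \<epsilon>\<close>; this gives the coefficient on the left.\<close>

lemma nibble_step_exists:
  assumes M: "M \<subseteq> A" "matching G M" "avoiding H M"
    and B: "\<And>x. 1 < x \<Longrightarrow> real r * x \<le> B * (max 0 (x - c))\<^sup>2" and c: "0 \<le> c" "0 \<le> B"
    and B': "real r * Y' \<le> B'" "c' + 1 \<le> K" and c': "0 \<le> c'" and w: "0 \<le> w" "w \<le> 1"
  shows "\<exists>A' M' y'. nibble_state K s1 Y' A' M' y' \<and>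
    real r * real (card M) + real r * (\<epsilon> * (1 - \<epsilon> * (real r + K)) + (1 - \<epsilon>) * w) * (\<Sum>e\<in>edges G. y e)
      - B * load_excess c y - B' * danger_excess c' s A y
      - (real (card (verts G)) * (\<epsilon>\<^sup>2 * K + B * load_variance) + real (card (edges G)) * (B' * danger_variance))
    \<le> real r * real (card M') + real r * w * (\<Sum>e\<in>edges G. y' e)
      - B * load_excess c y' - B' * danger_excess c' s1 A' y'"
proof -
  let ?L = "\<lambda>Z. (\<Sum>v\<in>verts G. (max 0 (load (y1 Z) v - c))\<^sup>2)"
  let ?D = "\<lambda>Z. (\<Sum>e | 0 < y e. if Z \<inter> hazard e = {} then (max 0 (danger s1 (A1 Z) (y1 Z) e - c'))\<^sup>2 else 0)"
  let ?T = "\<lambda>Z. (\<Sum>e | 0 < y e. if completed Z e then y1 Z e else 0)"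
  let ?P = "\<lambda>Z. (\<Sum>f | 0 < y f. if f \<in> picked Z then 1 else 0 :: real)"
  let ?Y = "\<Sum>e\<in>edges G. y e"
  have B'0: "0 \<le> B'" using B'(1) Y'_nonneg order_trans[of 0 "real r * Y'" B'] by simp
  \<comment> \<open>\<open>Q\<close> uses the weights before discarding, whose expectations are
    available; pointwise it bounds the true new potential from below.\<close>
  define Q where "Q Z = real r * real (card M) + real r * ?P Z
      + (real r * w * (\<Sum>e\<in>edges G. y1 Z e) - B * ?L Z - B' * ?D Z - real r * ?T Z)" for Z
  have EY: "bexp p trials (\<lambda>Z. \<Sum>e\<in>edges G. y1 Z e) = (1 - \<epsilon>) * ?Y"
    unfolding bexp_sum expectation_y1_full by (simp add: sum_distrib_left)
  have EL: "bexp p trials ?L \<le> load_excess c y + real (card (verts G)) * load_variance"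
  proof -
    have "bexp p trials ?L \<le> (\<Sum>v\<in>verts G. (max 0 (load y v - c))\<^sup>2 + load_variance)"
      unfolding bexp_sum by (rule sum_mono, rule expected_load_excess[OF _ c(1)])
    then show ?thesis by (simp add: load_excess_def sum.distrib)
  qed
  have dv0: "0 \<le> danger_variance"
  proof (rule add_nonneg_nonneg)
    show "0 \<le> 6 * ((real g)\<^sup>2 * \<tau>) * K\<^sup>2"
      by (intro mult_nonneg_nonneg[OF mult_nonneg_nonneg[OF _ mult_nonneg_nonneg[OF _ tau_nonneg]]]) simp_all
    have "0 \<le> real r * cc + 2" using cc_nonneg by simp
    moreover have "0 \<le> \<upsilon>" by (rule mult_nonneg_nonneg[OF Y'_nonneg less_imp_le[OF boost_pos]])
    ultimately show "0 \<le> 4 * real g * (real r * cc + 2) * \<upsilon> * K"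
      by (intro mult_nonneg_nonneg[OF mult_nonneg_nonneg[OF mult_nonneg_nonneg]] K_nonneg) simp_all
  qed
  have ED: "bexp p trials ?D \<le> danger_excess c' s A y + real (card (edges G)) * danger_variance"
  proof -
    have "bexp p trials ?D \<le> (\<Sum>e | 0 < y e. (max 0 (danger s A y e - c'))\<^sup>2 + danger_variance)"
      unfolding bexp_sum by (rule sum_mono, rule expected_danger_excess[OF _ c']) simp
    also have "\<dots> = danger_excess c' s A y + real (card {e. 0 < y e}) * danger_variance"
      by (simp add: danger_excess_def sum.distrib)
    also have "real (card {e. 0 < y e}) * danger_variance \<le> real (card (edges G)) * danger_variance"
      using card_mono[OF finite_edges, of "{e. 0 < y e}"] y_edge
      by (intro mult_right_mono[OF _ dv0]) auto
    finally show ?thesis by simp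
  qed
  have EP: "\<epsilon> * (1 - \<epsilon> * (real r + K)) * ?Y \<le> bexp p trials ?P"
  proof -
    have "\<epsilon> * (1 - \<epsilon> * (real r + K)) * ?Y = (\<Sum>f | 0 < y f. \<epsilon> * y f * (1 - \<epsilon> * (real r + K)))"
      unfolding sum_y_live[symmetric] sum_distrib_left by (simp add: mult_ac)
    also have "\<dots> \<le> bexp p trials ?P"
      unfolding bexp_sum by (rule sum_mono, rule picked_probability_ge) simp
    finally show ?thesis .
  qed
  have "real r * ?Y \<le> real (card (verts G))"
  proof -
    have "real r * ?Y = (\<Sum>v\<in>verts G. load y v)" by (rule sum_load[symmetric])
    also have "\<dots> \<le> real (card (verts G)) * 1" by (rule sum_bounded_above[OF load_le_1])
    finally show ?thesis by simp
  qed
  then have "\<epsilon>\<^sup>2 * K * (real r * ?Y) \<le> \<epsilon>\<^sup>2 * K * real (card (verts G))"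
    using K_nonneg by (intro mult_left_mono) auto
  moreover have "real r * bexp p trials ?T \<le> real r * (\<epsilon>\<^sup>2 * K * ?Y)"
    using expected_completed_loss by (rule mult_left_mono) simp
  ultimately have ET: "real r * bexp p trials ?T \<le> real (card (verts G)) * (\<epsilon>\<^sup>2 * K)"
    by (simp add: mult_ac)
  have "bexp p trials Q = real r * real (card M) + real r * bexp p trials ?P
      + (real r * w * ((1 - \<epsilon>) * ?Y) - B * bexp p trials ?L - B' * bexp p trials ?D - real r * bexp p trials ?T)"
    unfolding Q_def bexp_add bexp_diff bexp_cmult EY bexp_const[OF finite_trials] ..
  moreover have "real r * (\<epsilon> * (1 - \<epsilon> * (real r + K)) * ?Y) \<le> real r * bexp p trials ?P"
    using EP by (rule mult_left_mono) simp
  moreover have "B * bexp p trials ?L \<le> B * (load_excess c y + real (card (verts G)) * load_variance)"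
    using EL c(2) by (rule mult_left_mono)
  moreover have "B' * bexp p trials ?D \<le> B' * (danger_excess c' s A y + real (card (edges G)) * danger_variance)"
    using ED B'0 by (rule mult_left_mono)
  ultimately have EQ: "real r * real (card M) + real r * (\<epsilon> * (1 - \<epsilon> * (real r + K)) * ?Y)
      + (real r * w * ((1 - \<epsilon>) * ?Y) - B * (load_excess c y + real (card (verts G)) * load_variance)
        - B' * (danger_excess c' s A y + real (card (edges G)) * danger_variance)
        - real (card (verts G)) * (\<epsilon>\<^sup>2 * K)) \<le> bexp p trials Q"
    using ET by linarith
  have split: "real r * real (card M) + real r * (\<epsilon> * (1 - \<epsilon> * (real r + K)) + (1 - \<epsilon>) * w) * ?Y
      - B * load_excess c y - B' * danger_excess c' s A y
      - (real (card (verts G)) * (\<epsilon>\<^sup>2 * K + B * load_variance) + real (card (edges G)) * (B' * danger_variance))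
    = real r * real (card M) + real r * (\<epsilon> * (1 - \<epsilon> * (real r + K)) * ?Y)
      + (real r * w * ((1 - \<epsilon>) * ?Y) - B * (load_excess c y + real (card (verts G)) * load_variance)
        - B' * (danger_excess c' s A y + real (card (edges G)) * danger_variance)
        - real (card (verts G)) * (\<epsilon>\<^sup>2 * K))"
  proof -
    have "R * M + R * (a + b * w) * T - B * l - B' * d - (V * (k + B * lv) + E * (B' * dv))
      = R * M + R * (a * T) + (R * w * (b * T) - B * (l + V * lv) - B' * (d + E * dv) - V * k)"
      for R M a b w T B l B' d V k lv E dv :: real
      by (simp add: algebra_simps)
    then show ?thesis .
  qed
  obtain Z where Z: "Z \<subseteq> trials" "bexp p trials Q \<le> Q Z"
    using bexp_le_some[where p = p, OF finite_trials p_prob] by blast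
  have picked_live: "0 < y f" if "f \<in> picked Z" for f
  proof -
    have "Inl f \<in> trials" using that Z(1) by (auto simp: picked_def)
    then show ?thesis by (auto simp: trials_def)
  qed
  have "?P Z = real (card (picked Z))"
  proof -
    have "picked Z \<subseteq> {f. 0 < y f}" using picked_live by blast
    then have "{f. 0 < y f} \<inter> picked Z = picked Z" by blast
    then show ?thesis
      using sum.inter_restrict[OF finite_live, of "\<lambda>_. 1 :: real" "picked Z"] by simp
  qed
  moreover have "card (M \<union> picked Z) = card M + card (picked Z)"
  proof (rule card_Un_disjoint)
    show "finite M" using finite_subset[OF M(1)] finite_subset[OF A_edges finite_edges] by blast
    show "finite (picked Z)"
      by (rule finite_subset[OF _ finite_live]) (use picked_live in blast)
    have "f \<notin> M" if "f \<in> picked Z" for f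
      using live_notin_A[OF picked_live[OF that]] M(1) by blast
    then show "M \<inter> picked Z = {}" by blast
  qed
  ultimately have "Q Z \<le> real r * real (card (M \<union> picked Z)) + real r * w * (\<Sum>e\<in>edges G. y2 Z e)
      - B * load_excess c (y2 Z) - B' * danger_excess c' s1 (A1 Z) (y2 Z)"
    using potential_gain_pointwise[OF B c B' w, of Z] unfolding Q_def by (simp add: distrib_left)
  note final = order_trans[OF order_trans[OF EQ Z(2)] this]
  show ?thesis
  proof (intro exI conjI)
    show "nibble_state K s1 Y' (A1 Z) (M \<union> picked Z) (y2 Z)" by (rule nibble_state_next[OF M Z(1)])
  qed (unfold split, rule final)
qed

end

context bounded_configuration
begin

section \<open>Iteration\<close>

definition step_error :: "real \<Rightarrow> real \<Rightarrow> real \<Rightarrow> real \<Rightarrow> real \<Rightarrow> real \<Rightarrow> real" where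
  "step_error \<epsilon> K Y b B B' =
     real (card (verts G)) * (\<epsilon>\<^sup>2 * K + B * (2 * (\<epsilon> * (2 * real r + K)) * (real r * cd + cc) * Y)) +
     real (card (edges G)) * (B' * (6 * ((real g)\<^sup>2 * (\<epsilon> * Y * ((real r)\<^sup>2 * cd + 2 * real r * cc))) * K\<^sup>2
       + 4 * real g * (real r * cc + 2) * (Y * b) * K))"

lemma step_error_mono:
  assumes "0 \<le> \<epsilon>" "0 \<le> K" "0 \<le> B" "0 \<le> B'" "0 \<le> Y1" "Y1 \<le> Y" "0 \<le> Y2" "Y2 \<le> Y" "0 \<le> b1" "b1 \<le> b"
  shows "real (card (verts G)) * (\<epsilon>\<^sup>2 * K + B * (2 * (\<epsilon> * (2 * real r + K)) * (real r * cd + cc) * Y2)) +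
     real (card (edges G)) * (B' * (6 * ((real g)\<^sup>2 * (\<epsilon> * Y1 * ((real r)\<^sup>2 * cd + 2 * real r * cc))) * K\<^sup>2
       + 4 * real g * (real r * cc + 2) * (Y2 * b1) * K)) \<le> step_error \<epsilon> K Y b B B'"
proof -
  have Y: "0 \<le> Y" "0 \<le> b" using assms by auto
  have 1: "0 \<le> real r * cd + cc" "0 \<le> (real r)\<^sup>2 * cd + 2 * real r * cc" "0 \<le> real r * cc + 2"
    "0 \<le> 2 * (\<epsilon> * (2 * real r + K))"
    using cd_nonneg cc_nonneg assms by auto
  have h1: "2 * (\<epsilon> * (2 * real r + K)) * (real r * cd + cc) * Y2 \<le> 2 * (\<epsilon> * (2 * real r + K)) * (real r * cd + cc) * Y"
    by (rule mult_left_mono[OF assms(8) mult_nonneg_nonneg[OF 1(4) 1(1)]])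
  have "\<epsilon> * Y1 * ((real r)\<^sup>2 * cd + 2 * real r * cc) \<le> \<epsilon> * Y * ((real r)\<^sup>2 * cd + 2 * real r * cc)"
    by (rule mult_right_mono[OF mult_left_mono[OF assms(6,1)] 1(2)])
  then have h2: "6 * ((real g)\<^sup>2 * (\<epsilon> * Y1 * ((real r)\<^sup>2 * cd + 2 * real r * cc))) * K\<^sup>2
    \<le> 6 * ((real g)\<^sup>2 * (\<epsilon> * Y * ((real r)\<^sup>2 * cd + 2 * real r * cc))) * K\<^sup>2"
    by (intro mult_right_mono[OF mult_left_mono[OF mult_left_mono]]) simp_all
  have "Y2 * b1 \<le> Y * b" by (rule mult_mono[OF assms(8,10) Y(1) assms(9)])
  then have h3: "4 * real g * (real r * cc + 2) * (Y2 * b1) * K \<le> 4 * real g * (real r * cc + 2) * (Y * b) * K"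
    by (intro mult_right_mono[OF mult_left_mono[OF _ mult_nonneg_nonneg[OF _ 1(3)]] assms(2)]) simp_all
  show ?thesis
    unfolding step_error_def
    by (rule add_mono[OF mult_left_mono[OF add_left_mono[OF mult_left_mono[OF h1 assms(3)]]]
          mult_left_mono[OF mult_left_mono[OF add_mono[OF h2 h3] assms(4)]]]) simp_all
qed

text \<open>Equal weights keep all loads and dangers below the soft thresholds, so the potential
  starts free of penalties. No edge starts blocked, because configurations have at least two
  edges.\<close>

lemma initial_nibble_state:
  assumes y0: "0 \<le> y0" "y0 \<le> Y" and c: "c \<le> 1" and c': "c' \<le> K"
    and load: "\<And>v. v \<in> verts G \<Longrightarrow> real (vertex_degree G v) * y0 \<le> c"
    and danger: "\<And>e. e \<in> edges G \<Longrightarrow> (\<Sum>S | S \<in> H \<and> e \<in> S. (y0 * (1 + 1 / real g)) ^ (card S - 1)) \<le> c'"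
  shows "nibble_state K 1 Y {} {} (\<lambda>e. if e \<in> edges G then y0 else 0)"
    and "load_excess c (\<lambda>e. if e \<in> edges G then y0 else 0) = 0"
    and "danger_excess c' 1 {} (\<lambda>e. if e \<in> edges G then y0 else 0) = 0"
proof -
  let ?y = "\<lambda>e. if e \<in> edges G then y0 else 0"
  have unblocked: "\<not> S - {e} \<subseteq> {}" if "S \<in> H" for S e
  proof
    assume "S - {e} \<subseteq> {}"
    then have "S \<subseteq> {e}" by blast
    then have "card S \<le> 1" using card_mono[of "{e}" S] by simp
    then show False using card_config_ge[OF that] by simp
  qed
  have l: "load ?y v \<le> c" if "v \<in> verts G" for v
  proof -
    have "load ?y v = (\<Sum>e | e \<in> edges G \<and> v \<in> ends G e. y0)"
      unfolding load_def by (rule sum.cong) auto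
    then show ?thesis using load[OF that] by (simp add: vertex_degree_def)
  qed
  have d: "danger 1 {} ?y e \<le> c'" if e: "e \<in> edges G" for e
  proof -
    have "danger 1 {} ?y e = (\<Sum>S | S \<in> H \<and> e \<in> S. (y0 * (1 + 1 / real g)) ^ (card S - 1))"
      unfolding danger_def
    proof (rule sum.cong)
      show "pending {} e = {S. S \<in> H \<and> e \<in> S}" using unblocked by (auto simp: pending_def)
      fix S assume "S \<in> {S. S \<in> H \<and> e \<in> S}"
      then have S: "S \<in> H" "e \<in> S" by auto
      have "(\<Prod>f\<in>S - {e}. factor 1 {} ?y f) = (\<Prod>f\<in>S - {e}. y0 * (1 + 1 / real g))"
        by (rule prod.cong[OF refl]) (use config_subset[OF S(1)] in \<open>auto simp: factor_def\<close>)
      then show "(\<Prod>f\<in>S - {e}. factor 1 {} ?y f) = (y0 * (1 + 1 / real g)) ^ (card S - 1)"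
        using S(2) finite_config[OF S(1)] by (simp add: card_Diff_singleton)
    qed
    then show ?thesis using danger[OF e] by simp
  qed
  have edge: "e \<in> edges G" if "0 < ?y e" for e using that by (simp split: if_splits)
  show "nibble_state K 1 Y {} {} ?y"
    unfolding nibble_state_def
  proof (intro conjI allI impI ballI)
    fix e assume e: "0 < ?y e"
    show "danger 1 {} ?y e \<le> K" by (rule order_trans[OF d[OF edge[OF e]] c'])
  next
    fix v assume v: "v \<in> verts G"
    show "load ?y v \<le> 1" by (rule order_trans[OF l[OF v] c])
  next
    fix e S assume "S \<in> H"
    then show "\<not> S - {e} \<subseteq> {}" by (rule unblocked)
  next
    show "avoiding H {}" using card_config_ge by (fastforce simp: avoiding_def)
  qed (use y0 edge in \<open>auto simp: matching_def\<close>)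
  show "load_excess c ?y = 0"
    unfolding load_excess_def
  proof (rule sum.neutral, rule ballI)
    fix v assume "v \<in> verts G"
    then have "load ?y v \<le> c" by (rule l)
    then show "(max 0 (load ?y v - c))\<^sup>2 = 0" by simp
  qed
  show "danger_excess c' 1 {} ?y = 0"
    unfolding danger_excess_def
  proof (rule sum.neutral, rule ballI)
    fix e assume "e \<in> {e. 0 < ?y e}"
    then have "danger 1 {} ?y e \<le> c'" using d edge by blast
    then show "(max 0 (danger 1 {} ?y e - c'))\<^sup>2 = 0" by simp
  qed
qed

text \<open>With \<open>k\<close> rounds to go, a unit of weight is valued at
  \<open>(1 - \<epsilon> * (r + K)) * (1 - (1 - \<epsilon>) ^ k)\<close>, the yield of these rounds
  if conflicts were the only loss. The potential built on this value drops by at most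
  \<open>step_error\<close> per round.\<close>

lemma nibble_state_iterate:
  fixes \<epsilon> K B B' c c' b Ym y0 :: real and Y :: "nat \<Rightarrow> real" and T :: nat
  assumes eps: "0 < \<epsilon>" "\<epsilon> * (2 * real r + K) \<le> 1 / 2" "\<epsilon> * (real g * K) < 1" and K: "0 \<le> K"
    and Y: "\<And>j. j < T \<Longrightarrow> Y j \<le> Y (Suc j) * ((1 - \<epsilon>) ^ (r - 1) * (1 - \<epsilon> * (real g * (1 - \<epsilon>) ^ j * K)))"
    and Ym: "\<And>j. j \<le> T \<Longrightarrow> 0 \<le> Y j \<and> Y j \<le> Ym"
    and b: "1 + 1 / (real g * (1 - \<epsilon>) ^ T) \<le> b"
    and overlap: "(real g)\<^sup>2 * (\<epsilon> * Ym * ((real r)\<^sup>2 * cd + 2 * real r * cc)) \<le> 1 / 2"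
    and gain: "Ym * b \<le> 1"
    and B: "\<And>x. 1 < x \<Longrightarrow> real r * x \<le> B * (max 0 (x - c))\<^sup>2" and c: "0 \<le> c" "c \<le> 1" "0 \<le> B"
    and B': "real r * Ym \<le> B'" "c' + 1 \<le> K" "0 \<le> c'"
    and y0: "0 \<le> y0" "y0 \<le> Y 0"
    and load: "\<And>v. v \<in> verts G \<Longrightarrow> real (vertex_degree G v) * y0 \<le> c"
    and danger: "\<And>e. e \<in> edges G \<Longrightarrow> (\<Sum>S | S \<in> H \<and> e \<in> S. (y0 * (1 + 1 / real g)) ^ (card S - 1)) \<le> c'"
    and j: "j \<le> T"
  shows "\<exists>A M y. nibble_state K ((1 - \<epsilon>) ^ j) (Y j) A M y \<and>
    real r * ((1 - \<epsilon> * (real r + K)) * (1 - (1 - \<epsilon>) ^ T)) * (real (card (edges G)) * y0)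
      - real j * step_error \<epsilon> K Ym b B B'
    \<le> real r * real (card M) + real r * ((1 - \<epsilon> * (real r + K)) * (1 - (1 - \<epsilon>) ^ (T - j))) * (\<Sum>e\<in>edges G. y e)
      - B * load_excess c y - B' * danger_excess c' ((1 - \<epsilon>) ^ j) A y"
  using j
proof (induction j)
  case 0
  let ?y = "\<lambda>e. if e \<in> edges G then y0 else 0"
  have "c' \<le> K" using B'(2) by linarith
  note init = initial_nibble_state[OF y0 c(2) this load danger]
  have "(\<Sum>e\<in>edges G. ?y e) = real (card (edges G)) * y0" by simp
  then show ?case
    using init by (intro exI[of _ "{}"] exI[of _ ?y]) simp
next
  case (Suc j)
  let ?s = "(1 - \<epsilon>) ^ j" and ?q = "1 - \<epsilon> * (real r + K)" and ?err = "step_error \<epsilon> K Ym b B B'"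
  let ?w = "\<lambda>k. (1 - \<epsilon> * (real r + K)) * (1 - (1 - \<epsilon>) ^ k)"
  have jT: "j < T" "Suc j \<le> T" "j \<le> T" using Suc.prems by auto
  from Suc.IH[OF jT(3)] obtain A M y where st: "nibble_state K ?s (Y j) A M y" and
    pot: "real r * ?w T * (real (card (edges G)) * y0) - real j * ?err
    \<le> real r * real (card M) + real r * ?w (T - j) * (\<Sum>e\<in>edges G. y e)
      - B * load_excess c y - B' * danger_excess c' ?s A y" by blast
  have "\<epsilon> * 4 \<le> \<epsilon> * (2 * real r + K)" using r_ge_2 K eps(1) by (intro mult_left_mono) auto
  then have eps8: "\<epsilon> \<le> 1 / 8" using eps(2) by linarith
  have s: "0 < ?s" "?s \<le> 1" using eps(1) eps8 by (auto intro!: power_le_one)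
  have Ym0: "0 \<le> Ym" using Ym[of 0] by linarith
  have B'0: "0 \<le> B'" using B'(1) Ym0 order_trans[of 0 "real r * Ym" B'] by simp
  have q: "0 \<le> ?q" "?q \<le> 1"
  proof -
    have "\<epsilon> * (real r + K) \<le> \<epsilon> * (2 * real r + K)" using eps(1) by (intro mult_left_mono) auto
    then show "0 \<le> ?q" using eps(2) by linarith
    have "0 \<le> \<epsilon> * (real r + K)" using eps(1) K by simp
    then show "?q \<le> 1" by linarith
  qed
  have w: "0 \<le> ?w k" "?w k \<le> 1" for k
  proof -
    have "0 \<le> (1 - \<epsilon>) ^ k" "(1 - \<epsilon>) ^ k \<le> 1" using eps(1) eps8 by (auto intro!: power_le_one)
    then show "0 \<le> ?w k" "?w k \<le> 1" using q by (auto intro!: mult_le_one)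
  qed
  \<comment> \<open>Pick rate of the current round plus the value of what remains with one round
    less to go.\<close>
  have wrec: "\<epsilon> * ?q + (1 - \<epsilon>) * ?w (T - Suc j) = ?w (T - j)"
  proof -
    have "(1 - \<epsilon>) ^ (T - j) = (1 - \<epsilon>) * (1 - \<epsilon>) ^ (T - Suc j)"
      using jT(1) by (simp flip: power_Suc add: Suc_diff_Suc)
    then show ?thesis by (simp only:) (simp add: algebra_simps)
  qed
  have boost: "1 + 1 / (real g * ((1 - \<epsilon>) * ?s)) \<le> b" "0 \<le> 1 + 1 / (real g * ((1 - \<epsilon>) * ?s))"
  proof -
    have "(1 - \<epsilon>) ^ T \<le> (1 - \<epsilon>) ^ Suc j"
      using eps(1) eps8 jT(2) by (intro power_decreasing) auto
    moreover have "0 < (1 - \<epsilon>) ^ T" using eps8 by simp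
    ultimately have "1 / (real g * (1 - \<epsilon>) ^ Suc j) \<le> 1 / (real g * (1 - \<epsilon>) ^ T)"
      using g_ge_2 by (intro divide_left_mono mult_left_mono mult_pos_pos) auto
    then show "1 + 1 / (real g * ((1 - \<epsilon>) * ?s)) \<le> b" using b by simp
    have "0 \<le> real g * ((1 - \<epsilon>) * ?s)" using s eps8 by simp
    then show "0 \<le> 1 + 1 / (real g * ((1 - \<epsilon>) * ?s))" by simp
  qed
  have Yj: "0 \<le> Y j" "Y j \<le> Ym" "0 \<le> Y (Suc j)" "Y (Suc j) \<le> Ym" using Ym jT by auto
  have step: "sparse_nibble_step G H r g cd cc A y ?s \<epsilon> K (Y j) (Y (Suc j))"
  proof unfold_locales
    show "\<epsilon> * (real g * ?s * K) < 1"
    proof -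
      have "\<epsilon> * (real g * ?s * K) = ?s * (\<epsilon> * (real g * K))" by simp
      also have "\<dots> \<le> \<epsilon> * (real g * K)"
        using s eps(1) K by (intro mult_left_le_one_le) auto
      finally show ?thesis using eps(3) by linarith
    qed
    show "(real g)\<^sup>2 * (\<epsilon> * Y j * ((real r)\<^sup>2 * cd + 2 * real r * cc)) \<le> 1 / 2"
    proof -
      have "(real g)\<^sup>2 * (\<epsilon> * Y j * ((real r)\<^sup>2 * cd + 2 * real r * cc))
          \<le> (real g)\<^sup>2 * (\<epsilon> * Ym * ((real r)\<^sup>2 * cd + 2 * real r * cc))"
        using Yj eps(1) cd_nonneg cc_nonneg by (intro mult_left_mono mult_right_mono) auto
      then show ?thesis using overlap by linarith
    qed
    show "Y (Suc j) * (1 + 1 / (real g * ((1 - \<epsilon>) * ?s))) \<le> 1"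
    proof -
      have "Y (Suc j) * (1 + 1 / (real g * ((1 - \<epsilon>) * ?s))) \<le> Ym * b"
        by (rule mult_mono[OF Yj(4) boost(1) Ym0 boost(2)])
      then show ?thesis using gain by linarith
    qed
    show "Y j \<le> Y (Suc j) * ((1 - \<epsilon>) ^ (r - 1) * (1 - \<epsilon> * (real g * ?s * K)))" using Y[OF jT(1)] .
  qed (use st eps K s in \<open>auto simp: nibble_state_def\<close>)
  interpret sparse_nibble_step G H r g cd cc A y ?s \<epsilon> K "Y j" "Y (Suc j)" by (rule step)
  have M: "M \<subseteq> A" "matching G M" "avoiding H M" using st by (auto simp: nibble_state_def)
  have "real r * Y (Suc j) \<le> real r * Ym" using Yj(4) by (intro mult_left_mono) auto
  then have B'j: "real r * Y (Suc j) \<le> B'" using B'(1) by linarith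
  from nibble_step_exists[OF M B c(1,3) B'j B'(2,3) w, of "T - Suc j"]
  obtain A' M' y' where st': "nibble_state K s1 (Y (Suc j)) A' M' y'" and
    pot': "real r * real (card M) + real r * ?w (T - j) * (\<Sum>e\<in>edges G. y e)
      - B * load_excess c y - B' * danger_excess c' ?s A y
      - (real (card (verts G)) * (\<epsilon>\<^sup>2 * K + B * load_variance) + real (card (edges G)) * (B' * danger_variance))
    \<le> real r * real (card M') + real r * ?w (T - Suc j) * (\<Sum>e\<in>edges G. y' e)
      - B * load_excess c y' - B' * danger_excess c' s1 A' y'"
    unfolding wrec by blast
  have err: "real (card (verts G)) * (\<epsilon>\<^sup>2 * K + B * load_variance) + real (card (edges G)) * (B' * danger_variance) \<le> ?err"
    by (rule step_error_mono[OF less_imp_le[OF eps(1)] K c(3) B'0 Yj boost(2,1)])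
  have "real (Suc j) * ?err = real j * ?err + ?err" by (simp add: distrib_right)
  then have "real r * ?w T * (real (card (edges G)) * y0) - real (Suc j) * ?err
    \<le> real r * real (card M') + real r * ?w (T - Suc j) * (\<Sum>e\<in>edges G. y' e)
      - B * load_excess c y' - B' * danger_excess c' s1 A' y'"
    using pot pot' err by linarith
  moreover have "s1 = (1 - \<epsilon>) ^ Suc j" by simp
  ultimately show ?case using st' by (intro exI[of _ A'] exI[of _ M'] exI[of _ y']) (simp only:)
qed

text \<open>After round \<open>T\<close> the remaining weight has value 0 and the penalties are
  nonnegative, so the potential is at most the number of matched vertices.\<close>

lemma nibble_matching_exists:
  fixes \<epsilon> K B B' c c' b Ym y0 :: real and Y :: "nat \<Rightarrow> real" and T :: nat
  assumes eps: "0 < \<epsilon>" "\<epsilon> * (2 * real r + K) \<le> 1 / 2" "\<epsilon> * (real g * K) < 1" and K: "0 \<le> K"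
    and Y: "\<And>j. j < T \<Longrightarrow> Y j \<le> Y (Suc j) * ((1 - \<epsilon>) ^ (r - 1) * (1 - \<epsilon> * (real g * (1 - \<epsilon>) ^ j * K)))"
    and Ym: "\<And>j. j \<le> T \<Longrightarrow> 0 \<le> Y j \<and> Y j \<le> Ym"
    and b: "1 + 1 / (real g * (1 - \<epsilon>) ^ T) \<le> b"
    and overlap: "(real g)\<^sup>2 * (\<epsilon> * Ym * ((real r)\<^sup>2 * cd + 2 * real r * cc)) \<le> 1 / 2"
    and gain: "Ym * b \<le> 1"
    and B: "\<And>x. 1 < x \<Longrightarrow> real r * x \<le> B * (max 0 (x - c))\<^sup>2" and c: "0 \<le> c" "c \<le> 1" "0 \<le> B"
    and B': "real r * Ym \<le> B'" "c' + 1 \<le> K" "0 \<le> c'"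
    and y0: "0 \<le> y0" "y0 \<le> Y 0"
    and load: "\<And>v. v \<in> verts G \<Longrightarrow> real (vertex_degree G v) * y0 \<le> c"
    and danger: "\<And>e. e \<in> edges G \<Longrightarrow> (\<Sum>S | S \<in> H \<and> e \<in> S. (y0 * (1 + 1 / real g)) ^ (card S - 1)) \<le> c'"
  shows "\<exists>M. matching G M \<and> avoiding H M \<and>
    (1 - \<epsilon> * (real r + K)) * (1 - (1 - \<epsilon>) ^ T) * (real r * real (card (edges G)) * y0)
      - real T * step_error \<epsilon> K Ym b B B' \<le> real r * real (card M)"
proof -
  obtain A M y where st: "nibble_state K ((1 - \<epsilon>) ^ T) (Y T) A M y" and pot:
    "real r * ((1 - \<epsilon> * (real r + K)) * (1 - (1 - \<epsilon>) ^ T)) * (real (card (edges G)) * y0)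
      - real T * step_error \<epsilon> K Ym b B B'
    \<le> real r * real (card M) + real r * ((1 - \<epsilon> * (real r + K)) * (1 - (1 - \<epsilon>) ^ (T - T))) * (\<Sum>e\<in>edges G. y e)
      - B * load_excess c y - B' * danger_excess c' ((1 - \<epsilon>) ^ T) A y"
    using nibble_state_iterate[OF eps K Y Ym b overlap gain B c B' y0 load danger order_refl] by blast
  have "0 \<le> Ym" using Ym[of 0] by linarith
  then have "0 \<le> B'" using B'(1) order_trans[of 0 "real r * Ym" B'] by simp
  then have "0 \<le> B * load_excess c y" "0 \<le> B' * danger_excess c' ((1 - \<epsilon>) ^ T) A y"
    using c(3) by (auto simp: load_excess_def danger_excess_def intro!: mult_nonneg_nonneg sum_nonneg)
  moreover have "1 - (1 - \<epsilon>) ^ (T - T) = 0" by simp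
  ultimately have "real r * ((1 - \<epsilon> * (real r + K)) * (1 - (1 - \<epsilon>) ^ T)) * (real (card (edges G)) * y0)
      - real T * step_error \<epsilon> K Ym b B B' \<le> real r * real (card M)"
    using pot by simp
  then have "(1 - \<epsilon> * (real r + K)) * (1 - (1 - \<epsilon>) ^ T) * (real r * real (card (edges G)) * y0)
      - real T * step_error \<epsilon> K Ym b B B' \<le> real r * real (card M)" by (simp only: mult_ac)
  then show ?thesis using st by (auto simp: nibble_state_def)
qed

end

section \<open>Choice of parameters\<close>

lemma one_minus_exp_le:
  fixes u :: real
  assumes "0 \<le> u" "u \<le> 1 / 2"
  shows "1 \<le> exp (2 * u) * (1 - u)" and "exp (- 2 * u) \<le> 1 - u"
proof -
  have "u * (2 * u) \<le> u * 1" using assms by (intro mult_left_mono) auto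
  then have "1 \<le> (1 + 2 * u) * (1 - u)" by (simp add: algebra_simps)
  also have "\<dots> \<le> exp (2 * u) * (1 - u)" using assms by (intro mult_right_mono exp_ge_add_one_self) auto
  finally show 1: "1 \<le> exp (2 * u) * (1 - u)" .
  then have "exp (- (2 * u)) * 1 \<le> exp (- (2 * u)) * (exp (2 * u) * (1 - u))"
    by (intro mult_left_mono) auto
  also have "\<dots> = 1 - u" by (simp add: mult.assoc[symmetric] mult_exp_exp)
  finally show "exp (- 2 * u) \<le> 1 - u" by simp
qed

lemma one_plus_inverse_power_le:
  assumes "0 < g" "k \<le> g"
  shows "(1 + 1 / real g) ^ k \<le> 3"
proof -
  have "(1 + 1 / real g) ^ k \<le> (1 + 1 / real g) ^ g" using assms by (intro power_increasing) auto
  also have "\<dots> \<le> exp (1 / real g) ^ g" by (intro power_mono exp_ge_add_one_self) auto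
  also have "\<dots> = exp 1" using assms by (simp flip: exp_of_nat_mult)
  also have "\<dots> \<le> 3" by (rule exp_le)
  finally show ?thesis .
qed

text \<open>Writing \<open>x = 1 + u * \<delta>\<close>, the excess over \<open>1 - \<delta>\<close>
  is \<open>\<delta> * (1 + u)\<close>, while \<open>x \<le> 1 + u \<le> (1 + u)^2\<close>. With
  \<open>\<delta> = \<epsilon>\<close> this determines the price \<open>r / \<epsilon>^2\<close> of
  load excess.\<close>

lemma excess_penalty:
  fixes \<delta> x R :: real
  assumes "0 < \<delta>" "\<delta> \<le> 1" "1 < x" "0 \<le> R"
  shows "R * x \<le> R / \<delta>\<^sup>2 * (max 0 (x - (1 - \<delta>)))\<^sup>2"
proof -
  define u where "u = (x - 1) / \<delta>"
  have u: "0 \<le> u" "x = 1 + u * \<delta>" using assms by (auto simp: u_def)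
  have "u * \<delta> \<le> u * 1" using u assms by (intro mult_left_mono) auto
  then have "x \<le> 1 + u" using u by simp
  also have "\<dots> \<le> (1 + u)\<^sup>2" using u by (intro self_le_power) auto
  also have "\<dots> = (max 0 (x - (1 - \<delta>)) / \<delta>)\<^sup>2"
  proof -
    have "max 0 (x - (1 - \<delta>)) = \<delta> * (1 + u)" using u assms by (simp add: algebra_simps)
    then show ?thesis using assms by simp
  qed
  finally have "R * x \<le> R * (max 0 (x - (1 - \<delta>)) / \<delta>)\<^sup>2" using assms by (intro mult_left_mono) auto
  then show ?thesis by (simp add: power_divide)
qed

lemma one_minus_mult_ge:
  fixes x y :: real
  assumes "0 \<le> x" "x \<le> 1" "0 \<le> y"
  shows "1 - (x + y) \<le> (1 - x) * (1 - y)"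
  using assms by (simp add: algebra_simps)

context bounded_configuration
begin

lemma sum_vertex_degree: "(\<Sum>v\<in>verts G. real (vertex_degree G v)) = real r * real (card (edges G))"
proof -
  have "real (vertex_degree G v) = load (\<lambda>_. 1) v" for v
    by (simp add: vertex_degree_def load_def)
  then show ?thesis using sum_load[of "\<lambda>_. 1"] by simp
qed

text \<open>Grouped by size, the at most \<open>C * D ^ (i - 1)\<close> configurations of size
  \<open>i\<close> meet weights \<open>(1 / D) ^ (i - 1)\<close>, so every size contributes equally.
  The 3 bounds the powers of \<open>1 + 1 / g\<close>, and there are fewer than \<open>g\<close>
  sizes.\<close>

lemma initial_danger_le:
  fixes D y0 C :: real
  assumes e: "e \<in> edges G" and D: "0 < D" and y0: "0 \<le> y0" "y0 \<le> 1 / D"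
    and deg: "\<And>i. 2 \<le> i \<Longrightarrow> i \<le> g \<Longrightarrow> real (size_degree H i e) \<le> C * D ^ (i - 1)" and C: "0 \<le> C"
  shows "(\<Sum>S | S \<in> H \<and> e \<in> S. (y0 * (1 + 1 / real g)) ^ (card S - 1)) \<le> 3 * real g * C"
proof -
  let ?z = "y0 * (1 + 1 / real g)"
  have "(\<Sum>S | S \<in> H \<and> e \<in> S. ?z ^ (card S - 1))
      = (\<Sum>i\<in>{2..g}. \<Sum>S | S \<in> {S. S \<in> H \<and> e \<in> S} \<and> card S = i. ?z ^ (card S - 1))"
    using finite_H card_config_ge card_config_le by (subst sum.group) auto
  also have "\<dots> = (\<Sum>i\<in>{2..g}. real (size_degree H i e) * ?z ^ (i - 1))"
  proof (rule sum.cong[OF refl])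
    fix i
    have "(\<Sum>S | S \<in> {S. S \<in> H \<and> e \<in> S} \<and> card S = i. ?z ^ (card S - 1))
       = (\<Sum>S | S \<in> {S. S \<in> H \<and> e \<in> S} \<and> card S = i. ?z ^ (i - 1))" by (rule sum.cong) auto
    moreover have "{S. S \<in> {S. S \<in> H \<and> e \<in> S} \<and> card S = i} = {S \<in> H. card S = i \<and> e \<in> S}" by blast
    ultimately show "(\<Sum>S | S \<in> {S. S \<in> H \<and> e \<in> S} \<and> card S = i. ?z ^ (card S - 1))
      = real (size_degree H i e) * ?z ^ (i - 1)" by (simp add: size_degree_def)
  qed
  also have "\<dots> \<le> (\<Sum>i\<in>{2..g}. 3 * C)"
  proof (rule sum_mono)
    fix i assume "i \<in> {2..g}"
    then have i: "2 \<le> i" "i \<le> g" by auto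
    have "?z ^ (i - 1) = y0 ^ (i - 1) * (1 + 1 / real g) ^ (i - 1)" by (rule power_mult_distrib)
    also have "\<dots> \<le> (1 / D) ^ (i - 1) * 3"
      using y0 i g_ge_2 D by (intro mult_mono power_mono one_plus_inverse_power_le) auto
    finally have z: "?z ^ (i - 1) \<le> (1 / D) ^ (i - 1) * 3" .
    have z0: "0 \<le> ?z" using y0 by simp
    have "real (size_degree H i e) * ?z ^ (i - 1) \<le> (C * D ^ (i - 1)) * ((1 / D) ^ (i - 1) * 3)"
      using deg[OF i] z z0 C D by (intro mult_mono) auto
    also have "\<dots> = 3 * C" using D by (simp add: power_divide)
    finally show "real (size_degree H i e) * ?z ^ (i - 1) \<le> 3 * C" .
  qed
  also have "\<dots> = 3 * C * real (card {2..g})" by simp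
  also have "\<dots> \<le> 3 * C * real g" using C by (intro mult_left_mono) auto
  finally show ?thesis by (simp add: mult_ac)
qed

end

text \<open>The parameters are \<open>\<epsilon> = D powr (- 2 * a)\<close> and \<open>K = \<beta> * ln D / g\<close>, and all weights stay below
  \<open>D powr (- 1 + 9 / 4 * \<beta>)\<close>; both codegree bounds are weakened to \<open>ln D ^ m\<close>. In the last block, each
  source of loss takes at most an eighth of the permitted \<open>D powr (- a)\<close>, with \<open>2 * a * ln D * D powr (2 * a)\<close>
  an upper bound on the number of rounds.\<close>

definition large_degree :: "nat \<Rightarrow> nat \<Rightarrow> real \<Rightarrow> real \<Rightarrow> nat \<Rightarrow> real \<Rightarrow> bool" where
  "large_degree r g \<beta> a m D \<longleftrightarrow> 1 < D \<and> 1 \<le> ln D \<and> 3 \<le> D powr a \<and> D powr (- \<beta>) \<le> 1 / 2 \<and>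
     D powr (- 2 * a) * (2 * real r + \<beta> * ln D / real g) \<le> 1 / 2 \<and>
     D powr (- 2 * a) * (\<beta> * ln D) \<le> 1 / 2 \<and>
     (real g)\<^sup>2 * (D powr (- 2 * a) * D powr (- 1 + 9 / 4 * \<beta>) * ((real r)\<^sup>2 * ln D ^ m + 2 * real r * ln D ^ m)) \<le> 1 / 2 \<and>
     D powr (- 1 + 9 / 4 * \<beta>) * (2 * D powr (4 * a)) \<le> 1 \<and>
     1 \<le> \<beta> * ln D / (4 * real g) \<and>
     1 \<le> a * ln D * D powr (2 * a) / 2 \<and>
     D powr (- 2 * a) * (real r + \<beta> * ln D / real g) \<le> D powr (- a) / 8 \<and>
     D powr (- 3 / 2 * a) \<le> D powr (- a) / 8 \<and>
     D powr (- 2 * a) \<le> D powr (- a) / 8 \<and>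
     2 * D powr (- \<beta>) \<le> D powr (- a) / 8 \<and>
     2 * a * ln D * D powr (2 * a) * ((D powr (- 2 * a))\<^sup>2 * (\<beta> * ln D / real g)) \<le> D powr (- a) / 8 \<and>
     2 * a * ln D * D powr (2 * a) * (real r / (D powr (- 2 * a))\<^sup>2 * (2 * (D powr (- 2 * a) * (2 * real r + \<beta> * ln D / real g)) *
       (real r * ln D ^ m + ln D ^ m) * D powr (- 1 + 9 / 4 * \<beta>))) \<le> D powr (- a) / 8 \<and>
     2 * a * ln D * D powr (2 * a) * (D * (real r * D powr (- 1 + 9 / 4 * \<beta>) * (6 * ((real g)\<^sup>2 *
       (D powr (- 2 * a) * D powr (- 1 + 9 / 4 * \<beta>) * ((real r)\<^sup>2 * ln D ^ m + 2 * real r * ln D ^ m))) *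
       (\<beta> * ln D / real g)\<^sup>2))) \<le> D powr (- a) / 8 \<and>
     2 * a * ln D * D powr (2 * a) * (D * (real r * D powr (- 1 + 9 / 4 * \<beta>) * (4 * real g * (real r * ln D ^ m + 2) *
       (D powr (- 1 + 9 / 4 * \<beta>) * (2 * D powr (4 * a))) * (\<beta> * ln D / real g)))) \<le> D powr (- a) / 8"

lemma eventually_large_degree:
  assumes "0 < r" "0 < g" "0 < \<beta>" "\<beta> \<le> 1 / 16" "0 < a" "32 * a \<le> \<beta>"
  shows "eventually (large_degree r g \<beta> a m) at_top"
proof -
  define R Q where "R = real r" and "Q = real g"
  have pos: "0 < R" "0 < Q" "0 < \<beta>" "0 < a" "0 < a * 2" using assms by (auto simp: R_def Q_def)
  \<comment> \<open>The comparisons of exponents of \<open>D\<close> behind, in this order, the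
    bound on gains, the load variance, the overlap of hazards, the drift and the variance of the
    dangers, and the irregularity of the degrees.\<close>
  have e: "9 / 4 * \<beta> + 4 * a < 1" "9 / 4 * \<beta> + 5 * a < 1" "9 / 4 * \<beta> < 1" "9 / 2 * \<beta> + a < 1" "9 / 2 * \<beta> + 7 * a < 1" "a < \<beta>" using assms by auto
  show ?thesis
    unfolding large_degree_def eventually_conj_iff R_def[symmetric] Q_def[symmetric]
  proof (intro conjI)
    show "\<forall>\<^sub>F D::real in at_top. 1 < D" by real_asymp
    show "\<forall>\<^sub>F D::real in at_top. 1 \<le> ln D" by real_asymp
    show "\<forall>\<^sub>F D in at_top. 3 \<le> D powr a" using pos by real_asymp
    show "\<forall>\<^sub>F D in at_top. D powr (- \<beta>) \<le> 1 / 2" using pos by real_asymp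
    show "\<forall>\<^sub>F D in at_top. D powr (- 2 * a) * (2 * R + \<beta> * ln D / Q) \<le> 1 / 2" using pos by real_asymp
    show "\<forall>\<^sub>F D in at_top. D powr (- 2 * a) * (\<beta> * ln D) \<le> 1 / 2" using pos by real_asymp
    show "\<forall>\<^sub>F D in at_top. Q\<^sup>2 * (D powr (- 2 * a) * D powr (- 1 + 9 / 4 * \<beta>) *
        (R\<^sup>2 * ln D ^ m + 2 * R * ln D ^ m)) \<le> 1 / 2" using pos e by real_asymp
    show "\<forall>\<^sub>F D in at_top. D powr (- 1 + 9 / 4 * \<beta>) * (2 * D powr (4 * a)) \<le> 1" using pos e by real_asymp
    show "\<forall>\<^sub>F D in at_top. 1 \<le> \<beta> * ln D / (4 * Q)" using pos by real_asymp
    show "\<forall>\<^sub>F D in at_top. 1 \<le> a * ln D * D powr (2 * a) / 2" using pos by real_asymp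
    show "\<forall>\<^sub>F D in at_top. D powr (- 2 * a) * (R + \<beta> * ln D / Q) \<le> D powr (- a) / 8" using pos by real_asymp
    show "\<forall>\<^sub>F D in at_top. D powr (- 3 / 2 * a) \<le> D powr (- a) / 8" using pos by real_asymp
    show "\<forall>\<^sub>F D in at_top. D powr (- 2 * a) \<le> D powr (- a) / 8" using pos by real_asymp
    show "\<forall>\<^sub>F D in at_top. 2 * D powr (- \<beta>) \<le> D powr (- a) / 8" using pos e by real_asymp
    show "\<forall>\<^sub>F D in at_top. 2 * a * ln D * D powr (2 * a) * ((D powr (- 2 * a))\<^sup>2 * (\<beta> * ln D / Q)) \<le> D powr (- a) / 8"
      using pos by real_asymp
    show "\<forall>\<^sub>F D in at_top. 2 * a * ln D * D powr (2 * a) * (R / (D powr (- 2 * a))\<^sup>2 *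
        (2 * (D powr (- 2 * a) * (2 * R + \<beta> * ln D / Q)) * (R * ln D ^ m + ln D ^ m) *
        D powr (- 1 + 9 / 4 * \<beta>))) \<le> D powr (- a) / 8"
      using pos e by real_asymp
    show "\<forall>\<^sub>F D in at_top. 2 * a * ln D * D powr (2 * a) * (D * (R * D powr (- 1 + 9 / 4 * \<beta>) * (6 * (Q\<^sup>2 *
       (D powr (- 2 * a) * D powr (- 1 + 9 / 4 * \<beta>) * (R\<^sup>2 * ln D ^ m + 2 * R * ln D ^ m))) *
       (\<beta> * ln D / Q)\<^sup>2))) \<le> D powr (- a) / 8"
      using pos e by real_asymp
    show "\<forall>\<^sub>F D in at_top. 2 * a * ln D * D powr (2 * a) * (D * (R * D powr (- 1 + 9 / 4 * \<beta>) *
       (4 * Q * (R * ln D ^ m + 2) * (D powr (- 1 + 9 / 4 * \<beta>) * (2 * D powr (4 * a))) * (\<beta> * ln D / Q)))) \<le> D powr (- a) / 8"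
      using pos e by real_asymp
  qed
qed

section \<open>Near-perfect matchings for large \<open>D\<close>\<close>

context bounded_configuration
begin

lemma almost_perfect_matching:
  fixes D \<beta> a :: real
  assumes large: "large_degree r g \<beta> a m D" and \<beta>: "0 < \<beta>" and a: "0 < a" "16 * real r * a = \<beta>"
    and cd: "cd = ln D ^ m" and cc: "cc = ln D ^ m"
    and regular: "approx_regular (D powr (- \<beta>)) D G"
    and deg: "\<And>e i. e \<in> edges G \<Longrightarrow> 2 \<le> i \<Longrightarrow> i \<le> g \<Longrightarrow>
      real (size_degree H i e) \<le> \<beta> / (4 * (real g)\<^sup>2) * D ^ (i - 1) * ln D"
  shows "\<exists>M. matching G M \<and> avoiding H M \<and>
    real (card (verts G)) / real r * (1 - D powr (- a)) \<le> real (card M)"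
proof -
  define \<epsilon> where "\<epsilon> = D powr (- 2 * a)"
  define K where "K = \<beta> * ln D / real g"
  define Ym where "Ym = D powr (- 1 + 9 / 4 * \<beta>)"
  define b where "b = 2 * D powr (4 * a)"
  \<comment> \<open>As \<open>D powr (2 * a) = 1 / \<epsilon>\<close>, this makes
    \<open>\<epsilon> * T\<close> about \<open>3 / 2 * a * ln D\<close>: the final fraction of
    vertices is at most \<open>D powr (- 3 / 2 * a)\<close>, polynomially below the permitted
    loss.\<close>
  define T where "T = nat \<lceil>3 / 2 * a * ln D * D powr (2 * a)\<rceil>"
  define t where "t = D powr (- \<beta>)"
  \<comment> \<open>Degrees are at most \<open>(1 + t) * D\<close>, so every initial load is at most
    \<open>1 - \<epsilon>\<close>, the soft threshold for loads.\<close>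
  define y0 where "y0 = (1 - \<epsilon>) / ((1 + t) * D)"
  \<comment> \<open>The power compensates for the vertices of an edge other than the one at which
    the load is kept constant; the exponential accumulates the losses to blockers and never exceeds
    \<open>D powr (2 * \<beta>)\<close>.\<close>
  define Y where "Y j = 1 / D * (1 / ((1 - \<epsilon>) ^ j)) ^ (r - 1) * exp (2 * (\<beta> * ln D) * (1 - (1 - \<epsilon>) ^ j))" for j
  define S where "S = 2 * a * ln D * D powr (2 * a)"
  define x where "x = D powr (- a)"
  define V where "V = real (card (verts G))"
  note L = large[unfolded large_degree_def, folded \<epsilon>_def K_def Ym_def b_def t_def S_def x_def]
  have D: "1 < D" "0 < D" "1 \<le> ln D" using L by auto
  have g0: "0 < real g" and r0: "0 < real r" using g_ge_2 r_ge_2 by auto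
  have K0: "0 \<le> K" unfolding K_def using \<beta> D g0 by simp
  have K1: "1 \<le> K / 4" using L unfolding K_def by (simp add: field_simps)
  have gK: "real g * K = \<beta> * ln D" unfolding K_def using g0 by simp
  have \<epsilon>0: "0 < \<epsilon>" unfolding \<epsilon>_def using D by simp
  have e2: "\<epsilon> * (2 * real r + K) \<le> 1 / 2" using L by blast
  have e3: "\<epsilon> * (real g * K) \<le> 1 / 2" unfolding gK using L by blast
  have "\<epsilon> * 4 \<le> \<epsilon> * (2 * real r + K)" using r_ge_2 K0 \<epsilon>0 by (intro mult_left_mono) auto
  then have \<epsilon>1: "\<epsilon> \<le> 1 / 8" using e2 by linarith
  have \<epsilon>inv: "D powr (2 * a) * \<epsilon> = 1" unfolding \<epsilon>_def using D by (simp flip: powr_add)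
  have al: "0 < a * ln D" using a D by simp
  have lnD: "exp (ln D * c) = D powr c" for c using D by (simp add: powr_def mult.commute)
  have s0: "0 < (1 - \<epsilon>) ^ j" "(1 - \<epsilon>) ^ j \<le> 1" for j using \<epsilon>0 \<epsilon>1 by (auto intro!: power_le_one)
  have T0: "3 / 2 * a * ln D * D powr (2 * a) \<le> real T" and T1: "real T \<le> 3 / 2 * a * ln D * D powr (2 * a) + 1"
  proof -
    have "0 \<le> 3 / 2 * a * ln D * D powr (2 * a)" using a D by simp
    then show "3 / 2 * a * ln D * D powr (2 * a) \<le> real T" "real T \<le> 3 / 2 * a * ln D * D powr (2 * a) + 1"
      unfolding T_def by linarith+
  qed
  have TS: "real T \<le> S"
  proof -
    have "1 \<le> a * ln D * D powr (2 * a) / 2" using L by blast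
    then show ?thesis using T1 unfolding S_def by linarith
  qed
  have \<epsilon>T: "3 / 2 * (a * ln D) \<le> \<epsilon> * real T" "\<epsilon> * real T \<le> 3 / 2 * (a * ln D) + \<epsilon>"
  proof -
    have eq: "\<epsilon> * (3 / 2 * a * ln D * D powr (2 * a)) = 3 / 2 * (a * ln D)"
    proof -
      have "\<epsilon> * (3 / 2 * a * ln D * D powr (2 * a)) = 3 / 2 * (a * ln D) * (D powr (2 * a) * \<epsilon>)"
        by (simp only: mult_ac)
      then show ?thesis unfolding \<epsilon>inv by simp
    qed
    show "3 / 2 * (a * ln D) \<le> \<epsilon> * real T"
      using mult_left_mono[OF T0 less_imp_le[OF \<epsilon>0]] unfolding eq .
    show "\<epsilon> * real T \<le> 3 / 2 * (a * ln D) + \<epsilon>"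
      using mult_left_mono[OF T1 less_imp_le[OF \<epsilon>0]] unfolding distrib_left eq by simp
  qed
  have sT_upper: "(1 - \<epsilon>) ^ T \<le> D powr (- 3 / 2 * a)"
  proof -
    have "(1 - \<epsilon>) ^ T \<le> exp (- \<epsilon>) ^ T"
      using \<epsilon>1 exp_ge_add_one_self[of "- \<epsilon>"] by (intro power_mono) auto
    also have "\<dots> = exp (- (\<epsilon> * real T))" by (simp add: mult.commute flip: exp_of_nat_mult)
    also have "\<dots> \<le> exp (ln D * (- 3 / 2 * a))" using \<epsilon>T(1) by (simp add: mult_ac)
    finally show ?thesis unfolding lnD .
  qed
  \<comment> \<open>Estimating \<open>1 - \<epsilon>\<close> by
    \<open>exp (- 2 * \<epsilon>)\<close> doubles the exponent to \<open>3 * a\<close>; rounding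
    \<open>T\<close> up costs at most the factor \<open>exp 1\<close>, which is at most
    \<open>D powr a\<close>.\<close>
  have sT_lower: "1 / (1 - \<epsilon>) ^ T \<le> D powr (4 * a)"
  proof -
    have "exp (- (3 * (a * ln D) + 1)) \<le> exp (- (2 * (\<epsilon> * real T)))" using \<epsilon>T(2) \<epsilon>1 by simp
    also have "\<dots> = exp (- 2 * \<epsilon>) ^ T" by (simp add: mult_ac flip: exp_of_nat_mult)
    also have "\<dots> \<le> (1 - \<epsilon>) ^ T"
      using one_minus_exp_le(2)[of \<epsilon>] \<epsilon>0 \<epsilon>1 by (intro power_mono) auto
    finally have "1 / (1 - \<epsilon>) ^ T \<le> 1 / exp (- (3 * (a * ln D) + 1))"
      using s0 by (intro divide_left_mono) auto
    also have "\<dots> = exp (3 * (a * ln D) + 1)" by (simp only: exp_minus inverse_eq_divide) simp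
    also have "\<dots> = exp 1 * exp (ln D * (3 * a))" by (simp add: exp_add mult_ac)
    also have "\<dots> \<le> D powr a * exp (ln D * (3 * a))"
    proof (rule mult_right_mono)
      have "3 \<le> D powr a" using L by blast
      then show "exp 1 \<le> D powr a" using exp_le by linarith
    qed simp
    also have "\<dots> = D powr (4 * a)" unfolding lnD by (simp flip: powr_add)
    finally show ?thesis .
  qed
  \<comment> \<open>Since \<open>(1 - (1 - \<epsilon>) * s) - (1 - s) = \<epsilon> * s\<close>, the
    exponential in \<open>Y\<close> gains exactly \<open>exp (2 * u)\<close> per round, which
    compensates the factor \<open>1 - u\<close>.\<close>
  have Ystep: "Y j \<le> Y (Suc j) * ((1 - \<epsilon>) ^ (r - 1) * (1 - \<epsilon> * (real g * (1 - \<epsilon>) ^ j * K)))" for j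
  proof -
    define s where "s = (1 - \<epsilon>) ^ j"
    define u where "u = s * (\<epsilon> * (real g * K))"
    have s: "0 < s" "s \<le> 1" unfolding s_def using s0 by auto
    have "u \<le> \<epsilon> * (real g * K)" unfolding u_def using s \<epsilon>0 K0 by (intro mult_left_le_one_le) auto
    then have u_half: "u \<le> 1 / 2" using e3 by linarith
    have "0 \<le> u" unfolding u_def using s \<epsilon>0 K0 by simp
    note u = this u_half
    have Es: "exp (2 * (\<beta> * ln D) * (1 - (1 - \<epsilon>) * s)) = exp (2 * (\<beta> * ln D) * (1 - s)) * exp (2 * u)"
      unfolding u_def gK by (simp add: mult_exp_exp algebra_simps)
    have Ss: "(1 / ((1 - \<epsilon>) * s)) ^ (r - 1) * (1 - \<epsilon>) ^ (r - 1) = (1 / s) ^ (r - 1)"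
      using \<epsilon>1 by (simp flip: power_mult_distrib)
    have "Y j = 1 / D * (1 / s) ^ (r - 1) * exp (2 * (\<beta> * ln D) * (1 - s))"
      unfolding Y_def s_def ..
    also have "\<dots> \<le> 1 / D * (1 / s) ^ (r - 1) * exp (2 * (\<beta> * ln D) * (1 - s)) * (exp (2 * u) * (1 - u))"
      using mult_left_mono[OF one_minus_exp_le(1)[OF u], of "1 / D * (1 / s) ^ (r - 1) * exp (2 * (\<beta> * ln D) * (1 - s))"]
        s D by simp
    also have "\<dots> = Y (Suc j) * ((1 - \<epsilon>) ^ (r - 1) * (1 - u))"
      unfolding Y_def power_Suc s_def[symmetric] Es Ss[symmetric] by (simp only: mult_ac)
    finally show ?thesis by (simp add: u_def s_def mult_ac)
  qed
  \<comment> \<open>Origin of the exponent \<open>9 / 4 * \<beta>\<close>: because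
    \<open>16 * r * a = \<beta>\<close>, the power contributes at most \<open>\<beta> / 4\<close>,
    and the exponential at most \<open>2 * \<beta>\<close>.\<close>
  have Ybound: "0 \<le> Y j \<and> Y j \<le> Ym" if "j \<le> T" for j
  proof
    show "0 \<le> Y j" unfolding Y_def using D s0[of j] by simp
    have "(1 - \<epsilon>) ^ T \<le> (1 - \<epsilon>) ^ j" using \<epsilon>0 \<epsilon>1 that by (intro power_decreasing) auto
    then have "1 / (1 - \<epsilon>) ^ j \<le> 1 / (1 - \<epsilon>) ^ T" using s0[of T] s0[of j] by (intro divide_left_mono) auto
    then have "1 / (1 - \<epsilon>) ^ j \<le> D powr (4 * a)" using sT_lower by linarith
    then have "(1 / (1 - \<epsilon>) ^ j) ^ (r - 1) \<le> (D powr (4 * a)) ^ (r - 1)"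
      using s0[of j] by (intro power_mono) auto
    also have "\<dots> = D powr (4 * a * real (r - 1))" using D by (simp add: powr_power mult.commute)
    also have "\<dots> \<le> D powr (\<beta> / 4)"
    proof (rule powr_mono)
      have "4 * a * real (r - 1) \<le> 4 * a * real r" using a by (intro mult_left_mono) auto
      then show "4 * a * real (r - 1) \<le> \<beta> / 4" using a(2) by (simp add: mult_ac)
    qed (use D in simp)
    finally have 1: "(1 / (1 - \<epsilon>) ^ j) ^ (r - 1) \<le> D powr (\<beta> / 4)" .
    have "2 * (\<beta> * ln D) * (1 - (1 - \<epsilon>) ^ j) \<le> 2 * (\<beta> * ln D)"
      using s0[of j] \<beta> D by (intro mult_left_le) auto
    then have "exp (2 * (\<beta> * ln D) * (1 - (1 - \<epsilon>) ^ j)) \<le> exp (ln D * (2 * \<beta>))" by (simp add: mult_ac)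
    then have 2: "exp (2 * (\<beta> * ln D) * (1 - (1 - \<epsilon>) ^ j)) \<le> D powr (2 * \<beta>)" unfolding lnD .
    have "1 / D = D powr (- 1)" using D by (simp add: powr_minus_divide)
    then have "Y j \<le> D powr (- 1) * D powr (\<beta> / 4) * D powr (2 * \<beta>)"
      unfolding Y_def using 1 2 s0[of j] by (intro mult_mono) auto
    also have "\<dots> = Ym"
      unfolding Ym_def powr_add[symmetric] by (rule arg_cong[where f = "\<lambda>z. D powr z"]) simp
    finally show "Y j \<le> Ym" .
  qed
  have D4: "1 \<le> D powr (4 * a)" using D a by (simp add: ge_one_powr_ge_zero)
  have bb: "1 + 1 / (real g * (1 - \<epsilon>) ^ T) \<le> b"
  proof -
    have "1 / (real g * (1 - \<epsilon>) ^ T) \<le> 1 / (1 - \<epsilon>) ^ T"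
      using g_ge_2 s0[of T] by (intro divide_left_mono) auto
    then show ?thesis unfolding b_def using sT_lower D4 by linarith
  qed
  have Ym0: "0 \<le> Ym" unfolding Ym_def by simp
  have overlap: "(real g)\<^sup>2 * (\<epsilon> * Ym * ((real r)\<^sup>2 * cd + 2 * real r * cc)) \<le> 1 / 2"
    unfolding cd cc using L by blast
  have gain: "Ym * b \<le> 1" using L by blast
  have B0: "0 \<le> real r / \<epsilon>\<^sup>2" by simp
  have pen: "real r * z \<le> real r / \<epsilon>\<^sup>2 * (max 0 (z - (1 - \<epsilon>)))\<^sup>2" if "1 < z" for z
    using that \<epsilon>0 \<epsilon>1 by (intro excess_penalty) auto
  have t: "0 < t" "t \<le> 1 / 2" unfolding t_def using L D by (auto simp: t_def)
  have y00: "0 \<le> y0" unfolding y0_def using \<epsilon>1 t D by simp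
  have y0D: "y0 \<le> 1 / D"
  proof -
    have "(1 - \<epsilon>) / ((1 + t) * D) \<le> 1 / (1 * D)"
      using \<epsilon>0 t D by (intro frac_le) auto
    then show ?thesis unfolding y0_def by simp
  qed
  have y0Y: "y0 \<le> Y 0" using y0D unfolding Y_def by simp
  have degv: "(1 - t) * D \<le> real (vertex_degree G v)" "real (vertex_degree G v) \<le> (1 + t) * D"
    if "v \<in> verts G" for v using regular that unfolding approx_regular_def t_def by auto
  have load: "real (vertex_degree G v) * y0 \<le> 1 - \<epsilon>" if "v \<in> verts G" for v
  proof -
    have "real (vertex_degree G v) * y0 \<le> (1 + t) * D * y0" by (rule mult_right_mono[OF degv(2)[OF that] y00])
    also have "\<dots> = 1 - \<epsilon>" unfolding y0_def using t D by simp
    finally show ?thesis .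
  qed
  \<comment> \<open>The constant \<open>\<beta> / (4 * g^2)\<close> in the degree condition puts
    initial dangers at \<open>3 / 4\<close> of the limit \<open>K\<close>; the remaining quarter is
    at least 1, the gap that the danger penalty requires.\<close>
  have danger: "(\<Sum>S | S \<in> H \<and> e \<in> S. (y0 * (1 + 1 / real g)) ^ (card S - 1)) \<le> 3 * K / 4"
    if e: "e \<in> edges G" for e
  proof -
    have "(\<Sum>S | S \<in> H \<and> e \<in> S. (y0 * (1 + 1 / real g)) ^ (card S - 1))
        \<le> 3 * real g * (\<beta> / (4 * (real g)\<^sup>2) * ln D)"
    proof (rule initial_danger_le[OF e D(2) y00 y0D])
      show "real (size_degree H i e) \<le> \<beta> / (4 * (real g)\<^sup>2) * ln D * D ^ (i - 1)" if "2 \<le> i" "i \<le> g" for i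
        using deg[OF e that] by (simp add: mult_ac)
      show "0 \<le> \<beta> / (4 * (real g)\<^sup>2) * ln D" using \<beta> D by simp
    qed
    also have "\<dots> = 3 * K / 4" unfolding K_def using g0 by (simp add: power2_eq_square)
    finally show ?thesis .
  qed
  define Err where "Err = step_error \<epsilon> K Ym b (real r / \<epsilon>\<^sup>2) (real r * Ym)"
  obtain M where M: "matching G M" "avoiding H M" and
    big: "(1 - \<epsilon> * (real r + K)) * (1 - (1 - \<epsilon>) ^ T) * (real r * real (card (edges G)) * y0) - real T * Err
      \<le> real r * real (card M)"
  proof -
    have "\<exists>M. matching G M \<and> avoiding H M \<and>
      (1 - \<epsilon> * (real r + K)) * (1 - (1 - \<epsilon>) ^ T) * (real r * real (card (edges G)) * y0) - real T * Err
        \<le> real r * real (card M)"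
      unfolding Err_def
    proof (rule nibble_matching_exists[where Y = Y and c = "1 - \<epsilon>" and c' = "3 * K / 4",
          OF \<epsilon>0 e2 _ K0 Ystep Ybound bb overlap gain pen])
      show "\<epsilon> * (real g * K) < 1" using e3 by linarith
      show "3 * K / 4 + 1 \<le> K" using K1 by linarith
      show "real (vertex_degree G v) * y0 \<le> 1 - \<epsilon>" if "v \<in> verts G" for v by (rule load[OF that])
      show "(\<Sum>S | S \<in> H \<and> e \<in> S. (y0 * (1 + 1 / real g)) ^ (card S - 1)) \<le> 3 * K / 4"
        if "e \<in> edges G" for e by (rule danger[OF that])
    qed (use \<epsilon>0 \<epsilon>1 B0 K0 y00 y0Y in auto)
    then show ?thesis using that by blast
  qed
  have V0: "0 \<le> V" unfolding V_def by simp
  have edges_lower: "V * ((1 - t) * D) \<le> real r * real (card (edges G))"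
  proof -
    have "V * ((1 - t) * D) = (\<Sum>v\<in>verts G. (1 - t) * D)" by (simp add: V_def)
    also have "\<dots> \<le> (\<Sum>v\<in>verts G. real (vertex_degree G v))" by (rule sum_mono[OF degv(1)])
    finally show ?thesis unfolding sum_vertex_degree .
  qed
  \<comment> \<open>The factor \<open>1 + t \<le> 2\<close> is absorbed by
    \<open>r \<ge> 2\<close>.\<close>
  have edges_upper: "real (card (edges G)) \<le> V * D"
  proof -
    have "(\<Sum>v\<in>verts G. real (vertex_degree G v)) \<le> (\<Sum>v\<in>verts G. (1 + t) * D)" by (rule sum_mono[OF degv(2)])
    then have "real r * real (card (edges G)) \<le> V * ((1 + t) * D)" unfolding sum_vertex_degree by (simp add: V_def)
    also have "\<dots> \<le> V * (2 * D)" using t D V0 by (intro mult_left_mono mult_right_mono) auto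
    finally have "real r * real (card (edges G)) \<le> 2 * (V * D)" by simp
    moreover have "2 * real (card (edges G)) \<le> real r * real (card (edges G))"
      using r_ge_2 by (intro mult_right_mono) auto
    ultimately show ?thesis by linarith
  qed
  define x1 where "x1 = \<epsilon> * (real r + K)"
  define x2 where "x2 = D powr (- 3 / 2 * a)"
  have xs: "x1 \<le> x / 8" "x2 \<le> x / 8" "\<epsilon> \<le> x / 8" "2 * t \<le> x / 8"
    unfolding x1_def x2_def using L by blast+
  have x01: "0 \<le> x" "x \<le> 1" unfolding x_def using D a powr_mono[of "- a" 0 D] by auto
  have x1: "0 \<le> x1" unfolding x1_def using \<epsilon>0 K0 by simp
  have x2: "0 \<le> x2" unfolding x2_def by simp
  \<comment> \<open>Four losses of at most \<open>x / 8\<close> each: conflicts \<open>x1\<close>,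
    vertices left at the end \<open>x2\<close>, the initial slack \<epsilon> in the loads, and
    \<open>2 * t\<close> for irregular degrees. The other half of \<open>x\<close> is left for the
    accumulated error.\<close>
  have main: "V * (1 - x / 2) \<le> (1 - x1) * (1 - (1 - \<epsilon>) ^ T) * (real r * real (card (edges G)) * y0)"
  proof -
    have "(1 - 2 * t) * (1 + t) \<le> 1 - t" using t by (simp add: algebra_simps)
    then have "1 - 2 * t \<le> (1 - t) / (1 + t)" using t by (simp add: pos_le_divide_eq)
    then have "(1 - \<epsilon>) * (1 - 2 * t) \<le> (1 - \<epsilon>) * ((1 - t) / (1 + t))"
      using \<epsilon>1 by (intro mult_left_mono) auto
    also have "\<dots> = (1 - t) * D * y0" unfolding y0_def using D by simp
    finally have f: "(1 - \<epsilon>) * (1 - 2 * t) \<le> (1 - t) * D * y0" .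
    have "1 - (x1 + x2) \<le> (1 - x1) * (1 - x2)" using x1 x2 xs x01 by (intro one_minus_mult_ge) auto
    also have "\<dots> \<le> (1 - x1) * (1 - (1 - \<epsilon>) ^ T)"
      using sT_upper xs x01 unfolding x2_def by (intro mult_left_mono) auto
    finally have h: "1 - (x1 + x2) \<le> (1 - x1) * (1 - (1 - \<epsilon>) ^ T)" .
    have "1 - x / 2 \<le> 1 - ((x1 + x2) + (\<epsilon> + 2 * t))" using xs by linarith
    also have "\<dots> \<le> (1 - (x1 + x2)) * (1 - (\<epsilon> + 2 * t))"
      using x1 x2 xs x01 \<epsilon>0 t by (intro one_minus_mult_ge) auto
    also have "\<dots> \<le> (1 - (x1 + x2)) * ((1 - \<epsilon>) * (1 - 2 * t))"
      using xs x01 \<epsilon>0 \<epsilon>1 t by (intro mult_left_mono one_minus_mult_ge) auto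
    also have "\<dots> \<le> (1 - x1) * (1 - (1 - \<epsilon>) ^ T) * ((1 - t) * D * y0)"
    proof (rule mult_mono[OF h f])
      show "0 \<le> (1 - x1) * (1 - (1 - \<epsilon>) ^ T)" using h xs x01 by linarith
      show "0 \<le> (1 - \<epsilon>) * (1 - 2 * t)" using \<epsilon>1 t by simp
    qed
    finally have "V * (1 - x / 2) \<le> V * ((1 - x1) * (1 - (1 - \<epsilon>) ^ T) * ((1 - t) * D * y0))"
      using V0 by (rule mult_left_mono)
    also have "\<dots> = (1 - x1) * (1 - (1 - \<epsilon>) ^ T) * (V * ((1 - t) * D) * y0)" by (simp only: mult_ac)
    also have "\<dots> \<le> (1 - x1) * (1 - (1 - \<epsilon>) ^ T) * (real r * real (card (edges G)) * y0)"
      using edges_lower y00 xs x01 s0[of T] by (intro mult_left_mono mult_right_mono) auto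
    finally show ?thesis .
  qed
  \<comment> \<open>\<open>u1\<close> stems from completed configurations, \<open>u2\<close> from
    the load variance, \<open>u3\<close> and \<open>u4\<close> from drift and variance of the
    dangers. The last two are summed over edges, hence the extra factor \<open>D\<close>.\<close>
  have err: "real T * Err \<le> V * (x / 2)"
  proof -
    define P where "P = ln D ^ m"
    define u1 where "u1 = \<epsilon>\<^sup>2 * K"
    define u2 where "u2 = real r / \<epsilon>\<^sup>2 * (2 * (\<epsilon> * (2 * real r + K)) * (real r * P + P) * Ym)"
    define u3 where "u3 = 6 * ((real g)\<^sup>2 * (\<epsilon> * Ym * ((real r)\<^sup>2 * P + 2 * real r * P))) * K\<^sup>2"
    define u4 where "u4 = 4 * real g * (real r * P + 2) * (Ym * b) * K"
    have P: "0 \<le> P" unfolding P_def using D by simp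
    have b0: "0 \<le> b" unfolding b_def by simp
    have u: "0 \<le> u1" "0 \<le> u2" "0 \<le> u3" "0 \<le> u4"
      unfolding u1_def u2_def u3_def u4_def using P b0 K0 Ym0 \<epsilon>0 by auto
    have tb: "S * u1 \<le> x / 8" "S * u2 \<le> x / 8" "S * (D * (real r * Ym * u3)) \<le> x / 8" "S * (D * (real r * Ym * u4)) \<le> x / 8"
      unfolding u1_def u2_def u3_def u4_def P_def using L by blast+
    have "Err = V * (u1 + u2) + real (card (edges G)) * (real r * Ym * (u3 + u4))"
      unfolding Err_def step_error_def u1_def u2_def u3_def u4_def P_def V_def
      by (simp only: cd cc)
    also have "\<dots> \<le> V * (u1 + u2) + V * D * (real r * Ym * (u3 + u4))"
      using edges_upper u Ym0 by (intro add_left_mono mult_right_mono) auto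
    also have "\<dots> = V * (u1 + u2 + D * (real r * Ym * u3) + D * (real r * Ym * u4))" by (simp add: algebra_simps)
    finally have E: "Err \<le> V * (u1 + u2 + D * (real r * Ym * u3) + D * (real r * Ym * u4))" .
    have nn: "0 \<le> V * (u1 + u2 + D * (real r * Ym * u3) + D * (real r * Ym * u4))"
      using V0 u D Ym0 by (intro mult_nonneg_nonneg add_nonneg_nonneg) auto
    have "real T * Err \<le> real T * (V * (u1 + u2 + D * (real r * Ym * u3) + D * (real r * Ym * u4)))"
      using E by (rule mult_left_mono) simp
    also have "\<dots> \<le> S * (V * (u1 + u2 + D * (real r * Ym * u3) + D * (real r * Ym * u4)))"
      using TS nn by (rule mult_right_mono)
    also have "\<dots> = V * (S * u1 + S * u2 + S * (D * (real r * Ym * u3)) + S * (D * (real r * Ym * u4)))"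
      by (simp add: distrib_left mult.left_commute[of S V])
    also have "\<dots> \<le> V * (x / 2)" using tb by (intro mult_left_mono[OF _ V0]) linarith
    finally show ?thesis .
  qed
  have "V * (1 - x) = V * (1 - x / 2) - V * (x / 2)" by (simp add: algebra_simps)
  also have "\<dots> \<le> real r * real (card M)" using main err big unfolding x1_def by linarith
  finally have "V / real r * (1 - x) \<le> real (card M)" using r0 by (simp add: pos_divide_le_eq mult_ac)
  then show ?thesis using M unfolding V_def x_def by blast
qed

end

lemma size_degree_le_max:
  assumes "finite X" "e \<in> X"
  shows "size_degree H i e \<le> max_size_degree X H i"
  unfolding max_size_degree_def using assms by (intro Max_ge) auto

lemma config_codegree_le_max:
  assumes "finite_multi_hypergraph G" "v \<in> verts G" "e \<in> edges G" "v \<notin> ends G e"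
  shows "config_codegree G H v e \<le> max_config_codegree G H"
proof -
  let ?C = "{config_codegree G H v e | v e. v \<in> verts G \<and> e \<in> edges G \<and> v \<notin> ends G e}"
  have "?C \<subseteq> (\<lambda>(v, e). config_codegree G H v e) ` (verts G \<times> edges G)" by auto
  then have "finite ?C"
    by (rule finite_subset) (use assms(1) in \<open>simp add: finite_multi_hypergraph_def\<close>)
  moreover have "config_codegree G H v e \<in> insert 0 ?C" using assms by blast
  ultimately show ?thesis unfolding max_config_codegree_def by (intro Max_ge) auto
qed

theorem theorem1p9:
  fixes r g :: nat and \<beta> :: real
  assumes "2 \<le> r" and "2 \<le> g" and "0 < \<beta>" and "\<beta> \<le> 1 / (8 * real r)"
  shows "\<exists>D\<^sub>\<beta>::nat. \<forall>D::real. real D\<^sub>\<beta> \<le> D \<longrightarrow>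
    (\<forall>(G :: ('v, 'e) multi_hypergraph) (H :: 'e set set).
       finite_multi_hypergraph G \<and>
       uniform r G \<and>
       approx_regular (D powr (- \<beta>)) D G \<and>
       (\<forall>u\<in>verts G. \<forall>v\<in>verts G. u \<noteq> v \<longrightarrow> real (codegree G u v) \<le> (ln D)\<^sup>2) \<and>
       configuration_hypergraph G H \<and>
       bounded_hypergraph g H \<and>
       5 \<le> girth H \<and>
       (\<forall>i. 2 \<le> i \<and> i \<le> g \<longrightarrow>
          real (max_size_degree (edges G) H i) \<le> \<beta> / (4 * (real g)\<^sup>2) * D ^ (i - 1) * ln D) \<and>
       real (max_config_codegree G H) \<le> (ln D) ^ (2 * (g - 1)) \<longrightarrow>
       (\<exists>M. matching G M \<and> avoiding H M \<and>
          real (card M) \<ge> real (card (verts G)) / real r * (1 - D powr (- (\<beta> / (16 * real r))))))"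
proof -
  define a where "a = \<beta> / (16 * real r)"
  \<comment> \<open>Since \<open>2 \<le> g\<close>, this exponent is at least 2, so for
    \<open>1 \<le> ln D\<close> the same power also bounds the codegrees of
    \<open>G\<close>.\<close>
  define m where "m = 2 * (g - 1)"
  have r0: "0 < real r" using assms(1) by simp
  have a: "0 < a" "16 * real r * a = \<beta>" using assms(3) r0 by (auto simp: a_def)
  have "a * 32 \<le> a * (16 * real r)" using assms(1) a(1) by (intro mult_left_mono) auto
  then have a32: "32 * a \<le> \<beta>" using a(2) by (simp add: mult_ac)
  have "1 / (8 * real r) \<le> 1 / 16" using assms(1) by (intro divide_left_mono) auto
  then have \<beta>16: "\<beta> \<le> 1 / 16" using assms(4) by linarith
  have "eventually (large_degree r g \<beta> a m) at_top"
    using assms \<beta>16 a a32 by (intro eventually_large_degree) auto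
  then obtain N where N: "\<And>D. N \<le> D \<Longrightarrow> large_degree r g \<beta> a m D"
    unfolding eventually_at_top_linorder by blast
  show ?thesis
  proof (rule exI[of _ "nat \<lceil>N\<rceil>"], intro allI impI, elim conjE)
    fix D :: real and G :: "('v, 'e) multi_hypergraph" and H :: "'e set set"
    assume "real (nat \<lceil>N\<rceil>) \<le> D"
    then have "N \<le> D" by linarith
    then have large: "large_degree r g \<beta> a m D" by (rule N)
    then have l: "1 \<le> ln D" by (simp add: large_degree_def)
    assume G: "finite_multi_hypergraph G" "uniform r G" and reg: "approx_regular (D powr (- \<beta>)) D G"
      and cod: "\<forall>u\<in>verts G. \<forall>v\<in>verts G. u \<noteq> v \<longrightarrow> real (codegree G u v) \<le> (ln D)\<^sup>2"
      and H: "configuration_hypergraph G H" "bounded_hypergraph g H" "5 \<le> girth H"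
      and deg: "\<forall>i. 2 \<le> i \<and> i \<le> g \<longrightarrow>
          real (max_size_degree (edges G) H i) \<le> \<beta> / (4 * (real g)\<^sup>2) * D ^ (i - 1) * ln D"
      and ccod: "real (max_config_codegree G H) \<le> (ln D) ^ (2 * (g - 1))"
    have l2: "(ln D)\<^sup>2 \<le> ln D ^ m" using l assms(2) by (intro power_increasing) (auto simp: m_def)
    interpret bounded_configuration G H r g "ln D ^ m" "ln D ^ m"
    proof
      show "real (codegree G u v) \<le> ln D ^ m" if "u \<in> verts G" "v \<in> verts G" "u \<noteq> v" for u v
        using cod that l2 by (meson order_trans)
      show "real (config_codegree G H v e) \<le> ln D ^ m"
        if "v \<in> verts G" "e \<in> edges G" "v \<notin> ends G e" for v e
      proof -
        have "config_codegree G H v e \<le> max_config_codegree G H"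
          by (rule config_codegree_le_max[OF G(1) that])
        then have "real (config_codegree G H v e) \<le> real (max_config_codegree G H)" by simp
        then show ?thesis using ccod unfolding m_def by linarith
      qed
    qed (use G H assms l in auto)
    have "real (size_degree H i e) \<le> \<beta> / (4 * (real g)\<^sup>2) * D ^ (i - 1) * ln D"
      if "e \<in> edges G" "2 \<le> i" "i \<le> g" for e i
    proof -
      have "real (size_degree H i e) \<le> real (max_size_degree (edges G) H i)"
        using size_degree_le_max[OF finite_edges that(1)] by simp
      also have "\<dots> \<le> \<beta> / (4 * (real g)\<^sup>2) * D ^ (i - 1) * ln D" using deg that by blast
      finally show ?thesis .
    qed
    from almost_perfect_matching[OF large assms(3) a refl refl reg this]
    show "\<exists>M. matching G M \<and> avoiding H M \<and>
          real (card M) \<ge> real (card (verts G)) / real r * (1 - D powr (- (\<beta> / (16 * real r))))"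
      unfolding a_def .
  qed
qed

end
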